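(* Let $\mu>0$, $\frac65\le p<\infty$, and let $(f,u)$ be a sufficiently regular solution on $[0,\infty)$ (in the sense of the context) of $$\partial_t f+v\cdot\nabla_x f+\nabla_v\cdot((u-v)f)=0,$$ $$\partial_t u+(u\cdot\nabla_x)u+\nabla_x\pi-\mathrm{div}_x(\tau(Du))=-\int_{\mathbb R^3}(u-v)f\,dv,\qquad \mathrm{div}_x u=0$$ on $\mathbb T^3\times\mathbb R^3$. Assume that $$\int_{\mathbb R^3}f\,dv\in L^\infty(0,\infty;L^r(\mathbb T^3))$$ for some $r$ with $$r\in\begin{cases}[\tfrac{6}{5p-6},\infty] & \text{if } \tfrac65\le p<2,\\ [\tfrac{3p}{5p-6},\infty] & \text{if } 2\le p<3,\\ (1,\infty] & \text{if } p=3,\\ [1,\infty] & \text{if } p>3,\end{cases}$$ where for $p=\frac65$ the condition means $r=\infty$. Let $$\mathcal E(t)=\frac12\iint_{\mathbb T^3\times\mathbb R^3}|v-v_c|^2f\,dx\,dv+\frac12\int_{\mathbb T^3}|u-u_c|^2\,dx+\frac14|u_c-v_c|^2,$$ with $v_c(t)=\iint_{\mathbb T^3\times\mathbb R^3}vf\,dx\,dv$ and $u_c(t)=\int_{\mathbb T^3}u\,dx$. Then there is a constant $C_0>0$ independent of $t$ such that for all $t\ge0$ $$\mathcal E(t)\le\begin{cases}\Big(\mathcal E(0)^{\frac{2-p}{2}}+C_0\big(\tfrac p2-1\big)t\Big)^{-\frac{2}{p-2}} & \text{if } p>2,\\[2mm] \mathcal E(0)\,e^{-C_0t} & \text{if }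 \tfrac65\le p\le2,\end{cases}$$ where for $p>2$ the right-hand side is read as $0$ if $\mathcal E(0)=0$.
   Context: $\mathbb T^3$ is the three-dimensional flat torus of total measure $1$. The unknowns are $f=f(t,x,v)\ge0$, $u=u(t,x)\in\mathbb R^3$ and the pressure $\pi=\pi(t,x)$. $Du=(\nabla_x u+\nabla_x^{T}u)/2$ and $\tau(Du)=\mu|Du|^{p-2}Du$ (read as $0$ where $Du=0$). The total particle mass is normalized: $\iint_{\mathbb T^3\times\mathbb R^3}f\,dx\,dv=\iint_{\mathbb T^3\times\mathbb R^3}f(0)\,dx\,dv=1$ for all $t\ge0$. "Sufficiently regular solution" may be taken to mean: a classical solution (all terms of the system are defined and continuous and the equations hold pointwise), with finite second velocity moment $\iint|v|^2f\,dx\,dv<\infty$, satisfying the energy balance for every $t\ge0$: $$\iint\frac{|v|^2}{2}f(t)\,dv\,dx+\int_{\mathbb T^3}\frac{|u(t)|^2}{2}\,dx+\int_0^t\int_{\mathbb T^3}\mu|Du|^p\,dx\,ds+\int_0^t\iint|u-v|^2f\,dv\,dx\,ds=\iint\frac{|v|^2}{2}f(0)\,dv\,dx+\int_{\mathbb T^3}\frac{|u(0)|^2}{2}\,dx .$$ The constant $C_0$ may depend on the solution, $p$, $\mu$, $r$, but not on $t$. *)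

theory Defs
  imports "HOL-Analysis.Analysis"
begin

section \<open>The torus and phase space\<close>

text \<open>
  Functions on the flat torus are the \<open>\<int>\<^sup>3\<close>-periodic functions on \<open>real^3\<close>; integration over the
  torus is Lebesgue integration over the unit cube, so the torus has total measure 1.
\<close>

definition periodic :: "(real^3 \<Rightarrow> 'a) \<Rightarrow> bool" where
  "periodic g \<longleftrightarrow> (\<forall>x i. g (x + axis i 1) = g x)"

definition torus :: "(real^3) measure" where
  "torus = restrict_space lborel (cbox 0 1)"

definition phase :: "((real^3) \<times> (real^3)) measure" where
  "phase = torus \<Otimes>\<^sub>M lborel"

section \<open>Differential operators\<close>

text \<open>Time runs over \<open>[0,\<infinity>)\<close>; at \<open>t = 0\<close> the time derivative is the right derivative.\<close>

definition dt_exists :: "(real \<Rightarrow> 'a::real_normed_vector) \<Rightarrow> real \<Rightarrow> bool" where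
  "dt_exists g t \<longleftrightarrow> g differentiable (at t within {0..})"

definition dt :: "(real \<Rightarrow> 'a::real_normed_vector) \<Rightarrow> real \<Rightarrow> 'a" where
  "dt g t = vector_derivative g (at t within {0..})"

definition partial_exists :: "3 \<Rightarrow> (real^3 \<Rightarrow> real) \<Rightarrow> real^3 \<Rightarrow> bool" where
  "partial_exists i g x \<longleftrightarrow> (\<lambda>h. g (x + h *\<^sub>R axis i 1)) differentiable (at 0)"

definition partial :: "3 \<Rightarrow> (real^3 \<Rightarrow> real) \<Rightarrow> real^3 \<Rightarrow> real" where
  "partial i g x = vector_derivative (\<lambda>h. g (x + h *\<^sub>R axis i 1)) (at 0)"

definition grad :: "(real^3 \<Rightarrow> real) \<Rightarrow> real^3 \<Rightarrow> real^3" where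
  "grad g x = (\<chi> i. partial i g x)"

definition dvg :: "(real^3 \<Rightarrow> real^3) \<Rightarrow> real^3 \<Rightarrow> real" where
  "dvg F x = (\<Sum>i\<in>UNIV. partial i (\<lambda>y. F y $ i) x)"

definition dvg_mat :: "(real^3 \<Rightarrow> real^3^3) \<Rightarrow> real^3 \<Rightarrow> real^3" where
  "dvg_mat S x = (\<chi> i. dvg (\<lambda>y. S y $ i) x)"

definition jac :: "(real^3 \<Rightarrow> real^3) \<Rightarrow> real^3 \<Rightarrow> real^3^3" where
  "jac w x = (\<chi> i j. partial j (\<lambda>y. w y $ i) x)"

definition sym_grad :: "(real^3 \<Rightarrow> real^3) \<Rightarrow> real^3 \<Rightarrow> real^3^3" where
  "sym_grad w x = (1/2) *\<^sub>R (jac w x + transpose (jac w x))"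

text \<open>
  The norm on \<open>real^3^3\<close> is the Frobenius norm. The expression below is \<open>0\<close> at \<open>A = 0\<close> for every
  exponent, which is the convention for the power-law stress.
\<close>

definition stress :: "real \<Rightarrow> real \<Rightarrow> real^3^3 \<Rightarrow> real^3^3" where
  "stress \<mu> p A = (\<mu> * norm A powr (p - 2)) *\<^sub>R A"

section \<open>Classical solutions\<close>

definition drag :: "(real \<Rightarrow> real^3 \<Rightarrow> real^3 \<Rightarrow> real) \<Rightarrow> (real \<Rightarrow> real^3 \<Rightarrow> real^3) \<Rightarrow> real \<Rightarrow> real^3 \<Rightarrow> real^3"
  where "drag f u t x = (LINT v|lborel. f t x v *\<^sub>R (u t x - v))"

text \<open>
  A classical solution: every partial derivative occurring in the system exists and is jointly
  continuous up to \<open>t = 0\<close>, the velocity integral in the drag force converges absolutely at every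
  point and depends continuously on it, and the equations hold pointwise.
\<close>

definition kinetic_regular ::
  "(real \<Rightarrow> real^3 \<Rightarrow> real^3 \<Rightarrow> real) \<Rightarrow> (real \<Rightarrow> real^3 \<Rightarrow> real^3) \<Rightarrow> bool" where
  "kinetic_regular f u \<longleftrightarrow>
     continuous_on ({0..} \<times> UNIV \<times> UNIV) (\<lambda>(t, x, v). f t x v) \<and>
     (\<forall>t\<ge>0. \<forall>x v. dt_exists (\<lambda>s. f s x v) t) \<and>
     continuous_on ({0..} \<times> UNIV \<times> UNIV) (\<lambda>(t, x, v). dt (\<lambda>s. f s x v) t) \<and>
     (\<forall>i. (\<forall>t\<ge>0. \<forall>x v. partial_exists i (\<lambda>y. f t y v) x) \<and>
        continuous_on ({0..} \<times> UNIV \<times> UNIV) (\<lambda>(t, x, v). partial i (\<lambda>y. f t y v) x)) \<and>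
     (\<forall>i. (\<forall>t\<ge>0. \<forall>x v. partial_exists i (\<lambda>w. (f t x w *\<^sub>R (u t x - w)) $ i) v) \<and>
        continuous_on ({0..} \<times> UNIV \<times> UNIV)
          (\<lambda>(t, x, v). partial i (\<lambda>w. (f t x w *\<^sub>R (u t x - w)) $ i) v))"

definition fluid_regular ::
  "real \<Rightarrow> real \<Rightarrow> (real \<Rightarrow> real^3 \<Rightarrow> real^3 \<Rightarrow> real) \<Rightarrow> (real \<Rightarrow> real^3 \<Rightarrow> real^3) \<Rightarrow> (real \<Rightarrow> real^3 \<Rightarrow> real) \<Rightarrow> bool"
  where
  "fluid_regular \<mu> p f u \<pi> \<longleftrightarrow>
     continuous_on ({0..} \<times> UNIV) (\<lambda>(t, x). u t x) \<and>
     (\<forall>t\<ge>0. \<forall>x. dt_exists (\<lambda>s. u s x) t) \<and>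
     continuous_on ({0..} \<times> UNIV) (\<lambda>(t, x). dt (\<lambda>s. u s x) t) \<and>
     (\<forall>i j. (\<forall>t\<ge>0. \<forall>x. partial_exists j (\<lambda>y. u t y $ i) x) \<and>
        continuous_on ({0..} \<times> UNIV) (\<lambda>(t, x). partial j (\<lambda>y. u t y $ i) x)) \<and>
     (\<forall>i. (\<forall>t\<ge>0. \<forall>x. partial_exists i (\<pi> t) x) \<and>
        continuous_on ({0..} \<times> UNIV) (\<lambda>(t, x). partial i (\<pi> t) x)) \<and>
     (\<forall>i j. (\<forall>t\<ge>0. \<forall>x. partial_exists j (\<lambda>y. stress \<mu> p (sym_grad (u t) y) $ i $ j) x) \<and>
        continuous_on ({0..} \<times> UNIV)
          (\<lambda>(t, x). partial j (\<lambda>y. stress \<mu> p (sym_grad (u t) y) $ i $ j) x)) \<and>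
     (\<forall>t\<ge>0. \<forall>x. integrable lborel (\<lambda>v. f t x v *\<^sub>R (u t x - v))) \<and>
     continuous_on ({0..} \<times> UNIV) (\<lambda>(t, x). drag f u t x)"

definition kinetic_eq ::
  "(real \<Rightarrow> real^3 \<Rightarrow> real^3 \<Rightarrow> real) \<Rightarrow> (real \<Rightarrow> real^3 \<Rightarrow> real^3) \<Rightarrow> bool" where
  "kinetic_eq f u \<longleftrightarrow> (\<forall>t\<ge>0. \<forall>x v.
     dt (\<lambda>s. f s x v) t + v \<bullet> grad (\<lambda>y. f t y v) x + dvg (\<lambda>w. f t x w *\<^sub>R (u t x - w)) v = 0)"

definition fluid_eq ::
  "real \<Rightarrow> real \<Rightarrow> (real \<Rightarrow> real^3 \<Rightarrow> real^3 \<Rightarrow> real) \<Rightarrow> (real \<Rightarrow> real^3 \<Rightarrow> real^3) \<Rightarrow> (real \<Rightarrow> real^3 \<Rightarrow> real) \<Rightarrow> bool"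
  where
  "fluid_eq \<mu> p f u \<pi> \<longleftrightarrow> (\<forall>t\<ge>0. \<forall>x.
     dt (\<lambda>s. u s x) t + jac (u t) x *v u t x + grad (\<pi> t) x
       - dvg_mat (\<lambda>y. stress \<mu> p (sym_grad (u t) y)) x = - drag f u t x
     \<and> dvg (u t) x = 0)"

definition classical_solution ::
  "real \<Rightarrow> real \<Rightarrow> (real \<Rightarrow> real^3 \<Rightarrow> real^3 \<Rightarrow> real) \<Rightarrow> (real \<Rightarrow> real^3 \<Rightarrow> real^3) \<Rightarrow> (real \<Rightarrow> real^3 \<Rightarrow> real) \<Rightarrow> bool"
  where
  "classical_solution \<mu> p f u \<pi> \<longleftrightarrow>
     (\<forall>t\<ge>0. (\<forall>x v. 0 \<le> f t x v) \<and> (\<forall>v. periodic (\<lambda>x. f t x v)) \<and> periodic (u t) \<and> periodic (\<pi> t)) \<and>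
     kinetic_regular f u \<and> fluid_regular \<mu> p f u \<pi> \<and> kinetic_eq f u \<and> fluid_eq \<mu> p f u \<pi>"

section \<open>Mass, energy balance, sufficiently regular solutions\<close>

definition unit_mass :: "(real \<Rightarrow> real^3 \<Rightarrow> real^3 \<Rightarrow> real) \<Rightarrow> bool" where
  "unit_mass f \<longleftrightarrow> (\<forall>t\<ge>0. integrable phase (\<lambda>(x, v). f t x v) \<and> (LINT (x, v)|phase. f t x v) = 1)"

definition finite_second_moment :: "(real \<Rightarrow> real^3 \<Rightarrow> real^3 \<Rightarrow> real) \<Rightarrow> bool" where
  "finite_second_moment f \<longleftrightarrow> (\<forall>t\<ge>0. integrable phase (\<lambda>(x, v). (norm v)\<^sup>2 * f t x v))"

definition energy ::
  "(real \<Rightarrow> real^3 \<Rightarrow> real^3 \<Rightarrow> real) \<Rightarrow> (real \<Rightarrow> real^3 \<Rightarrow> real^3) \<Rightarrow> real \<Rightarrow> real" where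
  "energy f u t = (LINT (x, v)|phase. (norm v)\<^sup>2 / 2 * f t x v) + (LINT x|torus. (norm (u t x))\<^sup>2 / 2)"

definition viscous_dissipation :: "real \<Rightarrow> real \<Rightarrow> (real \<Rightarrow> real^3 \<Rightarrow> real^3) \<Rightarrow> real \<Rightarrow> real" where
  "viscous_dissipation \<mu> p u s = (LINT x|torus. \<mu> * norm (sym_grad (u s) x) powr p)"

definition drag_dissipation ::
  "(real \<Rightarrow> real^3 \<Rightarrow> real^3 \<Rightarrow> real) \<Rightarrow> (real \<Rightarrow> real^3 \<Rightarrow> real^3) \<Rightarrow> real \<Rightarrow> real" where
  "drag_dissipation f u s = (LINT (x, v)|phase. (norm (u s x - v))\<^sup>2 * f s x v)"

text \<open>
  The integrability clauses make the balance an identity between finite numbers: without them a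
  divergent time integral would be read as \<open>0\<close>.
\<close>

definition energy_balance ::
  "real \<Rightarrow> real \<Rightarrow> (real \<Rightarrow> real^3 \<Rightarrow> real^3 \<Rightarrow> real) \<Rightarrow> (real \<Rightarrow> real^3 \<Rightarrow> real^3) \<Rightarrow> bool" where
  "energy_balance \<mu> p f u \<longleftrightarrow> (\<forall>t\<ge>0.
     set_integrable lborel {0..t} (viscous_dissipation \<mu> p u) \<and>
     set_integrable lborel {0..t} (drag_dissipation f u) \<and>
     energy f u t + (LINT s:{0..t}|lborel. viscous_dissipation \<mu> p u s)
       + (LINT s:{0..t}|lborel. drag_dissipation f u s) = energy f u 0)"

definition sufficiently_regular_solution ::
  "real \<Rightarrow> real \<Rightarrow> (real \<Rightarrow> real^3 \<Rightarrow> real^3 \<Rightarrow> real) \<Rightarrow> (real \<Rightarrow> real^3 \<Rightarrow> real^3) \<Rightarrow> (real \<Rightarrow> real^3 \<Rightarrow> real) \<Rightarrow> bool"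
  where
  "sufficiently_regular_solution \<mu> p f u \<pi> \<longleftrightarrow>
     classical_solution \<mu> p f u \<pi> \<and> unit_mass f \<and> finite_second_moment f \<and> energy_balance \<mu> p f u"

section \<open>The integrability hypothesis on the density\<close>

definition particle_density :: "(real \<Rightarrow> real^3 \<Rightarrow> real^3 \<Rightarrow> real) \<Rightarrow> real \<Rightarrow> real^3 \<Rightarrow> real" where
  "particle_density f t x = (LINT v|lborel. f t x v)"

definition Lr_norm_le :: "ereal \<Rightarrow> (real^3 \<Rightarrow> real) \<Rightarrow> real \<Rightarrow> bool" where
  "Lr_norm_le r g M \<longleftrightarrow> g \<in> borel_measurable torus \<and>
     (if r = \<infinity> then (AE x in torus. \<bar>g x\<bar> \<le> M)
      else integrable torus (\<lambda>x. \<bar>g x\<bar> powr real_of_ereal r) \<and>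
           (LINT x|torus. \<bar>g x\<bar> powr real_of_ereal r) powr (1 / real_of_ereal r) \<le> M)"

definition Linf_Lr :: "ereal \<Rightarrow> (real \<Rightarrow> real^3 \<Rightarrow> real) \<Rightarrow> bool" where
  "Linf_Lr r g \<longleftrightarrow>
     (\<lambda>(t, x). g t x) \<in> borel_measurable (restrict_space lborel {0<..} \<Otimes>\<^sub>M torus) \<and>
     (\<exists>M. AE t in restrict_space lborel {0<..}. Lr_norm_le r (g t) M)"

text \<open>The case \<open>p = 6/5\<close> is listed separately because \<open>6/(5p - 6)\<close> is to be read as \<open>\<infinity>\<close> there.\<close>

definition admissible_exponent :: "real \<Rightarrow> ereal \<Rightarrow> bool" where
  "admissible_exponent p r \<longleftrightarrow>
     (if p = 6/5 then r = \<infinity>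
      else if p < 2 then ereal (6 / (5 * p - 6)) \<le> r
      else if p < 3 then ereal (3 * p / (5 * p - 6)) \<le> r
      else if p = 3 then 1 < r
      else 1 \<le> r)"

section \<open>The modulated energy\<close>

definition v_c :: "(real \<Rightarrow> real^3 \<Rightarrow> real^3 \<Rightarrow> real) \<Rightarrow> real \<Rightarrow> real^3" where
  "v_c f t = (LINT (x, v)|phase. f t x v *\<^sub>R v)"

definition u_c :: "(real \<Rightarrow> real^3 \<Rightarrow> real^3) \<Rightarrow> real \<Rightarrow> real^3" where
  "u_c u t = (LINT x|torus. u t x)"

definition modulated_energy ::
  "(real \<Rightarrow> real^3 \<Rightarrow> real^3 \<Rightarrow> real) \<Rightarrow> (real \<Rightarrow> real^3 \<Rightarrow> real^3) \<Rightarrow> real \<Rightarrow> real" where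
  "modulated_energy f u t =
     1/2 * (LINT (x, v)|phase. (norm (v - v_c f t))\<^sup>2 * f t x v)
     + 1/2 * (LINT x|torus. (norm (u t x - u_c u t))\<^sup>2)
     + 1/4 * (norm (u_c u t - v_c f t))\<^sup>2"

end

(*
  Total momentum u_c + v_c is conserved, so the modulated energy E differs from the energy by a
  constant and E(s) - E(t) is the integral over [s,t] of the total dissipation D (viscous plus drag).
  With w = u - u_c, expanding the squares gives E <= D_drag + int |w|^2 rho + (1/2) int |w|^2.
  It remains to bound int |w|^2 rho by the viscous dissipation, which yields E^max(1,p/2) <= C D for
  almost every t and hence, by monotonicity of E alone, the decay rates.

  The last bound needs Sobolev and Morrey inequalities in terms of the symmetric gradient.  Singular
  integrals are avoided: d . w is differentiated along the line in direction d only, which sees just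
  the symmetric gradient.  Averaging over closed lines in the directions e_i and e_i + e_j gives the
  Poincare-Korn inequality; for p < 3 a Gagliardo-Nirenberg argument over triples of such directions
  (with a Loomis-Whitney inequality for each triple) gives the critical Sobolev-Korn inequality; for
  p > 3 one averages over a full cube of directions.
*)
theory Submission
  imports Defs "HOL-Real_Asymp.Real_Asymp"
begin

text \<open>Three obstacles shape the argument. The energy enters only through an integrated balance
  and the density bound only for almost every time, so increments over short time steps take the
  place of a differential inequality. The exponents come from one Hoelder inequality: |w|^2 in
  L^(q/2) with q = 3p/(3-p) pairs with the density in L^s with s = 3p/(5p-6), which gives int |w|^2
  rho <= C V^(2/p) for V = int |Dw|^p. For p < 2 the power 1 of V is aimed at instead; trading 2-p
  powers of w for the energy bound yields it and raises the density exponent to (2/p) s = 6/(5p-6).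
  Finally, conservation of momentum needs the unbounded weight v, so the kinetic equation is tested
  with truncations of v_k; the drag dissipation, integrable in time by the energy balance, supplies
  the majorant that removes the truncation. All constants depend on the solution only through E(0)
  and the density bound, hence not on t.\<close>

section \<open>Integration on cubes\<close>

lemma cube_continuous_integral:
  fixes h :: "'a::euclidean_space \<Rightarrow> 'b::euclidean_space"
  assumes "continuous_on (cbox a b) h"
  shows "integrable (restrict_space lborel (cbox a b)) h"
    and "(LINT x|restrict_space lborel (cbox a b). h x) = integral (cbox a b) h"
proof -
  have *: "set_integrable lborel (cbox a b) h"
    unfolding set_integrable_def by (intro borel_integrable_compact compact_cbox assms)
  then show "integrable (restrict_space lborel (cbox a b)) h"
    by (simp add: integrable_restrict_space set_integrable_def)
  show "(LINT x|restrict_space lborel (cbox a b). h x) = integral (cbox a b) h"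
    using set_borel_integral_eq_integral(2)[OF *]
    by (simp add: integral_restrict_space set_lebesgue_integral_def)
qed

text \<open>Hoelder in interpolation form: with weights \<open>a + b = 1\<close> instead of
  conjugate exponents, every later use is a matter of writing an integrand as a product of powers.
  Young's inequality is applied to \<open>f\<close> and \<open>g\<close> normalized by their
  integrals; if one integral vanishes, the product is zero almost everywhere.\<close>

lemma Holder_inequality_weights:
  fixes f g :: "'a \<Rightarrow> real"
  assumes f: "integrable M f" "\<And>x. x \<in> space M \<Longrightarrow> 0 \<le> f x"
    and g: "integrable M g" "\<And>x. x \<in> space M \<Longrightarrow> 0 \<le> g x"
    and ab: "0 < a" "0 < b" "a + b = 1"
  shows "integrable M (\<lambda>x. f x powr a * g x powr b)"
    and "(LINT x|M. f x powr a * g x powr b) \<le> (LINT x|M. f x) powr a * (LINT x|M. g x) powr b"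
proof -
  have young: "y powr a * z powr b \<le> a * y + b * z" if "0 \<le> y" "0 \<le> z" for y z
    using Youngs_inequality_0[of a b y z] ab that by (cases "y = 0 \<or> z = 0") auto
  have [measurable]: "f \<in> borel_measurable M" "g \<in> borel_measurable M"
    using f(1) g(1) by auto
  show int: "integrable M (\<lambda>x. f x powr a * g x powr b)"
  proof (rule Bochner_Integration.integrable_bound)
    show "integrable M (\<lambda>x. a * f x + b * g x)"
      using f g by auto
    show "AE x in M. norm (f x powr a * g x powr b) \<le> norm (a * f x + b * g x)"
      using young f(2) g(2) ab by (intro AE_I2) (smt (verit) real_norm_def powr_ge_zero mult_nonneg_nonneg)
  qed measurable
  let ?F = "LINT x|M. f x" and ?G = "LINT x|M. g x"
  have F0: "0 \<le> ?F" and G0: "0 \<le> ?G"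
    using f(2) g(2) by (auto intro!: integral_nonneg_AE)
  show "(LINT x|M. f x powr a * g x powr b) \<le> ?F powr a * ?G powr b"
  proof (cases "?F = 0 \<or> ?G = 0")
    case True
    then have "AE x in M. f x powr a * g x powr b = 0"
    proof
      assume "?F = 0"
      then have "AE x in M. f x = 0"
        using integral_nonneg_eq_0_iff_AE[OF f(1)] f(2) by auto
      then show ?thesis by eventually_elim auto
    next
      assume "?G = 0"
      then have "AE x in M. g x = 0"
        using integral_nonneg_eq_0_iff_AE[OF g(1)] g(2) by auto
      then show ?thesis by eventually_elim auto
    qed
    then have "(LINT x|M. f x powr a * g x powr b) = 0"
      by (simp add: integral_eq_zero_AE)
    then show ?thesis by simp
  next
    case False
    with F0 G0 have pos: "?F > 0" "?G > 0" by auto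
    have "(LINT x|M. (f x / ?F) powr a * (g x / ?G) powr b) \<le> (LINT x|M. a * (f x / ?F) + b * (g x / ?G))"
    proof (rule integral_mono)
      have "(\<lambda>x. (f x / ?F) powr a * (g x / ?G) powr b) = (\<lambda>x. f x powr a * g x powr b / (?F powr a * ?G powr b))"
        using pos by (auto simp: powr_def ln_div fun_eq_iff)
          (auto simp: exp_diff right_diff_distrib exp_add abs_if)
      then show "integrable M (\<lambda>x. (f x / ?F) powr a * (g x / ?G) powr b)"
        using int by simp
      show "integrable M (\<lambda>x. a * (f x / ?F) + b * (g x / ?G))"
        using f g by auto
      show "(f x / ?F) powr a * (g x / ?G) powr b \<le> a * (f x / ?F) + b * (g x / ?G)"
        if "x \<in> space M" for x
        using young[of "f x / ?F" "g x / ?G"] f(2)[OF that] g(2)[OF that] pos by simp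
    qed
    also have "\<dots> = 1"
      using f g pos ab by (subst Bochner_Integration.integral_add) auto
    finally have 1: "(LINT x|M. (f x / ?F) powr a * (g x / ?G) powr b) \<le> 1" .
    have "(LINT x|M. (f x / ?F) powr a * (g x / ?G) powr b)
        = (LINT x|M. (1 / (?F powr a * ?G powr b)) * (f x powr a * g x powr b))"
      using f(2) g(2) pos
      by (intro Bochner_Integration.integral_cong) (auto simp: powr_divide)
    also have "\<dots> = (LINT x|M. f x powr a * g x powr b) / (?F powr a * ?G powr b)"
      by simp
    finally show ?thesis
      using 1 pos by (simp add: divide_le_eq)
  qed
qed

section \<open>Periodic functions\<close>

text \<open>The shifted cube is cut at the face \<open>x \<bullet> b = 1\<close>; the slab that
  sticks out, moved back by the period \<open>b\<close>, fills exactly the slab that was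
  vacated.\<close>

lemma integral_periodic_shift_step:
  fixes g :: "'a::euclidean_space \<Rightarrow> real"
  assumes b: "b \<in> Basis" and g: "continuous_on UNIV g" and per: "\<And>x. g (x + b) = g x"
    and s: "0 \<le> s" "s \<le> 1"
  shows "integral (cbox 0 One) (\<lambda>x. g (x + s *\<^sub>R b)) = integral (cbox 0 One) g"
proof -
  have shift: "integral (cbox u v) (\<lambda>x. g (x + c)) = integral (cbox (u + c) (v + c)) g" for u v c
  proof -
    have "(g has_integral integral (cbox (u + c) (v + c)) g) (cbox (u + c) (v + c))"
      by (intro integrable_integral integrable_continuous continuous_on_subset[OF g]) auto
    then show ?thesis
      using has_integral_shift_cbox_iff[of g c _ u v] by (auto simp: o_def add.commute intro!: integral_unique)
  qed
  have int: "g integrable_on cbox u v" for u v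
    by (intro integrable_continuous continuous_on_subset[OF g]) auto
  \<comment> \<open>All boxes of the argument have unit range in every direction except
    \<open>b\<close>, where the range is \<open>[l, r]\<close>; this description turns each identity
    between them into one about the coordinate along \<open>b\<close>.\<close>
  have box: "x \<in> cbox (l *\<^sub>R b) (One + (r - 1) *\<^sub>R b) \<longleftrightarrow>
      l \<le> x \<bullet> b \<and> x \<bullet> b \<le> r \<and> (\<forall>i\<in>Basis - {b}. 0 \<le> x \<bullet> i \<and> x \<bullet> i \<le> 1)" for x l r
  proof -
    have "b \<bullet> i = 0" if "i \<in> Basis - {b}" for i
      using b that by (auto simp: inner_Basis)
    then have "(\<forall>i\<in>Basis - {b}. (l *\<^sub>R b) \<bullet> i \<le> x \<bullet> i \<and> x \<bullet> i \<le> (One + (r - 1) *\<^sub>R b) \<bullet> i)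
        \<longleftrightarrow> (\<forall>i\<in>Basis - {b}. 0 \<le> x \<bullet> i \<and> x \<bullet> i \<le> 1)"
      by (intro ball_cong refl) (simp add: inner_add_left)
    moreover have "(\<forall>i\<in>Basis. P i) \<longleftrightarrow> P b \<and> (\<forall>i\<in>Basis - {b}. P i)" for P
      using b by blast
    ultimately show ?thesis
      unfolding mem_box using b by (simp add: inner_add_left)
  qed
  have "integral (cbox 0 One) (\<lambda>x. g (x + s *\<^sub>R b)) = integral (cbox (s *\<^sub>R b) (One + s *\<^sub>R b)) g"
    using shift[of 0 One "s *\<^sub>R b"] by simp
  also have "\<dots> = integral (cbox (s *\<^sub>R b) (One + s *\<^sub>R b) \<inter> {x. x \<bullet> b \<le> 1}) g
      + integral (cbox (s *\<^sub>R b) (One + s *\<^sub>R b) \<inter> {x. 1 \<le> x \<bullet> b}) g"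
    using integral_split[OF int b] by simp
  also have "cbox (s *\<^sub>R b) (One + s *\<^sub>R b) \<inter> {x. x \<bullet> b \<le> 1} = cbox 0 One \<inter> {x. s \<le> x \<bullet> b}"
    using s box[of _ s "1 + s"] box[of _ 0 1] by auto
  also have "cbox (s *\<^sub>R b) (One + s *\<^sub>R b) \<inter> {x. 1 \<le> x \<bullet> b} = cbox (0 + b) (One + (s - 1) *\<^sub>R b + b)"
    using s box[of _ s "1 + s"] box[of _ 1 "1 + s"] by (auto simp: algebra_simps)
  also have "integral (cbox (0 + b) (One + (s - 1) *\<^sub>R b + b)) g = integral (cbox 0 (One + (s - 1) *\<^sub>R b)) g"
    using shift[of 0 "One + (s - 1) *\<^sub>R b" b] per by simp
  also have "cbox 0 (One + (s - 1) *\<^sub>R b) = cbox 0 One \<inter> {x. x \<bullet> b \<le> s}"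
    using s box[of _ 0 s] box[of _ 0 1] by auto
  also have "integral (cbox 0 One \<inter> {x. s \<le> x \<bullet> b}) g + integral (cbox 0 One \<inter> {x. x \<bullet> b \<le> s}) g
      = integral (cbox 0 One) g"
    using integral_split[OF int b, of 0 One s] by simp
  finally show ?thesis .
qed

lemma integral_periodic_shift:
  fixes g :: "'a::euclidean_space \<Rightarrow> real"
  assumes b: "b \<in> Basis" and g: "continuous_on UNIV g" and per: "\<And>x. g (x + b) = g x"
  shows "integral (cbox 0 One) (\<lambda>x. g (x + s *\<^sub>R b)) = integral (cbox 0 One) g"
proof -
  have nat: "g (x + real n *\<^sub>R b) = g x" for x n
  proof (induction n arbitrary: x)
    case (Suc n)
    have "g (x + real (Suc n) *\<^sub>R b) = g ((x + real n *\<^sub>R b) + b)"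
      by (simp add: algebra_simps)
    then show ?case using Suc per by simp
  qed simp
  have int: "g (x + of_int k *\<^sub>R b) = g x" for x and k :: int
  proof (cases "k \<ge> 0")
    case True
    then show ?thesis using nat[of x "nat k"] by simp
  next
    case False
    then show ?thesis
      using nat[of "x + of_int k *\<^sub>R b" "nat (- k)"] by simp
  qed
  have "g (x + s *\<^sub>R b) = g (x + frac s *\<^sub>R b)" for x
    using int[of "x + frac s *\<^sub>R b" "floor s"]
    by (simp add: frac_def scaleR_left_diff_distrib)
  then have "integral (cbox 0 One) (\<lambda>x. g (x + s *\<^sub>R b)) = integral (cbox 0 One) (\<lambda>x. g (x + frac s *\<^sub>R b))"
    by simp
  also have "\<dots> = integral (cbox 0 One) g"
    by (rule integral_periodic_shift_step[OF b g per]) (auto simp: frac_lt_1 less_imp_le)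
  finally show ?thesis .
qed

lemma One_vec: "(One :: real^3) = 1"
proof -
  have "(1 :: real^3) = (\<chi> i. 1)" by (simp add: vec_eq_iff)
  then show ?thesis using const_vector_cart[of 1, where 'n=3] by simp
qed

lemma torus_integrable:
  fixes h :: "real^3 \<Rightarrow> 'b::euclidean_space"
  shows "continuous_on UNIV h \<Longrightarrow> integrable torus h"
  unfolding torus_def by (intro cube_continuous_integral) (auto intro: continuous_on_subset)

lemma torus_integral:
  fixes h :: "real^3 \<Rightarrow> 'b::euclidean_space"
  shows "continuous_on UNIV h \<Longrightarrow> (LINT x|torus. h x) = integral (cbox 0 1) h"
  unfolding torus_def by (intro cube_continuous_integral) (auto intro: continuous_on_subset)

lemma measure_unit_cube: "measure lborel (cbox 0 1 :: (real^3) set) = 1"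
  using content_cbox_if[of "0::real^3" One] by (simp add: One_vec[symmetric])

lemma torus_const [simp]: "(LINT x|torus. c) = (c::'b::euclidean_space)"
  using torus_integral[OF continuous_on_const, of c] by (simp only: integral_const measure_unit_cube scaleR_one)

lemma measure_torus [simp]: "measure torus (space torus) = 1"
  using torus_const[of "1::real"] by (simp del: torus_const)

text \<open>The working class of scalar functions. It is closed under all operations used below,
  including shifts and line averages, so integrability side conditions reduce to
  \<open>cper_intros\<close>.\<close>

definition cper :: "(real^3 \<Rightarrow> real) \<Rightarrow> bool" where
  "cper g \<longleftrightarrow> continuous_on UNIV g \<and> periodic g"

lemma cper_cont: "cper g \<Longrightarrow> continuous_on S g"
  by (auto simp: cper_def intro: continuous_on_subset)

lemma cper_integrable: "cper g \<Longrightarrow> integrable torus g"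
  by (simp add: cper_cont torus_integrable)

lemma cper_const: "cper (\<lambda>x. c)"
  by (simp add: cper_def periodic_def)

lemma cper_add: "cper g \<Longrightarrow> cper h \<Longrightarrow> cper (\<lambda>x. g x + h x)"
  by (auto simp: cper_def periodic_def intro!: continuous_intros)

lemma cper_diff: "cper g \<Longrightarrow> cper h \<Longrightarrow> cper (\<lambda>x. g x - h x)"
  by (auto simp: cper_def periodic_def intro!: continuous_intros)

lemma cper_mult: "cper g \<Longrightarrow> cper h \<Longrightarrow> cper (\<lambda>x. g x * h x)"
  by (auto simp: cper_def periodic_def intro!: continuous_intros)

lemma cper_abs: "cper g \<Longrightarrow> cper (\<lambda>x. \<bar>g x\<bar>)"
  by (auto simp: cper_def periodic_def intro!: continuous_intros)

lemma cper_powr: "cper g \<Longrightarrow> (\<And>x. 0 \<le> g x) \<Longrightarrow> 0 < a \<Longrightarrow> cper (\<lambda>x. g x powr a)"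
  unfolding cper_def periodic_def by (auto intro: continuous_on_powr'[OF _ continuous_on_const])

lemmas cper_intros = cper_const cper_add cper_diff cper_mult cper_abs cper_powr

lemma periodic_shift:
  assumes "periodic g"
  shows "g (x + axis i 1 + z) = g (x + z)"
proof -
  have "x + axis i 1 + z = (x + z) + axis i 1" by (simp add: algebra_simps)
  then show ?thesis using assms unfolding periodic_def by metis
qed

lemma torus_shift:
  assumes g: "cper g"
  shows "(LINT x|torus. g (x + z)) = (LINT x|torus. g x)"
proof -
  have c: "continuous_on UNIV (\<lambda>x. g (x + z))" for z
    by (rule continuous_on_compose2[OF cper_cont[OF g, of UNIV]]) (auto intro!: continuous_intros)
  have step: "(LINT x|torus. g (x + (y + s *\<^sub>R axis i 1))) = (LINT x|torus. g (x + y))" for y s i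
  proof -
    have "g (x + axis i 1 + y) = g (x + y)" for x
      using g periodic_shift[of g] unfolding cper_def by simp
    then show ?thesis
      using integral_periodic_shift[of "axis i 1" "\<lambda>x. g (x + y)" s] c[of y]
        c[of "y + s *\<^sub>R axis i 1"]
      by (simp add: One_vec torus_integral axis_in_Basis_iff add_ac)
  qed
  have "z = 0 + (z$1) *\<^sub>R axis 1 1 + (z$2) *\<^sub>R axis 2 1 + (z$3) *\<^sub>R axis 3 1"
    by (simp add: vec_eq_iff forall_3 axis_def)
  then show ?thesis
    using step[of 0 "z$1" 1] step[of "(z$1) *\<^sub>R axis 1 1" "z$2" 2]
      step[of "(z$1) *\<^sub>R axis 1 1 + (z$2) *\<^sub>R axis 2 1" "z$3" 3]
    by simp
qed

section \<open>Averages along closed lines\<close>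

text \<open>Lattice vectors, described by their effect on periodic functions; the ones that occur
  are coordinate axes and sums of two of them.\<close>

definition period_vector :: "real^3 \<Rightarrow> bool" where
  "period_vector d \<longleftrightarrow> (\<forall>g :: real^3 \<Rightarrow> real. periodic g \<longrightarrow> (\<forall>x. g (x + d) = g x))"

lemma period_vector_axis: "period_vector (axis i 1)"
  by (auto simp: period_vector_def periodic_def)

lemma period_vector_add: "period_vector c \<Longrightarrow> period_vector d \<Longrightarrow> period_vector (c + d)"
  unfolding period_vector_def by (metis add.assoc)

text \<open>The mean over the segment from \<open>x\<close> to \<open>x + d\<close>. For a period
  vector \<open>d\<close> it is the mean over a closed line of the torus; the Morrey argument also
  uses it for general \<open>d\<close>.\<close>

definition avg :: "real^3 \<Rightarrow> (real^3 \<Rightarrow> real) \<Rightarrow> real^3 \<Rightarrow> real" where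
  "avg d g x = integral {0..1} (\<lambda>t. g (x + t *\<^sub>R d))"

definition invariant_along :: "real^3 \<Rightarrow> (real^3 \<Rightarrow> real) \<Rightarrow> bool" where
  "invariant_along d g \<longleftrightarrow> (\<forall>x s. g (x + s *\<^sub>R d) = g x)"

lemma line_cont:
  assumes "cper g"
  shows "continuous_on S (\<lambda>t. g (x + t *\<^sub>R d))"
  by (rule continuous_on_compose2[OF cper_cont[OF assms, of UNIV]]) (auto intro!: continuous_intros)

lemma line_integrable: "cper g \<Longrightarrow> (\<lambda>t. g (x + t *\<^sub>R d)) integrable_on {a..b}"
  by (intro integrable_continuous_interval line_cont)

lemma cper_shift:
  assumes "cper g"
  shows "cper (\<lambda>x. g (x + z))"
proof -
  have "continuous_on UNIV (\<lambda>x. g (x + z))"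
    by (rule continuous_on_compose2[OF cper_cont[OF assms, of UNIV]]) (auto intro!: continuous_intros)
  moreover have "periodic (\<lambda>x. g (x + z))"
    using assms periodic_shift[of g] unfolding cper_def periodic_def[of "\<lambda>x. g (x + z)"] by simp
  ultimately show ?thesis by (simp add: cper_def)
qed



lemma avg_cper:
  assumes g: "cper g"
  shows "cper (avg d g)"
proof -
  have "continuous_on UNIV (\<lambda>x. integral (cbox 0 1) (\<lambda>t::real. g (x + t *\<^sub>R d)))"
    by (rule integral_continuous_on_param)
      (auto simp: split_beta intro!: continuous_intros continuous_on_compose2[OF cper_cont[OF g, of UNIV]])
  moreover have "periodic (avg d g)"
    using g periodic_shift[of g] unfolding cper_def periodic_def[of "avg d g"] avg_def by simp
  ultimately show ?thesis by (simp add: cper_def avg_def[abs_def])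
qed

lemma avg_mono: "cper g \<Longrightarrow> cper h \<Longrightarrow> (\<And>x. g x \<le> h x) \<Longrightarrow> avg d g x \<le> avg d h x"
  unfolding avg_def by (intro integral_le line_integrable) auto

lemma avg_nonneg: "cper g \<Longrightarrow> (\<And>x. 0 \<le> g x) \<Longrightarrow> 0 \<le> avg d g x"
  unfolding avg_def by (intro integral_nonneg line_integrable) auto

lemma avg_add: "cper g \<Longrightarrow> cper h \<Longrightarrow> avg d (\<lambda>x. g x + h x) x = avg d g x + avg d h x"
  unfolding avg_def by (intro integral_add line_integrable)

lemma avg_diff: "cper g \<Longrightarrow> cper h \<Longrightarrow> avg d (\<lambda>x. g x - h x) x = avg d g x - avg d h x"
  unfolding avg_def by (intro integral_diff line_integrable)

lemma avg_cmult: "avg d (\<lambda>x. c * g x) x = c * avg d g x"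
  unfolding avg_def by simp

lemma avg_const [simp]: "avg d (\<lambda>x. c) x = c"
  by (simp add: avg_def)

lemma avg_abs_le:
  assumes "cper g" "cper h" "\<And>x. \<bar>g x\<bar> \<le> h x"
  shows "\<bar>avg d g x\<bar> \<le> avg d h x"
  unfolding avg_def using assms
  by (subst real_norm_def[symmetric], intro integral_norm_bound_integral line_integrable) auto

lemma avg_Holder:
  assumes "cper g" "\<And>x. 0 \<le> g x" "cper h" "\<And>x. 0 \<le> h x" "0 < a" "0 < b" "a + b = 1"
  shows "avg d (\<lambda>x. g x powr a * h x powr b) x \<le> avg d g x powr a * avg d h x powr b"
proof -
  let ?I = "restrict_space lborel (cbox 0 1 :: real set)"
  have eq: "avg d k x = (LINT t|?I. k (x + t *\<^sub>R d))" if "cper k" for k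
    using cube_continuous_integral(2)[of 0 1 "\<lambda>t. k (x + t *\<^sub>R d)"] line_cont[OF that]
    by (simp add: avg_def)
  have int: "integrable ?I (\<lambda>t. k (x + t *\<^sub>R d))" if "cper k" for k
    using cube_continuous_integral(1)[of 0 1 "\<lambda>t. k (x + t *\<^sub>R d)"] line_cont[OF that] by simp
  show ?thesis
    using Holder_inequality_weights(2)[of ?I "\<lambda>t. g (x + t *\<^sub>R d)" "\<lambda>t. h (x + t *\<^sub>R d)" a b]
      assms int eq by (simp add: cper_intros)
qed

lemma avg_Jensen:
  assumes g: "cper g" "\<And>x. 0 \<le> g x" and p: "1 \<le> p"
  shows "avg d g x powr p \<le> avg d (\<lambda>x. g x powr p) x"
proof (cases "p = 1")
  case True
  then show ?thesis using avg_nonneg[OF g] g by simp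
next
  case False
  with p have p1: "p > 1" by simp
  have c: "cper (\<lambda>x. g x powr p)" using g p1 by (intro cper_powr) auto
  have "avg d g x = avg d (\<lambda>x. (g x powr p) powr (1/p) * 1 powr (1 - 1/p)) x"
    using g p1 by (simp add: powr_powr)
  also have "\<dots> \<le> avg d (\<lambda>x. g x powr p) x powr (1/p) * avg d (\<lambda>x. 1) x powr (1 - 1/p)"
    using p1 by (intro avg_Holder c cper_const) (auto simp: field_simps)
  finally have "avg d g x \<le> avg d (\<lambda>x. g x powr p) x powr (1/p)" by simp
  then have "avg d g x powr p \<le> (avg d (\<lambda>x. g x powr p) x powr (1/p)) powr p"
    using p1 avg_nonneg[OF g] by (intro powr_mono2) auto
  also have "\<dots> = avg d (\<lambda>x. g x powr p) x"
    using p1 avg_nonneg[OF c] by (simp add: powr_powr)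
  finally show ?thesis .
qed

lemma avg_commute:
  assumes "cper g"
  shows "avg c (avg d g) x = avg d (avg c g) x"
proof -
  have "continuous_on (cbox (0, 0) (1, 1)) (\<lambda>(s::real, t::real). g (x + s *\<^sub>R c + t *\<^sub>R d))"
    by (auto simp: split_beta intro!: continuous_intros continuous_on_compose2[OF cper_cont[OF assms, of UNIV]])
  from integral_swap_continuous[OF this] show ?thesis
    by (simp add: avg_def add_ac)
qed

lemma torus_avg:
  assumes g: "cper g"
  shows "(LINT x|torus. avg d g x) = (LINT x|torus. g x)"
proof -
  have "continuous_on (cbox (0, 0) (1, 1)) (\<lambda>(x::real^3, t::real). g (x + t *\<^sub>R d))"
    by (auto simp: split_beta intro!: continuous_intros continuous_on_compose2[OF cper_cont[OF g, of UNIV]])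
  from integral_swap_continuous[OF this]
  have "(LINT x|torus. avg d g x) = integral {0..1} (\<lambda>t. integral (cbox 0 1) (\<lambda>x. g (x + t *\<^sub>R d)))"
    using torus_integral[OF cper_cont[OF avg_cper[OF g]], of d] by (simp add: avg_def[abs_def])
  also have "\<dots> = integral {0..1} (\<lambda>t::real. LINT x|torus. g x)"
    using torus_integral[OF cper_cont[OF cper_shift[OF g]]] torus_shift[OF g] by simp
  finally show ?thesis by simp
qed

lemma avg_invariant:
  assumes g: "cper g" and d: "period_vector d"
  shows "invariant_along d (avg d g)"
  unfolding invariant_along_def
proof (intro allI)
  fix x s
  have "g (x + (t + 1) *\<^sub>R d) = g (x + t *\<^sub>R d)" for t
    using g d unfolding period_vector_def cper_def by (simp add: scaleR_left_distrib add.assoc[symmetric])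
  then show "avg d g (x + s *\<^sub>R d) = avg d g x"
    using integral_periodic_shift[of "1::real" "\<lambda>t. g (x + t *\<^sub>R d)" s] line_cont[OF g]
    by (simp add: avg_def scaleR_left_distrib add_ac)
qed

lemma invariant_along_avg:
  assumes "invariant_along c g"
  shows "invariant_along c (avg d g)"
proof -
  have "g (x + s *\<^sub>R c + t *\<^sub>R d) = g (x + t *\<^sub>R d)" for x s t
  proof -
    have "x + s *\<^sub>R c + t *\<^sub>R d = (x + t *\<^sub>R d) + s *\<^sub>R c" by (simp add: algebra_simps)
    then show ?thesis using assms unfolding invariant_along_def by metis
  qed
  then show ?thesis by (simp add: invariant_along_def[of c "avg d g"] avg_def)
qed



lemma avg_mult_invariant: "invariant_along d g \<Longrightarrow> avg d (\<lambda>x. g x * h x) x = g x * avg d h x"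
  unfolding invariant_along_def avg_def by simp

text \<open>A shear: once a function is constant along \<open>c\<close>, averaging it along
  \<open>c + d\<close> is averaging along \<open>d\<close>. This is how directions such as e_i + e_j
  produce ordinary plane averages.\<close>

lemma avg_add_dir: "invariant_along c g \<Longrightarrow> avg (c + d) g x = avg d g x"
proof -
  assume "invariant_along c g"
  have "g (x + t *\<^sub>R (c + d)) = g (x + t *\<^sub>R d)" for t
  proof -
    have "x + t *\<^sub>R (c + d) = (x + t *\<^sub>R d) + t *\<^sub>R c" by (simp add: algebra_simps)
    then show ?thesis
      using \<open>invariant_along c g\<close> unfolding invariant_along_def by metis
  qed
  then show ?thesis by (simp add: avg_def)
qed

definition spanning :: "real^3 \<Rightarrow> real^3 \<Rightarrow> real^3 \<Rightarrow> bool" where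
  "spanning a b c \<longleftrightarrow> (\<forall>x. \<exists>r s t. x = r *\<^sub>R a + s *\<^sub>R b + t *\<^sub>R c)"

text \<open>The iterated average is invariant along three spanning directions, hence constant, and a
  constant equals its own torus mean, which averaging preserves. No change of variables for skew
  directions is involved.\<close>

lemma triple_avg:
  assumes g: "cper g" and d: "period_vector a" "period_vector b" "period_vector c"
    and sp: "spanning a b c"
  shows "avg a (avg b (avg c g)) x = (LINT x|torus. g x)"
proof -
  let ?h = "avg a (avg b (avg c g))"
  note cp = avg_cper g
  have 1: "invariant_along a ?h" by (intro avg_invariant cp d)
  have 2: "invariant_along b ?h" by (intro invariant_along_avg avg_invariant cp d)
  have 3: "invariant_along c ?h" by (intro invariant_along_avg avg_invariant cp d)
  have const: "?h x = ?h 0" for x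
  proof -
    obtain r s t where "x = r *\<^sub>R a + s *\<^sub>R b + t *\<^sub>R c"
      using sp spanning_def by blast
    then show ?thesis
      using 1[unfolded invariant_along_def, rule_format, of 0 r]
        2[unfolded invariant_along_def, rule_format, of "r *\<^sub>R a" s]
        3[unfolded invariant_along_def, rule_format, of "r *\<^sub>R a + s *\<^sub>R b" t] by simp
  qed
  have "?h x = (LINT y|torus. ?h y)"
    by (subst (2) ext[OF const]) (simp only: torus_const const[of x])
  also have "\<dots> = (LINT x|torus. g x)"
    by (simp add: torus_avg cp)
  finally show ?thesis .
qed

lemma torus_integral_mono:
  fixes g h :: "real^3 \<Rightarrow> real"
  shows "cper g \<Longrightarrow> cper h \<Longrightarrow> (\<And>x. g x \<le> h x) \<Longrightarrow> (LINT x|torus. g x) \<le> (LINT x|torus. h x)"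
  by (intro integral_mono cper_integrable)

lemma torus_integral_nonneg: "(\<And>x. 0 \<le> g x) \<Longrightarrow> 0 \<le> (LINT x|torus. g x :: real)"
  by (intro integral_nonneg_AE) auto

lemma torus_Holder:
  assumes "cper g" "\<And>x. 0 \<le> g x" "cper h" "\<And>x. 0 \<le> h x" "0 < a" "0 < b" "a + b = 1"
  shows "(LINT x|torus. g x powr a * h x powr b) \<le> (LINT x|torus. g x) powr a * (LINT x|torus. h x) powr b"
  using assms by (intro Holder_inequality_weights cper_integrable)

text \<open>Averaging first along \<open>c\<close> separates the factor that is constant along \<open>c\<close>; in the remaining
  product one factor is constant along both \<open>c\<close> and \<open>a\<close>.\<close>

lemma Loomis_Whitney_avg:
  assumes G: "cper G" "\<And>x. 0 \<le> G x"
    and d: "period_vector a" "period_vector b" "period_vector c"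
    and sp: "spanning a b c"
  shows "(LINT x|torus. avg a G x powr (1/2) * avg b G x powr (1/2) * avg c G x powr (1/2))
    \<le> (LINT x|torus. G x) powr (3/2)"
proof -
  let ?I = "LINT x|torus. G x"
  have I0: "0 \<le> ?I" using G by (simp add: torus_integral_nonneg)
  have cp: "cper (avg e G)" "\<And>x. 0 \<le> avg e G x" for e
    using G by (auto intro: avg_cper avg_nonneg)
  have cp2: "cper (avg e (avg e' G))" "\<And>x. 0 \<le> avg e (avg e' G) x" for e e'
    using cp by (auto intro: avg_cper avg_nonneg)
  have sq: "cper (\<lambda>x. avg e G x powr (1/2))" for e
    using cp by (intro cper_powr) auto
  have inv_c: "invariant_along c (\<lambda>x. avg c G x powr (1/2))"
    using avg_invariant[OF G(1) d(3)] by (simp add: invariant_along_def)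
  have inv_a: "invariant_along a (avg c (avg a G))"
    by (intro invariant_along_avg avg_invariant G d)
  have "(LINT x|torus. avg a G x powr (1/2) * avg b G x powr (1/2) * avg c G x powr (1/2))
      = (LINT x|torus. avg c G x powr (1/2) * (avg a G x powr (1/2) * avg b G x powr (1/2)))"
    by (simp add: mult_ac)
  also have "\<dots> = (LINT x|torus. avg c (\<lambda>x. avg c G x powr (1/2) * (avg a G x powr (1/2) * avg b G x powr (1/2))) x)"
    by (intro torus_avg[symmetric] cper_mult sq)
  also have "\<dots> = (LINT x|torus. avg c G x powr (1/2) * avg c (\<lambda>x. avg a G x powr (1/2) * avg b G x powr (1/2)) x)"
    using avg_mult_invariant[OF inv_c] by simp
  also have "\<dots> \<le> (LINT x|torus. avg c G x powr (1/2) * (avg c (avg a G) x * avg c (avg b G) x) powr (1/2))"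
  proof (rule torus_integral_mono)
    show "cper (\<lambda>x. avg c G x powr (1/2) * avg c (\<lambda>x. avg a G x powr (1/2) * avg b G x powr (1/2)) x)"
      by (intro cper_mult sq avg_cper)
    show "cper (\<lambda>x. avg c G x powr (1/2) * (avg c (avg a G) x * avg c (avg b G) x) powr (1/2))"
      using cp2 by (intro cper_mult sq cper_powr) auto
    show "avg c G x powr (1/2) * avg c (\<lambda>x. avg a G x powr (1/2) * avg b G x powr (1/2)) x
        \<le> avg c G x powr (1/2) * (avg c (avg a G) x * avg c (avg b G) x) powr (1/2)" for x
      using avg_Holder[OF cp(1) cp(2) cp(1) cp(2), of "1/2" "1/2" c a b x] cp2
      by (intro mult_left_mono) (auto simp: powr_mult)
  qed
  also have "\<dots> \<le> (LINT x|torus. avg c G x) powr (1/2) * (LINT x|torus. avg c (avg a G) x * avg c (avg b G) x) powr (1/2)"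
    using cp cp2 by (intro torus_Holder cper_mult) auto
  also have "(LINT x|torus. avg c G x) = ?I"
    by (rule torus_avg[OF G(1)])
  also have "(LINT x|torus. avg c (avg a G) x * avg c (avg b G) x)
      = (LINT x|torus. avg a (\<lambda>x. avg c (avg a G) x * avg c (avg b G) x) x)"
    by (intro torus_avg[symmetric] cper_mult cp2)
  also have "\<dots> = (LINT x|torus. avg c (avg a G) x * avg a (avg c (avg b G)) x)"
    using avg_mult_invariant[OF inv_a] by simp
  also have "\<dots> = (LINT x|torus. avg c (avg a G) x * ?I)"
  proof -
    have "spanning a c b"
      unfolding spanning_def
    proof
      fix x
      obtain r s t where "x = r *\<^sub>R a + s *\<^sub>R b + t *\<^sub>R c"
        using sp spanning_def by blast
      then have "x = r *\<^sub>R a + t *\<^sub>R c + s *\<^sub>R b" by simp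
      then show "\<exists>r s t. x = r *\<^sub>R a + s *\<^sub>R c + t *\<^sub>R b" by blast
    qed
    then show ?thesis using triple_avg[OF G(1) d(1) d(3) d(2)] by simp
  qed
  also have "\<dots> = ?I * ?I"
    using torus_avg[OF cp(1)] torus_avg[OF G(1)] by simp
  also have "?I powr (1/2) * (?I * ?I) powr (1/2) = ?I powr (3/2)"
    using I0 powr_add[of ?I "1/2" 1] by (simp add: powr_mult powr_half_sqrt)
  finally show ?thesis .
qed

section \<open>Functions with continuous partial derivatives\<close>

definition C1 :: "(real^3 \<Rightarrow> real) \<Rightarrow> bool" where
  "C1 g \<longleftrightarrow> (\<forall>i. (\<forall>x. partial_exists i g x) \<and> continuous_on UNIV (partial i g))"

lemma partial_line:
  assumes "\<And>x. partial_exists i g x"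
  shows "((\<lambda>s. g (x + s *\<^sub>R axis i 1)) has_real_derivative partial i g (x + s *\<^sub>R axis i 1)) (at s)"
proof -
  have "((\<lambda>h. g ((x + s *\<^sub>R axis i 1) + h *\<^sub>R axis i 1)) has_real_derivative partial i g (x + s *\<^sub>R axis i 1)) (at 0)"
    using assms[of "x + s *\<^sub>R axis i 1"] unfolding partial_exists_def partial_def
    by (simp add: vector_derivative_works has_real_derivative_iff_has_vector_derivative)
  then have "((\<lambda>h. g (x + (h + s) *\<^sub>R axis i 1)) has_real_derivative partial i g (x + s *\<^sub>R axis i 1)) (at 0)"
    by (simp add: algebra_simps)
  then show ?thesis
    using DERIV_shift[of "\<lambda>s. g (x + s *\<^sub>R axis i 1)" _ 0 s] by simp
qed

lemma partial_eqI:
  assumes "((\<lambda>h. g (x + h *\<^sub>R axis i 1)) has_real_derivative D) (at 0)"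
  shows "partial_exists i g x" "partial i g x = D"
  using assms unfolding partial_exists_def partial_def has_real_derivative_iff_has_vector_derivative
  by (auto intro: differentiableI_vector vector_derivative_at)

lemma partial_periodic: "periodic g \<Longrightarrow> periodic (partial i g)"
  using periodic_shift[of g] unfolding periodic_def[of "partial i g"] partial_def by simp

text \<open>The mean value inequality for \<open>g (y + s *\<^sub>R axis i 1) - s * c\<close> on an
  interval symmetric about 0, so that both signs of \<open>h\<close> are covered.\<close>

lemma partial_increment_bound:
  assumes "\<And>x. partial_exists i g x" and "\<And>s. \<bar>s\<bar> \<le> \<bar>h\<bar> \<Longrightarrow> \<bar>partial i g (y + s *\<^sub>R axis i 1) - c\<bar> \<le> e"
  shows "\<bar>g (y + h *\<^sub>R axis i 1) - g y - h * c\<bar> \<le> e * \<bar>h\<bar>"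
proof -
  have "norm ((g (y + h *\<^sub>R axis i 1) - h * c) - (g (y + 0 *\<^sub>R axis i 1) - 0 * c)) \<le> e * norm (h - 0)"
  proof (rule field_differentiable_bound[where S = "{-\<bar>h\<bar>..\<bar>h\<bar>}"
        and f = "\<lambda>s. g (y + s *\<^sub>R axis i 1) - s * c" and f' = "\<lambda>s. partial i g (y + s *\<^sub>R axis i 1) - c"])
    show "((\<lambda>s. g (y + s *\<^sub>R axis i 1) - s * c) has_real_derivative partial i g (y + z *\<^sub>R axis i 1) - c)
        (at z within {-\<bar>h\<bar>..\<bar>h\<bar>})" for z
      using partial_line[OF assms(1)]
      by (auto intro!: derivative_eq_intros has_field_derivative_at_within[OF partial_line[OF assms(1)]])
    show "norm (partial i g (y + z *\<^sub>R axis i 1) - c) \<le> e" if "z \<in> {-\<bar>h\<bar>..\<bar>h\<bar>}" for z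
      using assms(2)[of z] that by auto
  qed auto
  then show ?thesis by simp
qed

text \<open>The classical theorem that continuous partial derivatives give total differentiability:
  go from \<open>x\<close> to \<open>y\<close> along the three axes and spend \<open>e / 3\<close>
  on each leg.\<close>

lemma C1_has_derivative:
  assumes g: "C1 g"
  shows "(g has_derivative (\<lambda>h. \<Sum>i\<in>UNIV. h $ i * partial i g x)) (at x)"
  unfolding has_derivative_at_alt
proof (intro conjI allI impI)
  show "bounded_linear (\<lambda>h. \<Sum>i\<in>UNIV. h $ i * partial i g x)"
    by (intro bounded_linear_sum bounded_linear_mult_const bounded_linear_vec_nth)
  fix e :: real assume e: "0 < e"
  have "\<exists>d>0. \<forall>y. norm (y - x) < d \<longrightarrow> \<bar>partial i g y - partial i g x\<bar> \<le> e / 3" for i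
  proof -
    have "isCont (partial i g) x"
      using g by (simp add: C1_def continuous_on_eq_continuous_at)
    then obtain d where "d > 0" "\<forall>y. dist y x < d \<longrightarrow> dist (partial i g y) (partial i g x) < e / 3"
      using e unfolding continuous_at_eps_delta by (metis divide_pos_pos zero_less_numeral)
    then show ?thesis by (intro exI[of _ d]) (auto simp: dist_norm less_imp_le)
  qed
  then obtain d where d: "\<And>i. d i > 0"
    "\<And>i y. norm (y - x) < d i \<Longrightarrow> \<bar>partial i g y - partial i g x\<bar> \<le> e / 3"
    by metis
  let ?d = "Min (range d)"
  have d0: "?d > 0" "\<And>i. ?d \<le> d i" using d(1) by auto
  have "norm (g y - g x - (\<Sum>i\<in>UNIV. (y - x) $ i * partial i g x)) \<le> e * norm (y - x)"
    if y: "norm (y - x) < ?d" for y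
  proof -
    define h where "h = y - x"
    have yh: "y = x + h" by (simp add: h_def)
    have hi: "\<bar>h $ i\<bar> \<le> norm h" for i by (rule component_le_norm_cart)
    \<comment> \<open>\<open>z\<close> is the part of \<open>h\<close> already travelled. Its
      \<open>i\<close>-th entry is still zero, so moving along axis \<open>i\<close> keeps the
      displacement componentwise below \<open>h\<close> and thus inside the ball where the partials
      are nearly constant.\<close>
    have inc: "\<bar>g (x + z + (h $ i) *\<^sub>R axis i 1) - g (x + z) - h $ i * partial i g x\<bar> \<le> e / 3 * \<bar>h $ i\<bar>"
      if z: "\<And>j. \<bar>z $ j\<bar> \<le> \<bar>h $ j\<bar>" "z $ i = 0" for z i
    proof (rule partial_increment_bound)
      show "\<And>x. partial_exists i g x" using g by (simp add: C1_def)
      fix s assume s: "\<bar>s\<bar> \<le> \<bar>h $ i\<bar>"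
      have "norm (z + s *\<^sub>R axis i 1) \<le> norm h"
        using z s by (intro norm_le_componentwise_cart) (auto simp: axis_def)
      then have "norm (x + z + s *\<^sub>R axis i 1 - x) < d i"
        using y d0(2)[of i] unfolding h_def by (simp only: add.assoc add_diff_cancel_left')
      then show "\<bar>partial i g (x + z + s *\<^sub>R axis i 1) - partial i g x\<bar> \<le> e / 3"
        by (rule d(2))
    qed
    let ?z2 = "(h$1) *\<^sub>R axis 1 1 :: real^3" and ?z3 = "(h$1) *\<^sub>R axis 1 1 + (h$2) *\<^sub>R axis 2 1 :: real^3"
    have "y = x + ?z3 + (h$3) *\<^sub>R axis 3 1"
      by (simp add: yh vec_eq_iff forall_3 axis_def)
    moreover have "\<bar>g (x + 0 + (h$1) *\<^sub>R axis 1 1) - g (x + 0) - h$1 * partial 1 g x\<bar> \<le> e / 3 * \<bar>h$1\<bar>"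
      by (rule inc) auto
    moreover have "\<bar>g (x + ?z2 + (h$2) *\<^sub>R axis 2 1) - g (x + ?z2) - h$2 * partial 2 g x\<bar> \<le> e / 3 * \<bar>h$2\<bar>"
      by (rule inc) (auto simp: axis_def)
    moreover have "\<bar>g (x + ?z3 + (h$3) *\<^sub>R axis 3 1) - g (x + ?z3) - h$3 * partial 3 g x\<bar> \<le> e / 3 * \<bar>h$3\<bar>"
      by (rule inc) (auto simp: axis_def)
    ultimately have "\<bar>g y - g x - (\<Sum>i\<in>UNIV. h $ i * partial i g x)\<bar> \<le> e / 3 * \<bar>h$1\<bar> + e / 3 * \<bar>h$2\<bar> + e / 3 * \<bar>h$3\<bar>"
      by (simp only: sum_3 add.assoc add_0_left add_0_right) linarith
    also have "\<dots> \<le> e / 3 * norm h + e / 3 * norm h + e / 3 * norm h"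
      using hi e by (intro add_mono mult_left_mono) auto
    finally show ?thesis by (simp add: h_def)
  qed
  then show "\<exists>d>0. \<forall>y. norm (y - x) < d \<longrightarrow>
      norm (g y - g x - (\<Sum>i\<in>UNIV. (y - x) $ i * partial i g x)) \<le> e * norm (y - x)"
    using d0(1) by blast
qed

lemma C1_line:
  assumes "C1 g"
  shows "((\<lambda>t. g (x + t *\<^sub>R d)) has_real_derivative (\<Sum>i\<in>UNIV. d $ i * partial i g (x + t *\<^sub>R d))) (at t)"
proof -
  have "((\<lambda>t. g (x + t *\<^sub>R d)) has_derivative (\<lambda>s. \<Sum>i\<in>UNIV. (s *\<^sub>R d) $ i * partial i g (x + t *\<^sub>R d))) (at t)"
    by (rule has_derivative_compose[OF _ C1_has_derivative[OF assms]])
      (auto intro!: derivative_eq_intros)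
  then show ?thesis
    by (rule has_derivative_imp_has_field_derivative) (simp add: sum_distrib_left mult_ac)
qed

definition C1_field :: "(real^3 \<Rightarrow> real^3) \<Rightarrow> bool" where
  "C1_field w \<longleftrightarrow> continuous_on UNIV w \<and> periodic w \<and> (\<forall>i. C1 (\<lambda>y. w y $ i))"

lemma sym_grad_component:
  "sym_grad w x $ i $ j = (partial j (\<lambda>y. w y $ i) x + partial i (\<lambda>y. w y $ j) x) / 2"
  by (simp add: sym_grad_def jac_def transpose_def)

lemma continuous_on_vec_components:
  fixes F :: "'a::topological_space \<Rightarrow> ('b::topological_space)^'n"
  shows "(\<And>i. continuous_on S (\<lambda>x. F x $ i)) \<Longrightarrow> continuous_on S F"
  using continuous_on_vec_lambda[of S "\<lambda>i x. F x $ i"] by simp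

lemma sym_grad_cper:
  assumes "C1_field w"
  shows "cper (\<lambda>x. norm (sym_grad w x))"
proof -
  have c: "continuous_on UNIV (\<lambda>x. sym_grad w x)"
    using assms unfolding C1_field_def C1_def
    by (intro continuous_on_vec_components) (simp add: sym_grad_component, intro continuous_intros, auto)
  have "periodic (\<lambda>y. w y $ i)" for i
    using assms by (simp add: C1_field_def periodic_def)
  then have "periodic (\<lambda>x. sym_grad w x)"
    using partial_periodic by (auto simp: periodic_def vec_eq_iff sym_grad_component)
  with c show ?thesis
    by (auto simp: cper_def periodic_def intro!: continuous_intros)
qed

text \<open>The form is the Frobenius inner product of \<open>S\<close> with the rank-one matrix d
  d^T, whose Frobenius norm is |d|^2; then Cauchy-Schwarz.\<close>

lemma quadratic_form_bound:
  fixes S :: "real^3^3"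
  shows "\<bar>\<Sum>i\<in>UNIV. \<Sum>j\<in>UNIV. d $ i * d $ j * S $ i $ j\<bar> \<le> (norm d)\<^sup>2 * norm S"
proof -
  define D :: "real^3^3" where "D = (\<chi> i. (d $ i) *\<^sub>R d)"
  have "(\<Sum>i\<in>UNIV. \<Sum>j\<in>UNIV. d $ i * d $ j * S $ i $ j) = D \<bullet> S"
    by (simp add: D_def inner_vec_def sum_distrib_left mult_ac)
  moreover have "norm D = (norm d)\<^sup>2"
  proof -
    have "(norm D)\<^sup>2 = (\<Sum>i\<in>UNIV. (d $ i)\<^sup>2 * (d \<bullet> d))"
      unfolding power2_norm_eq_inner by (simp add: D_def inner_vec_def[of D D] power2_eq_square)
        (simp add: inner_vec_def sum_distrib_left mult_ac)
    also have "\<dots> = (norm d)\<^sup>2 * (norm d)\<^sup>2"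
      by (simp add: sum_distrib_right[symmetric] power2_norm_eq_inner)
        (simp add: inner_vec_def power2_eq_square)
    finally show ?thesis
      by (metis norm_ge_zero power2_eq_imp_eq power2_eq_square zero_le_power2)
  qed
  ultimately show ?thesis
    using Cauchy_Schwarz_ineq2[of D S] by simp
qed

lemma C1_field_line:
  assumes w: "C1_field w"
  obtains D where "((\<lambda>t. d \<bullet> w (x + t *\<^sub>R d)) has_real_derivative D) (at t)"
    "\<bar>D\<bar> \<le> (norm d)\<^sup>2 * norm (sym_grad w (x + t *\<^sub>R d))"
proof
  let ?y = "x + t *\<^sub>R d"
  let ?D = "\<Sum>i\<in>UNIV. d $ i * (\<Sum>j\<in>UNIV. d $ j * partial j (\<lambda>y. w y $ i) ?y)"
  have "((\<lambda>t. \<Sum>i\<in>UNIV. d $ i * w (x + t *\<^sub>R d) $ i) has_real_derivative ?D) (at t)"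
    using w by (intro DERIV_sum DERIV_cmult C1_line) (simp add: C1_field_def)
  then show "((\<lambda>t. d \<bullet> w (x + t *\<^sub>R d)) has_real_derivative ?D) (at t)"
    by (simp add: inner_vec_def)
  \<comment> \<open>The weights d_i d_j are symmetric in i and j, so the antisymmetric part of the
    Jacobian cancels.\<close>
  have "?D = (\<Sum>i\<in>UNIV. \<Sum>j\<in>UNIV. d $ i * d $ j * sym_grad w ?y $ i $ j)"
    by (simp add: sym_grad_component sum_3 field_simps)
  then show "\<bar>?D\<bar> \<le> (norm d)\<^sup>2 * norm (sym_grad w ?y)"
    using quadratic_form_bound[of d "sym_grad w ?y"] by simp
qed

section \<open>Poincare-Korn inequality\<close>

text \<open>Since \<open>h\<close> is nonnegative on the line, the integral over
  \<open>[0, s]\<close> is at most the mean over the whole segment. The derivative is only known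
  pointwise; the gauge integral makes it integrable.\<close>

lemma line_increment_bound:
  fixes \<phi> :: "real \<Rightarrow> real"
  assumes h: "cper h" and D: "\<And>t. \<exists>D. (\<phi> has_real_derivative D) (at t) \<and> \<bar>D\<bar> \<le> h (x + t *\<^sub>R d)"
    and s: "0 \<le> s" "s \<le> 1"
  shows "\<bar>\<phi> s - \<phi> 0\<bar> \<le> avg d h x"
proof -
  obtain \<phi>' where \<phi>': "\<And>t. (\<phi> has_real_derivative \<phi>' t) (at t)" "\<And>t. \<bar>\<phi>' t\<bar> \<le> h (x + t *\<^sub>R d)"
    using D by metis
  have h0: "0 \<le> h (x + t *\<^sub>R d)" for t using \<phi>'(2)[of t] by linarith
  have int: "(\<phi>' has_integral (\<phi> s - \<phi> 0)) {0..s}"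
    using s by (intro fundamental_theorem_of_calculus)
      (auto simp: has_real_derivative_iff_has_vector_derivative[symmetric] intro: has_field_derivative_at_within \<phi>')
  have "norm (integral {0..s} \<phi>') \<le> integral {0..s} (\<lambda>t. h (x + t *\<^sub>R d))"
    using int \<phi>'(2) by (intro integral_norm_bound_integral line_integrable[OF h]) auto
  also have "\<dots> \<le> avg d h x"
    unfolding avg_def using s h0 by (intro integral_subset_le line_integrable[OF h]) auto
  finally show ?thesis using int by (simp add: integral_unique)
qed

lemma avg_gradient_bound:
  assumes g: "cper g" and h: "cper h"
    and D: "\<And>t. \<exists>D. ((\<lambda>t. g (x + t *\<^sub>R d)) has_real_derivative D) (at t) \<and> \<bar>D\<bar> \<le> h (x + t *\<^sub>R d)"
  shows "\<bar>g x - avg d g x\<bar> \<le> avg d h x"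
proof -
  have b: "\<bar>g (x + s *\<^sub>R d) - g x\<bar> \<le> avg d h x" if "0 \<le> s" "s \<le> 1" for s
    using line_increment_bound[OF h D that] by simp
  have eq: "avg d g x - g x = integral {0..1} (\<lambda>t. g (x + t *\<^sub>R d) - g x)"
    unfolding avg_def by (subst integral_diff[OF line_integrable[OF g]]) auto
  have "norm (integral {0..1} (\<lambda>t. g (x + t *\<^sub>R d) - g x)) \<le> integral {0..1} (\<lambda>t::real. avg d h x)"
    using b by (intro integral_norm_bound_integral integrable_diff line_integrable[OF g]) auto
  then show ?thesis using eq by simp
qed

lemma C1_field_component_cper: "C1_field w \<Longrightarrow> cper (\<lambda>x. w x $ i)"
  by (auto simp: C1_field_def cper_def periodic_def intro!: continuous_intros)

lemma C1_field_inner_cper: "C1_field w \<Longrightarrow> cper (\<lambda>x. d \<bullet> w x)"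
  by (auto simp: C1_field_def cper_def periodic_def intro!: continuous_intros)

lemma C1_field_norm_cper: "C1_field w \<Longrightarrow> cper (\<lambda>x. norm (w x))"
  by (auto simp: C1_field_def cper_def periodic_def intro!: continuous_intros)

lemma directional_avg_bound:
  assumes w: "C1_field w"
  shows "\<bar>d \<bullet> w x - avg d (\<lambda>y. d \<bullet> w y) x\<bar> \<le> (norm d)\<^sup>2 * avg d (\<lambda>y. norm (sym_grad w y)) x"
proof -
  have "\<bar>d \<bullet> w x - avg d (\<lambda>y. d \<bullet> w y) x\<bar> \<le> avg d (\<lambda>y. (norm d)\<^sup>2 * norm (sym_grad w y)) x"
  proof (rule avg_gradient_bound)
    show "\<exists>D. ((\<lambda>t. d \<bullet> w (x + t *\<^sub>R d)) has_real_derivative D) (at t) \<and>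
         \<bar>D\<bar> \<le> (norm d)\<^sup>2 * norm (sym_grad w (x + t *\<^sub>R d))" for t
      using C1_field_line[OF w, of d x t] by metis
  qed (use w in \<open>auto intro!: C1_field_inner_cper cper_mult cper_const sym_grad_cper\<close>)
  then show ?thesis by (simp add: avg_cmult)
qed

text \<open>Averages along \<open>e\<^sub>i\<close> and then along \<open>e\<^sub>i + e\<^sub>j\<close> are averages over the coordinate plane, so the
  bounds for \<open>w\<^sub>j\<close> along \<open>e\<^sub>j\<close> and for \<open>w\<^sub>i + w\<^sub>j\<close> along \<open>e\<^sub>i + e\<^sub>j\<close> control the variation of \<open>w\<^sub>i\<close>
  along \<open>e\<^sub>j\<close>.\<close>

lemma avg_pair_bound:
  assumes w: "C1_field w" and ij: "i \<noteq> j"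
  defines "W \<equiv> \<lambda>i x. w x $ i" and "Q \<equiv> \<lambda>y. norm (sym_grad w y)"
  shows "\<bar>avg (axis i 1) (W i) x - avg (axis i 1) (avg (axis j 1) (W i)) x\<bar>
    \<le> 3 * avg (axis i 1) (avg (axis j 1) Q) x"
proof -
  let ?i = "axis i 1 :: real^3" and ?j = "axis j 1 :: real^3"
  have W: "cper (W k)" for k unfolding W_def by (rule C1_field_component_cper[OF w])
  have Q: "cper Q" unfolding Q_def by (rule sym_grad_cper[OF w])
  note cp = W Q avg_cper cper_intros
  \<comment> \<open>After averaging along e_i the function no longer varies in that direction, so
    the diagonal direction acts like e_j.\<close>
  have swap: "avg ?i (avg (?i + ?j) g) y = avg ?i (avg ?j g) y" if g: "cper g" for g y
  proof -
    have inv: "invariant_along ?i (avg ?i g)"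
      by (intro avg_invariant g period_vector_axis)
    have "avg ?i (avg (?i + ?j) g) y = avg (?i + ?j) (avg ?i g) y"
      by (rule avg_commute[OF g])
    also have "\<dots> = avg ?j (avg ?i g) y" by (rule avg_add_dir[OF inv])
    also have "\<dots> = avg ?i (avg ?j g) y" by (rule avg_commute[OF g])
    finally show ?thesis .
  qed
  have f1: "\<bar>W j y - avg ?j (W j) y\<bar> \<le> avg ?j Q y" for y
    using directional_avg_bound[OF w, of ?j y] by (simp add: W_def Q_def inner_axis' )
  have n2: "(norm (?i + ?j))\<^sup>2 = 2"
    using ij by (simp add: power2_norm_eq_inner inner_add_left inner_add_right inner_axis_axis)
  have f2: "\<bar>(W i y + W j y) - avg (?i + ?j) (\<lambda>y. W i y + W j y) y\<bar> \<le> 2 * avg (?i + ?j) Q y" for y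
    using directional_avg_bound[OF w, of "?i + ?j" y] by (simp add: n2 W_def Q_def inner_axis' inner_add_left)
  have g1: "\<bar>avg ?i (\<lambda>y. W j y - avg ?j (W j) y) x\<bar> \<le> avg ?i (avg ?j Q) x"
    using f1 by (intro avg_abs_le cp)
  have g2: "\<bar>avg ?i (\<lambda>y. (W i y + W j y) - avg (?i + ?j) (\<lambda>y. W i y + W j y) y) x\<bar>
      \<le> avg ?i (\<lambda>y. 2 * avg (?i + ?j) Q y) x"
    using f2 by (intro avg_abs_le cp)
  have e1: "avg ?i (\<lambda>y. W j y - avg ?j (W j) y) x = avg ?i (W j) x - avg ?i (avg ?j (W j)) x"
    by (intro avg_diff cp)
  have e2: "avg ?i (\<lambda>y. (W i y + W j y) - avg (?i + ?j) (\<lambda>y. W i y + W j y) y) x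
      = avg ?i (W i) x + avg ?i (W j) x - (avg ?i (avg ?j (W i)) x + avg ?i (avg ?j (W j)) x)"
  proof -
    have "avg ?i (\<lambda>y. (W i y + W j y) - avg (?i + ?j) (\<lambda>y. W i y + W j y) y) x
       = avg ?i (\<lambda>y. W i y + W j y) x - avg ?i (avg (?i + ?j) (\<lambda>y. W i y + W j y)) x"
      by (intro avg_diff cp)
    also have "avg ?i (avg (?i + ?j) (\<lambda>y. W i y + W j y)) x = avg ?i (avg ?j (\<lambda>y. W i y + W j y)) x"
      by (intro swap cp)
    also have "avg ?j (\<lambda>y. W i y + W j y) = (\<lambda>y. avg ?j (W i) y + avg ?j (W j) y)"
      by (intro ext avg_add cp)
    also have "avg ?i (\<lambda>y. avg ?j (W i) y + avg ?j (W j) y) x = avg ?i (avg ?j (W i)) x + avg ?i (avg ?j (W j)) x"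
      by (intro avg_add cp)
    also have "avg ?i (\<lambda>y. W i y + W j y) x = avg ?i (W i) x + avg ?i (W j) x"
      by (intro avg_add cp)
    finally show ?thesis .
  qed
  have e3: "avg ?i (\<lambda>y. 2 * avg (?i + ?j) Q y) x = 2 * avg ?i (avg ?j Q) x"
    by (simp add: avg_cmult swap Q)
  \<comment> \<open>Subtracting the estimate for W_j from the one for W_i + W_j leaves W_i. The
    constant is 3 = 1 + 2, where 2 = |e_i + e_j|^2.\<close>
  show ?thesis
    using g1 g2 unfolding e1 e2 e3 by linarith
qed

lemma distinct_3: "i \<noteq> j \<Longrightarrow> j \<noteq> k \<Longrightarrow> i \<noteq> k \<Longrightarrow> l = i \<or> l = j \<or> l = (k::3)"
  using exhaust_3[of i] exhaust_3[of j] exhaust_3[of k] exhaust_3[of l] by (elim disjE) auto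

text \<open>The directions form a triangular basis; the coefficient of \<open>axis i 1\<close> is
  corrected for what the two sheared directions contribute.\<close>

lemma spanning_sheared_axes:
  assumes "i \<noteq> j" "j \<noteq> k" "i \<noteq> (k::3)"
  shows "spanning (axis i 1) (axis j 1 + a *\<^sub>R axis i 1) (axis k 1 + b *\<^sub>R axis i 1)"
  unfolding spanning_def
proof
  fix x :: "real^3"
  have "x = (x $ i - x $ j * a - x $ k * b) *\<^sub>R axis i 1 + (x $ j) *\<^sub>R (axis j 1 + a *\<^sub>R axis i 1)
      + (x $ k) *\<^sub>R (axis k 1 + b *\<^sub>R axis i 1)"
    unfolding vec_eq_iff
  proof
    fix l show "x $ l = ((x $ i - x $ j * a - x $ k * b) *\<^sub>R axis i 1 + (x $ j) *\<^sub>R (axis j 1 + a *\<^sub>R axis i 1)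
      + (x $ k) *\<^sub>R (axis k 1 + b *\<^sub>R axis i 1)) $ l"
      using distinct_3[OF assms, of l] assms by (auto simp: axis_def)
  qed
  then show "\<exists>r s t. x = r *\<^sub>R axis i 1 + s *\<^sub>R (axis j 1 + a *\<^sub>R axis i 1) + t *\<^sub>R (axis k 1 + b *\<^sub>R axis i 1)"
    by blast
qed

text \<open>Telescoping through averages over a line along e_i, a plane spanned by e_i and e_j, and
  the torus. The last difference is the pair bound for (i, k) averaged along e_j, where all iterated
  averages become torus means.\<close>

lemma component_minus_mean_bound:
  assumes w: "C1_field w" and ij: "i \<noteq> j" "j \<noteq> k" "i \<noteq> (k::3)"
  defines "Q \<equiv> \<lambda>y. norm (sym_grad w y)"
  shows "\<bar>w x $ i - (LINT y|torus. w y $ i)\<bar>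
    \<le> avg (axis i 1) Q x + 3 * avg (axis i 1) (avg (axis j 1) Q) x + 3 * (LINT y|torus. Q y)"
proof -
  let ?i = "axis i 1 :: real^3" and ?j = "axis j 1 :: real^3" and ?k = "axis k 1 :: real^3"
  let ?W = "\<lambda>x. w x $ i"
  have W: "cper ?W" by (rule C1_field_component_cper[OF w])
  have Q: "cper Q" unfolding Q_def by (rule sym_grad_cper[OF w])
  note cp = W Q avg_cper cper_intros
  have mean: "avg ?j (avg ?i (avg ?k g)) x = (LINT y|torus. g y)" if "cper g" for g
  proof -
    have "spanning ?j ?i ?k"
      using spanning_sheared_axes[of j i k 0 0] ij by simp
    then show ?thesis
      by (intro triple_avg that period_vector_axis)
  qed
  have "\<bar>?W x - avg ?i ?W x\<bar> \<le> avg ?i Q x"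
    using directional_avg_bound[OF w, of ?i x] by (simp add: Q_def inner_axis')
  moreover have "\<bar>avg ?i ?W x - avg ?i (avg ?j ?W) x\<bar> \<le> 3 * avg ?i (avg ?j Q) x"
    using avg_pair_bound[OF w ij(1), of x] by (simp add: Q_def)
  moreover have "\<bar>avg ?i (avg ?j ?W) x - (LINT y|torus. ?W y)\<bar> \<le> 3 * (LINT y|torus. Q y)"
  proof -
    have "\<bar>avg ?j (\<lambda>y. avg ?i ?W y - avg ?i (avg ?k ?W) y) x\<bar> \<le> avg ?j (\<lambda>y. 3 * avg ?i (avg ?k Q) y) x"
      using avg_pair_bound[OF w ij(3)] by (intro avg_abs_le cp) (simp add: Q_def)
    moreover have "avg ?j (\<lambda>y. avg ?i ?W y - avg ?i (avg ?k ?W) y) x = avg ?j (avg ?i ?W) x - avg ?j (avg ?i (avg ?k ?W)) x"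
      by (intro avg_diff cp)
    moreover have "avg ?j (avg ?i ?W) x = avg ?i (avg ?j ?W) x"
      by (rule avg_commute[OF W])
    ultimately show ?thesis
      using mean[OF W] mean[OF Q] by (simp add: avg_cmult)
  qed
  ultimately show ?thesis by linarith
qed

lemma powr_sum3_le:
  fixes a b c :: real
  assumes "0 \<le> a" "0 \<le> b" "0 \<le> c" "0 \<le> p"
  shows "(a + b + c) powr p \<le> 3 powr p * (a powr p + b powr p + c powr p)"
proof -
  let ?m = "max a (max b c)"
  have "(a + b + c) powr p \<le> (3 * ?m) powr p"
    using assms by (intro powr_mono2) auto
  also have "\<dots> = 3 powr p * ?m powr p" using assms by (simp add: powr_mult)
  also have "\<dots> \<le> 3 powr p * (a powr p + b powr p + c powr p)"
    by (intro mult_left_mono) (auto simp: max_def)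
  finally show ?thesis .
qed

lemma torus_Jensen:
  assumes g: "cper g" "\<And>x. 0 \<le> g x" and p: "1 \<le> p"
  shows "(LINT x|torus. g x) powr p \<le> (LINT x|torus. g x powr p)"
proof (cases "p = 1")
  case True
  then show ?thesis using torus_integral_nonneg[OF g(2)] g by simp
next
  case False
  with p have p1: "p > 1" by simp
  have c: "cper (\<lambda>x. g x powr p)" using g p1 by (intro cper_powr) auto
  have "(LINT x|torus. g x) = (LINT x|torus. (g x powr p) powr (1/p) * 1 powr (1 - 1/p))"
    using g p1 by (simp add: powr_powr)
  also have "\<dots> \<le> (LINT x|torus. g x powr p) powr (1/p) * (LINT x|torus. 1) powr (1 - 1/p)"
    using p1 by (intro torus_Holder c cper_const) (auto simp: field_simps)
  finally have "(LINT x|torus. g x) \<le> (LINT x|torus. g x powr p) powr (1/p)" by simp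
  then have "(LINT x|torus. g x) powr p \<le> ((LINT x|torus. g x powr p) powr (1/p)) powr p"
    using p1 torus_integral_nonneg[OF g(2)] by (intro powr_mono2) auto
  also have "\<dots> = (LINT x|torus. g x powr p)"
    using p1 torus_integral_nonneg[of "\<lambda>x. g x powr p"] by (simp add: powr_powr)
  finally show ?thesis .
qed

text \<open>The pointwise bound by iterated averages is raised to the power \<open>p\<close>; Jensen
  moves the power inside each average, and averaging preserves torus integrals. No singular kernel
  appears.\<close>

lemma Korn_Poincare:
  assumes w: "C1_field w" and mean: "\<And>i. (LINT y|torus. w y $ i) = 0" and p: "1 \<le> p"
  shows "(LINT x|torus. norm (w x) powr p) \<le> 27 * 27 powr p * (LINT x|torus. norm (sym_grad w x) powr p)"
proof -
  define Q where "Q = (\<lambda>y. norm (sym_grad w y))"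
  have Q: "cper Q" unfolding Q_def by (rule sym_grad_cper[OF w])
  have Q0: "0 \<le> Q x" for x by (simp add: Q_def)
  let ?I = "LINT x|torus. Q x powr p"
  have Qp: "cper (\<lambda>x. Q x powr p)" using Q Q0 p by (intro cper_powr) auto
  have I0: "0 \<le> ?I" by (simp add: torus_integral_nonneg)
  have comp: "(LINT x|torus. \<bar>w x $ i\<bar> powr p) \<le> 3 * 9 powr p * ?I" for i
  proof -
    obtain j k :: 3 where ij: "i \<noteq> j" "j \<noteq> k" "i \<noteq> k"
      using exhaust_3[of i] that[of 2 3] that[of 1 3] that[of 1 2] by auto
    let ?i = "axis i 1 :: real^3" and ?j = "axis j 1 :: real^3"
    have c: "cper (avg ?i Q)" "cper (avg ?i (avg ?j Q))" by (intro avg_cper Q)+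
    have c0: "0 \<le> avg ?i Q x" "0 \<le> avg ?j Q x" "0 \<le> avg ?i (avg ?j Q) x" for x
      by (intro avg_nonneg avg_cper Q Q0)+
    have i0: "0 \<le> (LINT y|torus. Q y)" using Q0 by (simp add: torus_integral_nonneg)
    have cc: "cper (\<lambda>x. avg ?i Q x powr p)" "cper (\<lambda>x. avg ?i (avg ?j Q) x powr p)"
      using c c0 p by (auto intro!: cper_powr)
    have "(LINT x|torus. \<bar>w x $ i\<bar> powr p)
       \<le> (LINT x|torus. 9 powr p * (avg ?i Q x powr p + avg ?i (avg ?j Q) x powr p + (LINT y|torus. Q y) powr p))"
    proof (rule torus_integral_mono)
      show "cper (\<lambda>x. \<bar>w x $ i\<bar> powr p)"
        using p by (intro cper_powr cper_abs C1_field_component_cper w) auto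
      show "cper (\<lambda>x. 9 powr p * (avg ?i Q x powr p + avg ?i (avg ?j Q) x powr p + (LINT y|torus. Q y) powr p))"
        by (intro cper_intros cc)
      fix x
      have "\<bar>w x $ i\<bar> \<le> avg ?i Q x + 3 * avg ?i (avg ?j Q) x + 3 * (LINT y|torus. Q y)"
        using component_minus_mean_bound[OF w ij, of x] mean[of i] by (simp add: Q_def)
      also have "\<dots> \<le> 3 * (avg ?i Q x + avg ?i (avg ?j Q) x + (LINT y|torus. Q y))"
        using c0[of x] by simp
      finally have "\<bar>w x $ i\<bar> powr p \<le> (3 * (avg ?i Q x + avg ?i (avg ?j Q) x + (LINT y|torus. Q y))) powr p"
        using p by (intro powr_mono2) auto
      also have "\<dots> = 3 powr p * (avg ?i Q x + avg ?i (avg ?j Q) x + (LINT y|torus. Q y)) powr p"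
        using c0[of x] i0 by (intro powr_mult)
      also have "\<dots> \<le> 3 powr p * (3 powr p * (avg ?i Q x powr p + avg ?i (avg ?j Q) x powr p + (LINT y|torus. Q y) powr p))"
        using c0[of x] i0 p by (intro mult_left_mono powr_sum3_le) auto
      also have "\<dots> = 9 powr p * (avg ?i Q x powr p + avg ?i (avg ?j Q) x powr p + (LINT y|torus. Q y) powr p)"
        by (simp add: powr_mult[symmetric] mult.assoc[symmetric])
      finally show "\<bar>w x $ i\<bar> powr p \<le> 9 powr p * (avg ?i Q x powr p + avg ?i (avg ?j Q) x powr p + (LINT y|torus. Q y) powr p)" .
    qed
    also have "\<dots> = 9 powr p * ((LINT x|torus. avg ?i Q x powr p) + (LINT x|torus. avg ?i (avg ?j Q) x powr p) + (LINT y|torus. Q y) powr p)"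
      using cc by (simp add: Bochner_Integration.integral_add cper_integrable cper_intros)
    also have "\<dots> \<le> 9 powr p * (?I + ?I + ?I)"
    proof (intro mult_left_mono add_mono)
      have "(LINT x|torus. avg ?i Q x powr p) \<le> (LINT x|torus. avg ?i (\<lambda>x. Q x powr p) x)"
        using avg_Jensen[OF Q Q0 p] by (intro torus_integral_mono cc avg_cper Qp)
      then show "(LINT x|torus. avg ?i Q x powr p) \<le> ?I" by (simp add: torus_avg Qp)
      have "(LINT x|torus. avg ?i (avg ?j Q) x powr p) \<le> (LINT x|torus. avg ?i (avg ?j (\<lambda>x. Q x powr p)) x)"
      proof (intro torus_integral_mono cc avg_cper Qp)
        fix x
        have "avg ?i (avg ?j Q) x powr p \<le> avg ?i (\<lambda>x. avg ?j Q x powr p) x"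
          using c0 by (intro avg_Jensen avg_cper Q p)
        also have "\<dots> \<le> avg ?i (avg ?j (\<lambda>x. Q x powr p)) x"
          using avg_Jensen[OF Q Q0 p] c0 p by (intro avg_mono cper_powr avg_cper Qp Q) auto
        finally show "avg ?i (avg ?j Q) x powr p \<le> avg ?i (avg ?j (\<lambda>x. Q x powr p)) x" .
      qed
      then show "(LINT x|torus. avg ?i (avg ?j Q) x powr p) \<le> ?I" by (simp add: torus_avg avg_cper Qp)
      show "(LINT y|torus. Q y) powr p \<le> ?I" by (rule torus_Jensen[OF Q Q0 p])
    qed auto
    finally show ?thesis by simp
  qed
  have cw: "cper (\<lambda>x. \<bar>w x $ i\<bar> powr p)" for i
    using p by (intro cper_powr cper_abs C1_field_component_cper w) auto
  have "(LINT x|torus. norm (w x) powr p)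
      \<le> (LINT x|torus. 3 powr p * (\<bar>w x $ 1\<bar> powr p + \<bar>w x $ 2\<bar> powr p + \<bar>w x $ 3\<bar> powr p))"
  proof (rule torus_integral_mono)
    fix x
    have "norm (w x) \<le> \<bar>w x $ 1\<bar> + \<bar>w x $ 2\<bar> + \<bar>w x $ 3\<bar>"
      using norm_le_l1_cart[of "w x"] by (simp add: sum_3)
    then have "norm (w x) powr p \<le> (\<bar>w x $ 1\<bar> + \<bar>w x $ 2\<bar> + \<bar>w x $ 3\<bar>) powr p"
      using p by (intro powr_mono2) auto
    also have "\<dots> \<le> 3 powr p * (\<bar>w x $ 1\<bar> powr p + \<bar>w x $ 2\<bar> powr p + \<bar>w x $ 3\<bar> powr p)"
      using p by (intro powr_sum3_le) auto
    finally show "norm (w x) powr p \<le> 3 powr p * (\<bar>w x $ 1\<bar> powr p + \<bar>w x $ 2\<bar> powr p + \<bar>w x $ 3\<bar> powr p)" .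
  qed (use p in \<open>auto intro!: cper_intros cw cper_powr C1_field_norm_cper w C1_field_component_cper\<close>)
  also have "\<dots> = 3 powr p * ((LINT x|torus. \<bar>w x $ 1\<bar> powr p) + (LINT x|torus. \<bar>w x $ 2\<bar> powr p) + (LINT x|torus. \<bar>w x $ 3\<bar> powr p))"
    using cw by (simp add: Bochner_Integration.integral_add cper_integrable cper_intros)
  also have "\<dots> \<le> 3 powr p * (3 * 9 powr p * ?I + 3 * 9 powr p * ?I + 3 * 9 powr p * ?I)"
    by (intro mult_left_mono add_mono comp) auto
  also have "\<dots> = 9 * 27 powr p * ?I"
    by (simp add: powr_mult[of 3 9, simplified] algebra_simps)
  \<comment> \<open>The estimate so far carries the factor 9: three components times three averages
    each. It is enlarged to 27 for a uniform look of the constant.\<close>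
  also have "\<dots> \<le> 27 * 27 powr p * ?I"
    using I0 by (intro mult_right_mono) auto
  finally show ?thesis by (simp add: Q_def)
qed

section \<open>Sobolev-Korn inequality\<close>

text \<open>At 0 the difference quotient has modulus |h|^(g-1), which tends to 0 because
  \<open>g > 1\<close>. This makes |d . w|^g differentiable along lines even where d . w changes
  sign.\<close>

lemma abs_powr_has_real_derivative:
  assumes g: "1 < g"
  shows "((\<lambda>y. \<bar>y\<bar> powr g) has_real_derivative g * \<bar>y\<bar> powr (g - 1) * sgn y) (at y)"
proof -
  consider "y > 0" | "y < 0" | "y = 0" by linarith
  then show ?thesis
  proof cases
    case 1
    have "((\<lambda>y. y powr g) has_real_derivative g * y powr (g - 1)) (at y)"
      by (rule has_real_derivative_powr[OF 1])
    then have "((\<lambda>y. \<bar>y\<bar> powr g) has_real_derivative g * y powr (g - 1)) (at y)"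
      by (rule has_field_derivative_transform_within_open[where S = "{0<..}"]) (use 1 in auto)
    then show ?thesis using 1 by simp
  next
    case 2
    have "((\<lambda>y. (- y) powr g) has_real_derivative - (g * (- y) powr (g - 1))) (at y)"
      using 2 by (auto intro!: derivative_eq_intros)
    then have "((\<lambda>y. \<bar>y\<bar> powr g) has_real_derivative - (g * (- y) powr (g - 1))) (at y)"
      by (rule has_field_derivative_transform_within_open[where S = "{..<0}"]) (use 2 in auto)
    then show ?thesis using 2 by simp
  next
    case 3
    have "((\<lambda>h. \<bar>h\<bar> powr (g - 1)) \<longlongrightarrow> \<bar>0::real\<bar> powr (g - 1)) (at 0)"
      by (rule tendsto_powr') (use g in \<open>auto intro!: tendsto_rabs_zero\<close>)
    then have "((\<lambda>h. \<bar>h\<bar> powr (g - 1)) \<longlongrightarrow> 0) (at 0)"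
      by simp
    moreover have "norm ((\<bar>0 + h\<bar> powr g - \<bar>0\<bar> powr g) / h) \<le> \<bar>h\<bar> powr (g - 1)" for h :: real
      using powr_diff[of "\<bar>h\<bar>" g 1] by (cases "h = 0") simp_all
    ultimately have "((\<lambda>h. (\<bar>0 + h\<bar> powr g - \<bar>0\<bar> powr g) / h) \<longlongrightarrow> 0) (at 0)"
      using Lim_null_comparison[of "\<lambda>h. (\<bar>0 + h\<bar> powr g - \<bar>0\<bar> powr g) / h" "\<lambda>h. \<bar>h\<bar> powr (g - 1)" "at 0"]
      by (meson always_eventually)
    then show ?thesis using 3 by (simp add: DERIV_def)
  qed
qed

text \<open>One-dimensional Sobolev embedding of W^(1,1) into the bounded functions, applied to |d .
  w|^g along a segment: a point value is at most the mean of the function plus the mean of its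
  derivative.\<close>

lemma directional_powr_bound:
  assumes w: "C1_field w" and g: "1 < g" and d: "(norm d)\<^sup>2 \<le> 2"
  shows "\<bar>d \<bullet> w x\<bar> powr g \<le>
    2 powr g * avg d (\<lambda>y. norm (w y) powr g + 2 * g * (norm (w y) powr (g - 1) * norm (sym_grad w y))) x"
proof -
  let ?h = "\<lambda>y. 2 powr g * (2 * g * (norm (w y) powr (g - 1) * norm (sym_grad w y)))"
  have nd: "norm d \<le> 2" using d by (auto intro: power2_le_imp_le[of _ 2])
  have iw: "\<bar>d \<bullet> w y\<bar> \<le> 2 * norm (w y)" for y
    using Cauchy_Schwarz_ineq2[of d "w y"] mult_right_mono[OF nd, of "norm (w y)"] by simp
  have cg: "cper (\<lambda>y. \<bar>d \<bullet> w y\<bar> powr g)"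
    using g by (intro cper_powr cper_abs C1_field_inner_cper w) auto
  have cn: "cper (\<lambda>y. norm (w y) powr g)" "cper (\<lambda>y. norm (w y) powr (g - 1))"
    using g by (auto intro!: cper_powr C1_field_norm_cper w)
  have ch: "cper ?h"
    by (intro cper_const cper_mult cn sym_grad_cper w)
  have "\<bar>\<bar>d \<bullet> w x\<bar> powr g - avg d (\<lambda>y. \<bar>d \<bullet> w y\<bar> powr g) x\<bar> \<le> avg d ?h x"
  proof (rule avg_gradient_bound[OF cg ch])
    fix t
    let ?y = "x + t *\<^sub>R d"
    obtain D where D: "((\<lambda>t. d \<bullet> w (x + t *\<^sub>R d)) has_real_derivative D) (at t)"
      "\<bar>D\<bar> \<le> (norm d)\<^sup>2 * norm (sym_grad w ?y)"
      using C1_field_line[OF w, of d x t] by metis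
    let ?D = "g * \<bar>d \<bullet> w ?y\<bar> powr (g - 1) * sgn (d \<bullet> w ?y) * D"
    have "((\<lambda>t. \<bar>d \<bullet> w (x + t *\<^sub>R d)\<bar> powr g) has_real_derivative ?D) (at t)"
      by (rule DERIV_chain2[OF abs_powr_has_real_derivative[OF g] D(1)])
    moreover have "\<bar>?D\<bar> \<le> ?h ?y"
    proof -
      have "\<bar>?D\<bar> \<le> g * \<bar>d \<bullet> w ?y\<bar> powr (g - 1) * \<bar>D\<bar>"
        using g by (cases "d \<bullet> w ?y = 0") (simp_all add: abs_mult)
      also have "\<dots> \<le> g * (2 * norm (w ?y)) powr (g - 1) * (2 * norm (sym_grad w ?y))"
      proof (rule mult_mono)
        show "\<bar>D\<bar> \<le> 2 * norm (sym_grad w ?y)"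
          using D(2) mult_right_mono[OF d, of "norm (sym_grad w ?y)"] by simp
        show "g * \<bar>d \<bullet> w ?y\<bar> powr (g - 1) \<le> g * (2 * norm (w ?y)) powr (g - 1)"
          using g iw by (intro mult_left_mono powr_mono2) auto
      qed (use g in auto)
      also have "\<dots> = 2 powr (g - 1) * (2 * g * (norm (w ?y) powr (g - 1) * norm (sym_grad w ?y)))"
        by (simp add: powr_mult)
      also have "\<dots> \<le> ?h ?y"
        using g by (intro mult_right_mono) auto
      finally show ?thesis .
    qed
    ultimately show "\<exists>D. ((\<lambda>t. \<bar>d \<bullet> w (x + t *\<^sub>R d)\<bar> powr g) has_real_derivative D) (at t) \<and> \<bar>D\<bar> \<le> ?h ?y"
      by blast
  qed
  then have "\<bar>d \<bullet> w x\<bar> powr g \<le> avg d (\<lambda>y. \<bar>d \<bullet> w y\<bar> powr g) x + avg d ?h x"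
    by linarith
  also have "\<dots> = avg d (\<lambda>y. \<bar>d \<bullet> w y\<bar> powr g + ?h y) x"
    by (intro avg_add[symmetric] cg ch)
  also have "\<dots> \<le> avg d (\<lambda>y. 2 powr g * (norm (w y) powr g + 2 * g * (norm (w y) powr (g - 1) * norm (sym_grad w y)))) x"
  proof (intro avg_mono cper_add cper_mult cper_const cn sym_grad_cper w cg)
    fix y
    have "\<bar>d \<bullet> w y\<bar> powr g \<le> (2 * norm (w y)) powr g"
      using g iw by (intro powr_mono2) auto
    then show "\<bar>d \<bullet> w y\<bar> powr g + ?h y
        \<le> 2 powr g * (norm (w y) powr g + 2 * g * (norm (w y) powr (g - 1) * norm (sym_grad w y)))"
      by (simp only: powr_mult distrib_left)
  qed
  finally show ?thesis by (simp add: avg_cmult)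
qed

text \<open>The constant 2 is a convenient bound for the square root of 3.\<close>

lemma max_component:
  fixes a :: "real^3"
  obtains i where "\<And>j. \<bar>a $ j\<bar> \<le> \<bar>a $ i\<bar>" "norm a \<le> 2 * \<bar>a $ i\<bar>"
proof -
  have "Max (range (\<lambda>j. \<bar>a $ j\<bar>)) \<in> range (\<lambda>j. \<bar>a $ j\<bar>)"
    by (intro Max_in) auto
  then obtain i where im: "Max (range (\<lambda>j. \<bar>a $ j\<bar>)) = \<bar>a $ i\<bar>"
    by (metis rangeE)
  have i: "\<bar>a $ j\<bar> \<le> \<bar>a $ i\<bar>" for j
    unfolding im[symmetric] by (intro Max_ge) auto
  have "(norm a)\<^sup>2 = (\<bar>a $ 1\<bar>)\<^sup>2 + (\<bar>a $ 2\<bar>)\<^sup>2 + (\<bar>a $ 3\<bar>)\<^sup>2"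
    unfolding power2_norm_eq_inner by (simp add: inner_vec_def sum_3 power2_eq_square)
  also have "\<dots> \<le> (\<bar>a $ i\<bar>)\<^sup>2 + (\<bar>a $ i\<bar>)\<^sup>2 + (\<bar>a $ i\<bar>)\<^sup>2"
    using i by (intro add_mono power_mono) auto
  also have "\<dots> \<le> (2 * \<bar>a $ i\<bar>)\<^sup>2"
    by (simp add: power_mult_distrib)
  finally have "norm a \<le> 2 * \<bar>a $ i\<bar>"
    by (rule power2_le_imp_le) simp
  with i show ?thesis using that by blast
qed

text \<open>Gagliardo's argument for a scalar uses the three axes, but here a bound along
  \<open>d\<close> controls only the component d . w. The basis must therefore depend on the value
  of w; this finite family always contains a suitable one, and the choice is replaced by a sum over
  the family.\<close>

definition direction_triples :: "((real^3) \<times> (real^3) \<times> (real^3)) set" where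
  "direction_triples = (\<lambda>(i, j, k, b, c).
      (axis i 1, axis j 1 + of_bool b *\<^sub>R axis i 1, axis k 1 + of_bool c *\<^sub>R axis i 1)) `
    {(i, j, k, b, c). i \<noteq> j \<and> j \<noteq> k \<and> i \<noteq> k}"

lemma finite_direction_triples: "finite direction_triples"
  unfolding direction_triples_def by (intro finite_imageI finite_subset[OF subset_UNIV finite])

lemma direction_triples_props:
  assumes "(d1, d2, d3) \<in> direction_triples"
  shows "spanning d1 d2 d3"
    and "period_vector d1" "period_vector d2" "period_vector d3"
    and "(norm d1)\<^sup>2 \<le> 2" "(norm d2)\<^sup>2 \<le> 2" "(norm d3)\<^sup>2 \<le> 2"
proof -
  obtain i j k b c where ij: "i \<noteq> j" "j \<noteq> k" "i \<noteq> k"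
    and d: "d1 = axis i 1" "d2 = axis j 1 + of_bool b *\<^sub>R axis i 1" "d3 = axis k 1 + of_bool c *\<^sub>R axis i 1"
    using assms unfolding direction_triples_def by auto
  show "spanning d1 d2 d3"
    unfolding d by (rule spanning_sheared_axes[OF ij])
  have pv: "period_vector (axis l 1 + of_bool b *\<^sub>R axis i 1)" for l b
    by (cases b) (simp_all add: period_vector_axis period_vector_add)
  show "period_vector d1" "period_vector d2" "period_vector d3"
    unfolding d by (rule period_vector_axis pv)+
  have nv: "(norm (axis l 1 + of_bool b *\<^sub>R axis i 1 :: real^3))\<^sup>2 \<le> 2" if "l \<noteq> i" for l b
    using that by (cases b) (simp_all add: power2_norm_eq_inner inner_add_left inner_add_right inner_axis_axis)
  show "(norm d1)\<^sup>2 \<le> 2" "(norm d2)\<^sup>2 \<le> 2" "(norm d3)\<^sup>2 \<le> 2"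
    unfolding d using nv ij by (auto simp: power2_norm_eq_inner inner_axis_axis)
qed

text \<open>A component of maximal modulus is not cancelled in both \<open>a\<^sub>j\<close> and \<open>a\<^sub>j + a\<^sub>i\<close>.\<close>

lemma direction_triples_detect:
  fixes a :: "real^3"
  obtains d1 d2 d3 where "(d1, d2, d3) \<in> direction_triples"
    "norm a \<le> 4 * \<bar>d1 \<bullet> a\<bar>" "norm a \<le> 4 * \<bar>d2 \<bullet> a\<bar>" "norm a \<le> 4 * \<bar>d3 \<bullet> a\<bar>"
proof -
  obtain i where i: "\<And>j. \<bar>a $ j\<bar> \<le> \<bar>a $ i\<bar>" "norm a \<le> 2 * \<bar>a $ i\<bar>"
    using max_component[of a] by blast
  obtain j k :: 3 where ij: "i \<noteq> j" "j \<noteq> k" "i \<noteq> k"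
    using exhaust_3[of i] that[of 2 3] that[of 1 3] that[of 1 2] by auto
  have ex: "\<exists>b. \<bar>a $ i\<bar> \<le> 2 * \<bar>(axis l 1 + of_bool b *\<^sub>R axis i 1) \<bullet> a\<bar>" for l
  proof (cases "\<bar>a $ i\<bar> \<le> 2 * \<bar>a $ l\<bar>")
    case True
    then show ?thesis by (intro exI[of _ False]) (simp add: inner_axis')
  next
    case False
    then have "\<bar>a $ i\<bar> \<le> 2 * \<bar>a $ l + a $ i\<bar>"
      using abs_triangle_ineq2[of "a $ i" "- (a $ l)"] by (simp add: add.commute)
    then show ?thesis by (intro exI[of _ True]) (simp add: inner_axis' inner_add_left)
  qed
  obtain b c where bc: "\<bar>a $ i\<bar> \<le> 2 * \<bar>(axis j 1 + of_bool b *\<^sub>R axis i 1) \<bullet> a\<bar>"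
    "\<bar>a $ i\<bar> \<le> 2 * \<bar>(axis k 1 + of_bool c *\<^sub>R axis i 1) \<bullet> a\<bar>"
    using ex by metis
  show ?thesis
  proof (rule that)
    show "(axis i 1, axis j 1 + of_bool b *\<^sub>R axis i 1, axis k 1 + of_bool c *\<^sub>R axis i 1) \<in> direction_triples"
      unfolding direction_triples_def using ij by (intro image_eqI[of _ _ "(i, j, k, b, c)"]) auto
    show "norm a \<le> 4 * \<bar>axis i 1 \<bullet> a\<bar>"
      using i by (simp add: inner_axis')
  qed (use bc i in linarith)+
qed

text \<open>For a triple of directions seeing all of w(x), |w|^(g/2) is bounded by the square root
  of a line average in each direction. The product of the three bounds is what the Loomis-Whitney
  inequality integrates; summing over all triples removes the dependence on x.\<close>

lemma Gagliardo_bound: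
  assumes w: "C1_field w" and g: "1 < g"
  shows "(LINT x|torus. norm (w x) powr (3/2 * g)) \<le> real (card direction_triples) * 8 powr (3/2 * g) *
    (LINT x|torus. norm (w x) powr g + 2 * g * (norm (w x) powr (g - 1) * norm (sym_grad w x))) powr (3/2)"
proof -
  define G where "G = (\<lambda>y. norm (w y) powr g + 2 * g * (norm (w y) powr (g - 1) * norm (sym_grad w y)))"
  have G: "cper G" unfolding G_def
    using g by (intro cper_intros C1_field_norm_cper sym_grad_cper w) auto
  have G0: "0 \<le> G y" for y using g by (simp add: G_def)
  define F where "F = (\<lambda>D x. avg (fst D) G x powr (1/2) * avg (fst (snd D)) G x powr (1/2) * avg (snd (snd D)) G x powr (1/2))"
  have cF: "cper (F D)" for D
    unfolding F_def by (intro cper_mult cper_powr avg_cper G avg_nonneg G0) auto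
  have F0: "0 \<le> F D x" for D x by (simp add: F_def)
  have cS: "cper (\<lambda>x. \<Sum>D\<in>S. F D x)" for S
    by (induction S rule: infinite_finite_induct) (auto intro!: cper_add cper_const cF)
  have point: "norm (w x) powr (3/2 * g) \<le> 8 powr (3/2 * g) * (\<Sum>D\<in>direction_triples. F D x)" for x
  proof -
    obtain d1 d2 d3 where d: "(d1, d2, d3) \<in> direction_triples"
      "norm (w x) \<le> 4 * \<bar>d1 \<bullet> w x\<bar>" "norm (w x) \<le> 4 * \<bar>d2 \<bullet> w x\<bar>" "norm (w x) \<le> 4 * \<bar>d3 \<bullet> w x\<bar>"
      using direction_triples_detect[of "w x"] by blast
    note pr = direction_triples_props[OF d(1)]
    \<comment> \<open>8 = 4 * 2, where 4 is the loss in detecting w(x) by one direction and 2 comes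
      from the one-dimensional bound.\<close>
    have half: "norm (w x) powr (g/2) \<le> 8 powr (g/2) * avg d G x powr (1/2)"
      if "norm (w x) \<le> 4 * \<bar>d \<bullet> w x\<bar>" "(norm d)\<^sup>2 \<le> 2" for d
    proof -
      have "norm (w x) powr g \<le> (4 * \<bar>d \<bullet> w x\<bar>) powr g"
        using that g by (intro powr_mono2) auto
      also have "\<dots> = 4 powr g * \<bar>d \<bullet> w x\<bar> powr g" by (simp add: powr_mult)
      also have "\<dots> \<le> 4 powr g * (2 powr g * avg d G x)"
        using directional_powr_bound[OF w g that(2), of x] by (intro mult_left_mono) (auto simp: G_def)
      also have "\<dots> = 8 powr g * avg d G x"
        by (simp add: powr_mult[of 4 2, simplified])
      finally have "(norm (w x) powr g) powr (1/2) \<le> (8 powr g * avg d G x) powr (1/2)"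
        by (intro powr_mono2) auto
      then show ?thesis
        using avg_nonneg[OF G G0] by (simp add: powr_powr powr_mult)
    qed
    have "norm (w x) powr (3/2 * g) = norm (w x) powr (g/2) * norm (w x) powr (g/2) * norm (w x) powr (g/2)"
      by (simp add: powr_add[symmetric])
    also have "\<dots> \<le> (8 powr (g/2) * avg d1 G x powr (1/2)) * (8 powr (g/2) * avg d2 G x powr (1/2)) *
        (8 powr (g/2) * avg d3 G x powr (1/2))"
      using half d pr by (intro mult_mono) auto
    also have "\<dots> = (8 powr (g/2) * 8 powr (g/2) * 8 powr (g/2)) * F (d1, d2, d3) x"
      by (simp add: F_def)
    also have "8 powr (g/2) * 8 powr (g/2) * 8 powr (g/2) = (8::real) powr (3/2 * g)"
      by (simp add: powr_add[symmetric])
    also have "8 powr (3/2 * g) * F (d1, d2, d3) x \<le> 8 powr (3/2 * g) * (\<Sum>D\<in>direction_triples. F D x)"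
      by (intro mult_left_mono member_le_sum d finite_direction_triples F0) auto
    finally show ?thesis .
  qed
  have "(LINT x|torus. norm (w x) powr (3/2 * g)) \<le> (LINT x|torus. 8 powr (3/2 * g) * (\<Sum>D\<in>direction_triples. F D x))"
    using g by (intro torus_integral_mono point cper_mult cper_const cS cper_powr C1_field_norm_cper w) auto
  also have "\<dots> = 8 powr (3/2 * g) * (\<Sum>D\<in>direction_triples. LINT x|torus. F D x)"
    using cF by (simp add: Bochner_Integration.integral_sum cper_integrable)
  also have "\<dots> \<le> 8 powr (3/2 * g) * (\<Sum>D\<in>direction_triples. (LINT x|torus. G x) powr (3/2))"
  proof (intro mult_left_mono sum_mono)
    fix D assume "D \<in> direction_triples"
    moreover obtain d1 d2 d3 where "D = (d1, d2, d3)" by (cases D)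
    ultimately show "(LINT x|torus. F D x) \<le> (LINT x|torus. G x) powr (3/2)"
      using Loomis_Whitney_avg[OF G G0, of d1 d2 d3] direction_triples_props[of d1 d2 d3]
      by (simp add: F_def)
  qed auto
  finally show ?thesis by (simp add: mult_ac G_def)
qed

lemma Sobolev_Korn:
  assumes p: "1 < p" "p < 3"
  shows "\<exists>C\<ge>0. \<forall>w. C1_field w \<longrightarrow> (\<forall>i. (LINT y|torus. w y $ i) = 0) \<longrightarrow>
    (LINT x|torus. norm (w x) powr (3 * p / (3 - p))) powr ((3 - p) / (3 * p))
      \<le> C * (LINT x|torus. norm (sym_grad w x) powr p) powr (1/p)"
proof -
  \<comment> \<open>Chosen so that 3g/2 is the critical exponent q and q (1 - 1/p) = g - 1; then
    Hoelder turns both terms of the Gagliardo bound into X^(1 - 1/p) times an L^p norm, where X =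
    int |w|^q.\<close>
  define g where "g = 2 * p / (3 - p)"
  define q where "q = 3 * p / (3 - p)"
  define N where "N = real (card direction_triples) * 8 powr (3/2 * g)"
  define B where "B = (27 * 27 powr p) powr (1/p) + 2 * g"
  have g1: "1 < g" using p by (simp add: g_def field_simps)
  have q0: "0 < q" using p by (simp add: q_def)
  have qg: "q = 3/2 * g" "q * (1 - 1/p) = g - 1"
    using p by (auto simp: q_def g_def field_simps)
  have B0: "0 \<le> B" "0 \<le> N" using g1 by (auto simp: B_def N_def)
  let ?C = "(N * B powr (3/2)) powr (2/3)"
  show ?thesis
  proof (intro exI[of _ ?C] conjI allI impI)
    show "0 \<le> ?C" by simp
    fix w assume w: "C1_field w" and mean: "\<forall>i. (LINT y|torus. w y $ i) = 0"
    let ?X = "LINT x|torus. norm (w x) powr q"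
    let ?D = "LINT x|torus. norm (sym_grad w x) powr p"
    have X0: "0 \<le> ?X" and D0: "0 \<le> ?D" by (simp_all add: torus_integral_nonneg)
    have cn: "cper (\<lambda>x. norm (w x) powr a)" if "a > 0" for a
      using that by (intro cper_powr C1_field_norm_cper w) auto
    have cq: "cper (\<lambda>x. norm (sym_grad w x) powr p)"
      using p by (intro cper_powr sym_grad_cper w) auto
    have "(LINT x|torus. norm (w x) powr g + 2 * g * (norm (w x) powr (g - 1) * norm (sym_grad w x)))
        = (LINT x|torus. norm (w x) powr g) + 2 * g * (LINT x|torus. norm (w x) powr (g - 1) * norm (sym_grad w x))"
      using g1 cn sym_grad_cper[OF w]
      by (subst Bochner_Integration.integral_add) (auto intro!: cper_integrable cper_mult cper_const)
    \<comment> \<open>The lower-order term: one factor |w| is split off and measured in L^p, where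
      the Poincare-Korn inequality applies.\<close>
    also have "(LINT x|torus. norm (w x) powr g) = (LINT x|torus. (norm (w x) powr q) powr (1 - 1/p) * (norm (w x) powr p) powr (1/p))"
    proof -
      have "(norm (w x) powr q) powr (1 - 1/p) * (norm (w x) powr p) powr (1/p) = norm (w x) powr g" for x
        using p qg(2) powr_add[of "norm (w x)" "g - 1" 1] by (simp add: powr_powr)
      then show ?thesis by simp
    qed
    also have "\<dots> \<le> ?X powr (1 - 1/p) * (LINT x|torus. norm (w x) powr p) powr (1/p)"
      using p q0 cn by (intro torus_Holder) auto
    also have "\<dots> \<le> ?X powr (1 - 1/p) * ((27 * 27 powr p) powr (1/p) * ?D powr (1/p))"
    proof (intro mult_left_mono)
      have "(LINT x|torus. norm (w x) powr p) \<le> 27 * 27 powr p * ?D"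
        using p mean by (intro Korn_Poincare w) auto
      then have "(LINT x|torus. norm (w x) powr p) powr (1/p) \<le> (27 * 27 powr p * ?D) powr (1/p)"
        using p by (intro powr_mono2) (auto simp: torus_integral_nonneg)
      then show "(LINT x|torus. norm (w x) powr p) powr (1/p) \<le> (27 * 27 powr p) powr (1/p) * ?D powr (1/p)"
        using D0 by (simp add: powr_mult)
    qed simp
    also have "(LINT x|torus. norm (w x) powr (g - 1) * norm (sym_grad w x))
        = (LINT x|torus. (norm (w x) powr q) powr (1 - 1/p) * (norm (sym_grad w x) powr p) powr (1/p))"
      using p qg(2) by (simp add: powr_powr)
    also have "\<dots> \<le> ?X powr (1 - 1/p) * ?D powr (1/p)"
      using p q0 cn cq by (intro torus_Holder) auto
    finally have G: "(LINT x|torus. norm (w x) powr g + 2 * g * (norm (w x) powr (g - 1) * norm (sym_grad w x)))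
       \<le> B * (?X powr (1 - 1/p) * ?D powr (1/p))"
      using g1 by (simp add: B_def algebra_simps mult_left_mono)
    have "?X \<le> N * (LINT x|torus. norm (w x) powr g + 2 * g * (norm (w x) powr (g - 1) * norm (sym_grad w x))) powr (3/2)"
      using Gagliardo_bound[OF w g1] by (simp add: N_def qg(1))
    also have "\<dots> \<le> N * (B * (?X powr (1 - 1/p) * ?D powr (1/p))) powr (3/2)"
      using G B0 g1 by (intro mult_left_mono powr_mono2) (auto intro!: torus_integral_nonneg)
    also have "\<dots> = (N * B powr (3/2)) * ?X powr (3/2 * (1 - 1/p)) * ?D powr (3/(2*p))"
      using B0 by (simp add: powr_mult powr_powr mult_ac)
    finally have main: "?X \<le> (N * B powr (3/2)) * ?X powr (3/2 * (1 - 1/p)) * ?D powr (3/(2*p))" .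
    have "?X powr (1/q) \<le> ?C * ?D powr (1/p)"
    proof (cases "?X = 0")
      case False
      with X0 have X: "?X > 0" by (metis order_le_less)
      \<comment> \<open>Absorption: 3/2 (1 - 1/p) + 3/(2q) = 1, so the power of X on the right of
        \<open>main\<close> can be divided out. X is a finite number because w is
        continuous.\<close>
      have "?X powr (3/2 * (1/q)) * ?X powr (3/2 * (1 - 1/p)) = ?X powr 1"
        unfolding powr_add[symmetric] using p by (intro arg_cong2[where f = "(powr)"]) (auto simp: q_def field_simps)
      then have "?X powr (3/2 * (1/q)) = ?X / ?X powr (3/2 * (1 - 1/p))"
        using X by (simp add: field_simps)
      also have "\<dots> \<le> (N * B powr (3/2)) * ?D powr (3/(2*p))"
        using main X by (simp add: divide_le_eq mult_ac)
      finally have "(?X powr (3/2 * (1/q))) powr (2/3) \<le> ((N * B powr (3/2)) * ?D powr (3/(2*p))) powr (2/3)"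
        by (intro powr_mono2) auto
      then show ?thesis using B0 D0 by (simp add: powr_powr powr_mult)
    qed simp
    then show "(LINT x|torus. norm (w x) powr (3 * p / (3 - p))) powr ((3 - p) / (3 * p)) \<le> ?C * ?D powr (1/p)"
      by (simp add: q_def)
  qed
qed

section \<open>Morrey-Korn inequality\<close>

text \<open>Scaling by \<open>t\<close> produces the Jacobian factor t^(-3) and a cube of side t <=
  1, which nonnegativity allows to enlarge to a full period cell.\<close>

lemma torus_scaled_shift:
  assumes h: "cper h" "\<And>x. 0 \<le> h x" and t: "0 < t" "t \<le> 1"
  shows "(LINT y|torus. h (z + t *\<^sub>R y)) \<le> (LINT y|torus. h y) / t ^ 3"
proof -
  have c: "continuous_on UNIV (\<lambda>y. h (z + y))"
    using cper_cont[OF cper_shift[OF h(1), of z]] by (simp add: add.commute)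
  have "((\<lambda>y. h (z + y)) has_integral integral (cbox 0 (t *\<^sub>R 1)) (\<lambda>y. h (z + y))) (cbox 0 (t *\<^sub>R 1))"
    by (intro integrable_integral integrable_continuous continuous_on_subset[OF c]) auto
  from has_integral_affinity'[OF this t(1), of 0]
  have "integral (cbox 0 1) (\<lambda>y. h (z + t *\<^sub>R y)) = integral (cbox 0 (t *\<^sub>R 1)) (\<lambda>y. h (z + y)) / t ^ 3"
    using t by (simp add: integral_unique divide_inverse mult.commute)
  also have "integral (cbox 0 (t *\<^sub>R 1)) (\<lambda>y. h (z + y)) \<le> integral (cbox 0 1) (\<lambda>y. h (z + y))"
  proof (intro integral_subset_le integrable_continuous continuous_on_subset[OF c])
    show "cbox 0 (t *\<^sub>R 1) \<subseteq> cbox 0 (1 :: real^3)"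
      using t by (intro subset_box(1)[THEN iffD2] impI) (auto simp: Basis_vec_def inner_axis)
  qed (use h in auto)
  also have "\<dots> = (LINT y|torus. h y)"
    using torus_integral[OF c] torus_shift[OF h(1), of z] by (simp add: add.commute)
  finally have "integral (cbox 0 1) (\<lambda>y. h (z + t *\<^sub>R y)) \<le> (LINT y|torus. h y) / t ^ 3"
    using t by (simp add: divide_right_mono)
  moreover have "(LINT y|torus. h (z + t *\<^sub>R y)) = integral (cbox 0 1) (\<lambda>y. h (z + t *\<^sub>R y))"
    by (intro torus_integral continuous_on_compose2[OF cper_cont[OF h(1), of UNIV]]) (auto intro!: continuous_intros)
  ultimately show ?thesis by simp
qed


text \<open>If the \<open>i\<close>-th component of \<open>w x\<close> has maximal modulus, it dominates \<open>d \<bullet> w x\<close> for every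
  direction \<open>d = 4 e\<^sub>i + y\<close> with \<open>y\<close> in the unit cube; averaging over \<open>y\<close>, the line integrals at
  parameter \<open>t\<close> cost a factor \<open>t powr (- 3/p)\<close>, which is integrable.\<close>

lemma Morrey_Korn:
  assumes p: "3 < p"
  shows "\<exists>C\<ge>0. \<forall>w. C1_field w \<longrightarrow> (\<forall>i. (LINT y|torus. w y $ i) = 0) \<longrightarrow>
    (\<forall>x. norm (w x) \<le> C * (LINT x|torus. norm (sym_grad w x) powr p) powr (1/p))"
proof -
  \<comment> \<open>7 bounds |d|, 49 its square, and 1/(1 - 3/p) is the integral of t^(-3/p) over
    [0, 1], finite exactly because p > 3.\<close>
  define B where "B = 7 * (27 * 27 powr p) powr (1/p) + 49 / (1 - 3/p)"
  have "0 < 1 - 3/p" using p by simp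
  then have B0: "0 \<le> B" unfolding B_def by (intro add_nonneg_nonneg divide_nonneg_pos mult_nonneg_nonneg) auto
  show ?thesis
  proof (intro exI[of _ B] conjI allI impI B0)
    fix w x assume w: "C1_field w" and mean: "\<forall>i. (LINT y|torus. w y $ i) = 0"
    define Q where "Q = (\<lambda>y. norm (sym_grad w y))"
    define J where "J = (LINT x|torus. Q x powr p) powr (1/p)"
    have Q: "cper Q" unfolding Q_def by (rule sym_grad_cper[OF w])
    have Q0: "0 \<le> Q y" for y by (simp add: Q_def)
    have Qp: "cper (\<lambda>y. Q y powr p)" using Q Q0 p by (intro cper_powr) auto
    have nw: "cper (\<lambda>y. norm (w y))" by (rule C1_field_norm_cper[OF w])
    have J0: "0 \<le> J" by (simp add: J_def)
    obtain i where i: "\<And>j. \<bar>w x $ j\<bar> \<le> \<bar>w x $ i\<bar>" "norm (w x) \<le> 2 * \<bar>w x $ i\<bar>"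
      using max_component[of "w x"] by blast
    \<comment> \<open>The factor 4 beats the perturbation y: component i contributes at least 4
      |w_i|, the other two take away at most |w_i| each, and 2 |w_i| still dominates |w(x)|. Also |e
      + y| <= 4 + 3 = 7.\<close>
    define e :: "real^3" where "e = 4 *\<^sub>R axis i 1"
    have point: "norm (w x) \<le> 7 * norm (w (x + (e + y))) + 49 * avg (e + y) Q x" if y: "y \<in> cbox 0 1" for y
    proof -
      let ?d = "e + y"
      have y01: "0 \<le> y $ j" "y $ j \<le> 1" for j using y by (auto simp: mem_box_cart)
      have nd: "norm ?d \<le> 7"
      proof -
        have "norm ?d \<le> norm e + norm y" by (rule norm_triangle_ineq)
        also have "norm e = 4" by (simp add: e_def)
        also have "norm y \<le> \<bar>y $ 1\<bar> + \<bar>y $ 2\<bar> + \<bar>y $ 3\<bar>"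
          using norm_le_l1_cart[of y] by (simp add: sum_3)
        finally show ?thesis using y01[of 1] y01[of 2] y01[of 3] by simp
      qed
      have "2 * \<bar>w x $ i\<bar> \<le> \<bar>?d \<bullet> w x\<bar>"
      proof -
        have "y \<bullet> w x = y $ i * w x $ i + (\<Sum>j\<in>UNIV - {i}. y $ j * w x $ j)"
          unfolding inner_vec_def inner_real_def by (subst sum.remove[of _ i]) auto
        then have "?d \<bullet> w x = (4 + y $ i) * w x $ i + (\<Sum>j\<in>UNIV - {i}. y $ j * w x $ j)"
          by (simp add: e_def inner_add_left inner_axis' algebra_simps)
        moreover have "\<bar>\<Sum>j\<in>UNIV - {i}. y $ j * w x $ j\<bar> \<le> (\<Sum>j\<in>UNIV - {i}. \<bar>w x $ i\<bar>)"
        proof (rule order_trans[OF sum_abs sum_mono])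
          fix j
          have "\<bar>y $ j\<bar> * \<bar>w x $ j\<bar> \<le> 1 * \<bar>w x $ i\<bar>"
            using y01[of j] i(1)[of j] by (intro mult_mono) auto
          then show "\<bar>y $ j * w x $ j\<bar> \<le> \<bar>w x $ i\<bar>" by (simp add: abs_mult)
        qed
        moreover have "(\<Sum>j\<in>UNIV - {i}. \<bar>w x $ i\<bar>) = 2 * \<bar>w x $ i\<bar>"
          by (simp add: card_Diff_singleton)
        moreover have "4 * \<bar>w x $ i\<bar> \<le> \<bar>(4 + y $ i) * w x $ i\<bar>"
          using y01[of i] by (simp add: abs_mult mult_right_mono)
        ultimately show ?thesis by linarith
      qed
      moreover have "\<bar>?d \<bullet> w (x + 1 *\<^sub>R ?d) - ?d \<bullet> w (x + 0 *\<^sub>R ?d)\<bar> \<le> avg ?d (\<lambda>y. (norm ?d)\<^sup>2 * Q y) x"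
      proof (rule line_increment_bound[where \<phi> = "\<lambda>t. ?d \<bullet> w (x + t *\<^sub>R ?d)"])
        show "cper (\<lambda>y. (norm ?d)\<^sup>2 * Q y)" by (intro cper_mult cper_const Q)
        show "\<exists>D. ((\<lambda>t. ?d \<bullet> w (x + t *\<^sub>R ?d)) has_real_derivative D) (at t) \<and>
            \<bar>D\<bar> \<le> (norm ?d)\<^sup>2 * Q (x + t *\<^sub>R ?d)" for t
          unfolding Q_def using C1_field_line[OF w, of ?d x t] by blast
      qed auto
      moreover have "avg ?d (\<lambda>y. (norm ?d)\<^sup>2 * Q y) x \<le> 49 * avg ?d Q x"
      proof -
        have "(norm ?d)\<^sup>2 \<le> 7\<^sup>2" using nd by (intro power_mono) auto
        then show ?thesis
          using avg_nonneg[OF Q Q0, of ?d x] by (simp add: avg_cmult mult_right_mono)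
      qed
      moreover have "\<bar>?d \<bullet> w (x + 1 *\<^sub>R ?d)\<bar> \<le> 7 * norm (w (x + ?d))"
        using Cauchy_Schwarz_ineq2[of ?d "w (x + ?d)"] mult_right_mono[OF nd, of "norm (w (x + ?d))"] by simp
      ultimately show ?thesis using i(2) by simp
    qed
    have cont2: "continuous_on S (\<lambda>z. Q (x + snd z *\<^sub>R (e + fst z)))" for S
      by (intro continuous_on_compose2[OF cper_cont[OF Q, of UNIV]]) (auto intro!: continuous_intros)
    have cont_avg: "continuous_on UNIV (\<lambda>y. avg (e + y) Q x)"
    proof -
      have "continuous_on UNIV (\<lambda>y. integral (cbox 0 1) (\<lambda>t::real. Q (x + t *\<^sub>R (e + y))))"
        by (rule integral_continuous_on_param) (use cont2 in \<open>simp add: split_beta\<close>)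
      then show ?thesis by (simp add: avg_def)
    qed
    have cont_w: "continuous_on UNIV (\<lambda>y. norm (w (x + (e + y))))"
      using cper_cont[OF cper_shift[OF nw, of "x + e"]] by (simp add: add_ac)
    have "norm (w x) \<le> (LINT y|torus. 7 * norm (w (x + (e + y))) + 49 * avg (e + y) Q x)"
    proof -
      have "(LINT y|torus. norm (w x)) \<le> (LINT y|torus. 7 * norm (w (x + (e + y))) + 49 * avg (e + y) Q x)"
        using point by (intro integral_mono torus_integrable continuous_intros cont_w cont_avg)
          (auto simp: torus_def space_restrict_space)
      then show ?thesis by simp
    qed
    also have "\<dots> = 7 * (LINT y|torus. norm (w (x + (e + y)))) + 49 * (LINT y|torus. avg (e + y) Q x)"
      using cont_w cont_avg by (simp add: torus_integrable)
    also have "(LINT y|torus. norm (w (x + (e + y)))) = (LINT y|torus. norm (w y))"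
      using torus_shift[OF nw, of "x + e"] by (simp add: add_ac)
    also have "\<dots> \<le> (27 * 27 powr p) powr (1/p) * J"
    proof -
      have "(LINT y|torus. norm (w y)) powr p \<le> (LINT y|torus. norm (w y) powr p)"
        using p by (intro torus_Jensen nw) auto
      also have "\<dots> \<le> 27 * 27 powr p * (LINT y|torus. Q y powr p)"
        unfolding Q_def using p mean by (intro Korn_Poincare w) auto
      finally have "((LINT y|torus. norm (w y)) powr p) powr (1/p) \<le> (27 * 27 powr p * (LINT y|torus. Q y powr p)) powr (1/p)"
        using p by (intro powr_mono2) auto
      then show ?thesis
        using p by (simp add: J_def powr_powr powr_mult torus_integral_nonneg)
    qed
    also have "(LINT y|torus. avg (e + y) Q x) \<le> J / (1 - 3/p)"
    proof -
      let ?A = "\<lambda>t. integral (cbox 0 1) (\<lambda>y. Q (x + t *\<^sub>R (e + y)))"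
      have "(LINT y|torus. avg (e + y) Q x) = integral (cbox 0 1) (\<lambda>y. integral (cbox 0 (1::real)) (\<lambda>t. Q (x + t *\<^sub>R (e + y))))"
        using torus_integral[OF cont_avg] by (simp add: avg_def)
      also have "\<dots> = integral (cbox 0 1) ?A"
        by (rule integral_swap_continuous) (use cont2 in \<open>simp add: split_beta\<close>)
      also have "\<dots> \<le> J / (1 - 3/p)"
      proof -
        \<comment> \<open>For fixed t the points t y fill a cube of side t; Jensen's inequality
          through Hoelder and the scaled-cube bound give the factor t^(-3/p).\<close>
        have A: "?A t \<le> J * t powr (- (3/p))" if t: "0 < t" "t \<le> 1" for t
        proof -
          have c: "continuous_on UNIV (\<lambda>y. h (x + t *\<^sub>R (e + y)))" if "cper h" for h
            by (intro continuous_on_compose2[OF cper_cont[OF that, of UNIV]]) (auto intro!: continuous_intros)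
          have "?A t = (LINT y|torus. (Q (x + t *\<^sub>R (e + y)) powr p) powr (1/p) * 1 powr (1 - 1/p))"
            using torus_integral[OF c[OF Q]] Q0 p by (simp add: powr_powr)
          also have "\<dots> \<le> (LINT y|torus. Q (x + t *\<^sub>R (e + y)) powr p) powr (1/p) * (LINT y|torus. 1) powr (1 - 1/p)"
            using p by (intro Holder_inequality_weights torus_integrable c[OF Qp] continuous_on_const) auto
          also have "\<dots> = (LINT y|torus. Q ((x + t *\<^sub>R e) + t *\<^sub>R y) powr p) powr (1/p)"
            by (simp add: scaleR_right_distrib add.assoc)
          also have "\<dots> \<le> ((LINT y|torus. Q y powr p) / t ^ 3) powr (1/p)"
            using torus_scaled_shift[OF Qp _ t, of "x + t *\<^sub>R e"] p
            by (intro powr_mono2) (auto intro: torus_integral_nonneg)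
          also have "\<dots> = J * t powr (- (3/p))"
          proof -
            have "(t ^ 3) powr (1/p) = t powr (3/p)"
              using t powr_powr[of t 3 "1/p"] by (simp add: powr_numeral)
            moreover have "((LINT y|torus. Q y powr p) / t ^ 3) powr (1/p) = J / (t ^ 3) powr (1/p)"
              unfolding J_def using t by (intro powr_divide)
            ultimately show ?thesis
              using t by (simp add: powr_minus_divide)
          qed
          finally show ?thesis .
        qed
        have I: "((\<lambda>t. J * t powr (- (3/p))) has_integral J * (1 / (1 - 3/p))) {0..1}"
          using has_integral_powr_from_0[of "- (3/p)" 1] p by (intro has_integral_mult_right) simp
        have cA: "?A integrable_on {0..1}"
        proof -
          have "continuous_on (cbox 0 1) (\<lambda>t::real. ?A t)"
            by (rule integral_continuous_on_param)
              (auto simp: split_beta intro!: continuous_on_compose2[OF cper_cont[OF Q, of UNIV]] continuous_intros)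
          then show ?thesis by (intro integrable_continuous_interval) simp
        qed
        \<comment> \<open>The majorant has the value 0 at t = 0, since \<open>0 powr a = 0\<close>
          for every \<open>a\<close>, so the integrand is altered at this one point.\<close>
        have "integral {0..1} (\<lambda>t. if t = 0 then 0 else ?A t) \<le> J * (1 / (1 - 3/p))"
        proof (rule has_integral_le[OF integrable_integral I])
          show "(\<lambda>t. if t = 0 then 0 else ?A t) integrable_on {0..1}"
            by (rule integrable_spike_finite[OF _ _ cA, of "{0}"]) auto
          show "(if t = 0 then 0 else ?A t) \<le> J * t powr (- (3/p))" if "t \<in> {0..1}" for t
            using A[of t] that J0 by (cases "t = 0") auto
        qed
        moreover have "integral {0..1} (\<lambda>t. if t = 0 then 0 else ?A t) = integral {0..1} ?A"
          by (rule integral_spike[of "{0}"]) auto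
        ultimately show ?thesis by simp
      qed
      finally show ?thesis .
    qed
    finally have "norm (w x) \<le> 7 * ((27 * 27 powr p) powr (1/p) * J) + 49 * (J / (1 - 3/p))"
      by simp
    also have "\<dots> = B * J" by (simp add: B_def algebra_simps)
    finally show "norm (w x) \<le> B * (LINT x|torus. norm (sym_grad w x) powr p) powr (1/p)"
      by (simp add: J_def Q_def)
  qed
qed

section \<open>The density-weighted estimate\<close>

lemma torus_weighted_integrable:
  assumes g: "cper g" and \<rho>: "integrable torus \<rho>"
  shows "integrable torus (\<lambda>x. g x * \<rho> x :: real)"
proof -
  have "compact (g ` cbox 0 1)"
    by (intro compact_continuous_image cper_cont g compact_cbox)
  then obtain B where B: "\<And>x. x \<in> cbox 0 1 \<Longrightarrow> \<bar>g x\<bar> \<le> B"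
    using compact_imp_bounded[of "g ` cbox 0 1"] by (auto simp: bounded_iff)
  have [measurable]: "g \<in> borel_measurable torus" "\<rho> \<in> borel_measurable torus"
    using cper_integrable[OF g] \<rho> by auto
  show ?thesis
  proof (rule Bochner_Integration.integrable_bound)
    show "integrable torus (\<lambda>x. B * \<rho> x)" using \<rho> by simp
    show "AE x in torus. norm (g x * \<rho> x) \<le> norm (B * \<rho> x)"
    proof (rule AE_I2)
      fix x assume "x \<in> space torus"
      then have "\<bar>g x\<bar> \<le> \<bar>B\<bar>" using B[of x] by (force simp: torus_def space_restrict_space)
      then show "norm (g x * \<rho> x) \<le> norm (B * \<rho> x)" by (simp add: abs_mult mult_right_mono)
    qed
  qed measurable
qed

lemma Lr_norm_le_mono: "Lr_norm_le r g M \<Longrightarrow> M \<le> M' \<Longrightarrow> Lr_norm_le r g M'"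
  unfolding Lr_norm_le_def by (auto split: if_splits elim!: eventually_mono)

text \<open>Inclusion of Lebesgue spaces on a probability space, by rho^s <= 1 + rho^q. The bound
  \<open>B\<close> is chosen before the density, which later makes it independent of time; |M|
  appears because the sign of \<open>M\<close> is not prescribed.\<close>

lemma Lr_norm_le_imp_powr_bound:
  assumes s: "0 < s" "ereal s \<le> r"
  shows "\<exists>B\<ge>0. \<forall>\<rho>. (\<forall>x. 0 \<le> \<rho> x) \<longrightarrow> Lr_norm_le r \<rho> M \<longrightarrow>
    integrable torus (\<lambda>x. \<rho> x powr s) \<and> (LINT x|torus. \<rho> x powr s) \<le> B"
proof (cases "r = \<infinity>")
  case True
  show ?thesis
  proof (intro exI[of _ "\<bar>M\<bar> powr s"] conjI allI impI)
    fix \<rho> :: "real^3 \<Rightarrow> real" assume \<rho>: "\<forall>x. 0 \<le> \<rho> x" "Lr_norm_le r \<rho> M"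
    have [measurable]: "\<rho> \<in> borel_measurable torus" and M: "AE x in torus. \<bar>\<rho> x\<bar> \<le> M"
      using \<rho>(2) True by (auto simp: Lr_norm_le_def)
    have b: "AE x in torus. \<rho> x powr s \<le> \<bar>M\<bar> powr s"
      using M by eventually_elim (use \<rho>(1) s in \<open>auto intro!: powr_mono2\<close>)
    have c: "integrable torus (\<lambda>x. \<bar>M\<bar> powr s)" by (simp add: cper_integrable cper_const)
    show int: "integrable torus (\<lambda>x. \<rho> x powr s)"
      by (rule Bochner_Integration.integrable_bound[OF c]) (use b in auto)
    have "(LINT x|torus. \<rho> x powr s) \<le> (LINT x|torus. \<bar>M\<bar> powr s)"
      by (rule integral_mono_AE[OF int c b])
    then show "(LINT x|torus. \<rho> x powr s) \<le> \<bar>M\<bar> powr s" by simp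
  qed simp
next
  case False
  then obtain q where q: "r = ereal q" "s \<le> q" using s(2) by (cases r) auto
  show ?thesis
  proof (intro exI[of _ "1 + \<bar>M\<bar> powr q"] conjI allI impI)
    fix \<rho> :: "real^3 \<Rightarrow> real" assume \<rho>: "\<forall>x. 0 \<le> \<rho> x" "Lr_norm_le r \<rho> M"
    have [measurable]: "\<rho> \<in> borel_measurable torus" and int_q: "integrable torus (\<lambda>x. \<rho> x powr q)"
      and M: "(LINT x|torus. \<rho> x powr q) powr (1/q) \<le> M"
      using \<rho> q by (auto simp: Lr_norm_le_def)
    have b: "\<rho> x powr s \<le> 1 + \<rho> x powr q" for x
    proof (cases "\<rho> x \<le> 1")
      case True
      then have "\<rho> x powr s \<le> 1 powr s" using \<rho> s by (intro powr_mono2) auto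
      then show ?thesis by (simp add: add_increasing2)
    next
      case False
      then have "\<rho> x powr s \<le> \<rho> x powr q" using q by (intro powr_mono) auto
      then show ?thesis by simp
    qed
    have c: "integrable torus (\<lambda>x. 1 + \<rho> x powr q)"
      using int_q by (simp add: cper_integrable cper_const)
    show int: "integrable torus (\<lambda>x. \<rho> x powr s)"
      by (rule Bochner_Integration.integrable_bound[OF c]) (use b in \<open>auto intro!: AE_I2\<close>)
    have "(LINT x|torus. \<rho> x powr s) \<le> (LINT x|torus. 1 + \<rho> x powr q)"
      by (rule integral_mono[OF int c b])
    also have "\<dots> = 1 + (LINT x|torus. \<rho> x powr q)"
      using int_q by (simp add: cper_integrable cper_const)
    also have "(LINT x|torus. \<rho> x powr q) = ((LINT x|torus. \<rho> x powr q) powr (1/q)) powr q"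
      using q s torus_integral_nonneg[of "\<lambda>x. \<rho> x powr q"] by (simp add: powr_powr)
    also have "\<dots> \<le> \<bar>M\<bar> powr q"
      using M q s by (intro powr_mono2) auto
    finally show "(LINT x|torus. \<rho> x powr s) \<le> 1 + \<bar>M\<bar> powr q" by simp
  qed simp
qed

lemma norm_sq_powr: "0 < a \<Longrightarrow> (norm v powr a) powr (2/a) = (norm v)\<^sup>2"
  by (cases "v = 0") (simp_all add: powr_powr powr_numeral)

text \<open>Hoelder with 2/q + 1/s = 1 for the critical q; s = 3p/(5p-6) is positive exactly when p
  > 6/5. The weight is a general \<open>\<sigma>\<close>, so that a power of the density can be
  inserted as well as the density itself.\<close>

lemma weighted_Sobolev:
  assumes p: "6/5 < p" "p < 3"
  shows "\<exists>C\<ge>0. \<forall>w \<sigma>. C1_field w \<longrightarrow> (\<forall>i. (LINT y|torus. w y $ i) = 0) \<longrightarrow> (\<forall>x. 0 \<le> \<sigma> x) \<longrightarrow>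
    integrable torus (\<lambda>x. \<sigma> x powr (3 * p / (5 * p - 6))) \<longrightarrow>
    integrable torus (\<lambda>x. (norm (w x))\<^sup>2 * \<sigma> x) \<and>
    (LINT x|torus. (norm (w x))\<^sup>2 * \<sigma> x) \<le>
      C * (LINT x|torus. \<sigma> x powr (3 * p / (5 * p - 6))) powr ((5 * p - 6) / (3 * p)) *
        (LINT x|torus. norm (sym_grad w x) powr p) powr (2/p)"
proof -
  define s where "s = 3 * p / (5 * p - 6)"
  define q where "q = 3 * p / (3 - p)"
  have s0: "0 < s" and q0: "0 < q" using p by (auto simp: s_def q_def)
  have inv: "1/s = (5 * p - 6) / (3 * p)" "1/q = (3 - p) / (3 * p)" using p by (auto simp: s_def q_def)
  have sum1: "2/q + 1/s = 1"
  proof -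
    have "2/q = 2 * (1/q)" by simp
    then show ?thesis unfolding inv using p by (simp add: field_simps)
  qed
  obtain C where C: "C \<ge> 0" "\<And>w. C1_field w \<Longrightarrow> (\<forall>i. (LINT y|torus. w y $ i) = 0) \<Longrightarrow>
    (LINT x|torus. norm (w x) powr q) powr (1/q) \<le> C * (LINT x|torus. norm (sym_grad w x) powr p) powr (1/p)"
    using Sobolev_Korn[of p] p unfolding inv unfolding q_def by auto
  show ?thesis
  proof (intro exI[of _ "C\<^sup>2"] conjI allI impI)
    fix w and \<sigma> :: "real^3 \<Rightarrow> real"
    assume w: "C1_field w" and mean: "\<forall>i. (LINT y|torus. w y $ i) = 0" and \<sigma>: "\<forall>x. 0 \<le> \<sigma> x"
      and "integrable torus (\<lambda>x. \<sigma> x powr (3 * p / (5 * p - 6)))"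
    then have int: "integrable torus (\<lambda>x. \<sigma> x powr s)" by (simp add: s_def)
    have cw: "integrable torus (\<lambda>x. norm (w x) powr q)"
      using q0 by (intro cper_integrable cper_powr C1_field_norm_cper w) auto
    have eq: "(norm (w x))\<^sup>2 * \<sigma> x = (norm (w x) powr q) powr (2/q) * (\<sigma> x powr s) powr (1/s)" for x
      using norm_sq_powr[OF q0, of "w x"] s0 \<sigma> by (simp add: powr_powr)
    note H = Holder_inequality_weights[OF cw _ int _ _ _ sum1]
    show "integrable torus (\<lambda>x. (norm (w x))\<^sup>2 * \<sigma> x)"
      unfolding eq using s0 q0 by (intro H) auto
    have "(LINT x|torus. (norm (w x))\<^sup>2 * \<sigma> x) \<le> (LINT x|torus. norm (w x) powr q) powr (2/q) * (LINT x|torus. \<sigma> x powr s) powr (1/s)"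
      unfolding eq using s0 q0 by (intro H) auto
    also have "(LINT x|torus. norm (w x) powr q) powr (2/q) = ((LINT x|torus. norm (w x) powr q) powr (1/q))\<^sup>2"
      using powr_powr[of "LINT x|torus. norm (w x) powr q" "1/q" 2] by (simp add: powr_numeral)
    also have "\<dots> \<le> (C * (LINT x|torus. norm (sym_grad w x) powr p) powr (1/p))\<^sup>2"
      using C(2)[OF w mean] by (intro power_mono) auto
    also have "\<dots> = C\<^sup>2 * (LINT x|torus. norm (sym_grad w x) powr p) powr (2/p)"
      using powr_powr[of "LINT x|torus. norm (sym_grad w x) powr p" "1/p" 2]
      by (simp add: power_mult_distrib powr_numeral)
    finally show "(LINT x|torus. (norm (w x))\<^sup>2 * \<sigma> x) \<le>
      C\<^sup>2 * (LINT x|torus. \<sigma> x powr (3 * p / (5 * p - 6))) powr ((5 * p - 6) / (3 * p)) *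
        (LINT x|torus. norm (sym_grad w x) powr p) powr (2/p)"
      unfolding inv(1) by (simp add: s_def mult_ac mult_right_mono)
  qed simp
qed

text \<open>The critical exponent 3p/(3-p) is at least 2 exactly when p >= 6/5, so this version
  still covers the endpoint, where the weighted inequality would require s to be infinite.\<close>

lemma L2_Sobolev:
  assumes p: "6/5 \<le> p" "p < 3"
  shows "\<exists>C\<ge>0. \<forall>w. C1_field w \<longrightarrow> (\<forall>i. (LINT y|torus. w y $ i) = 0) \<longrightarrow>
    (LINT x|torus. (norm (w x))\<^sup>2) \<le> C * (LINT x|torus. norm (sym_grad w x) powr p) powr (2/p)"
proof -
  define q where "q = 3 * p / (3 - p)"
  have q2: "2 \<le> q" using p by (simp add: q_def field_simps)
  have inv: "1/q = (3 - p) / (3 * p)" using p by (auto simp: q_def)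
  obtain C where C: "C \<ge> 0" "\<And>w. C1_field w \<Longrightarrow> (\<forall>i. (LINT y|torus. w y $ i) = 0) \<Longrightarrow>
    (LINT x|torus. norm (w x) powr q) powr (1/q) \<le> C * (LINT x|torus. norm (sym_grad w x) powr p) powr (1/p)"
    using Sobolev_Korn[of p] p unfolding inv unfolding q_def by auto
  show ?thesis
  proof (intro exI[of _ "C\<^sup>2"] conjI allI impI)
    fix w assume w: "C1_field w" and mean: "\<forall>i. (LINT y|torus. w y $ i) = 0"
    have c2: "cper (\<lambda>x. (norm (w x))\<^sup>2)"
      unfolding power2_eq_square by (intro cper_mult C1_field_norm_cper w)
    have "(LINT x|torus. (norm (w x))\<^sup>2) powr (q/2) \<le> (LINT x|torus. (norm (w x))\<^sup>2 powr (q/2))"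
      using q2 by (intro torus_Jensen c2) auto
    also have "(\<lambda>x. (norm (w x))\<^sup>2 powr (q/2)) = (\<lambda>x. norm (w x) powr q)"
      using q2 by (auto simp: powr_numeral[symmetric] powr_powr simp del: powr_numeral)
    finally have "((LINT x|torus. (norm (w x))\<^sup>2) powr (q/2)) powr (2/q) \<le> (LINT x|torus. norm (w x) powr q) powr (2/q)"
      using q2 by (intro powr_mono2) auto
    then have "(LINT x|torus. (norm (w x))\<^sup>2) \<le> (LINT x|torus. norm (w x) powr q) powr (2/q)"
      using q2 by (simp add: powr_powr torus_integral_nonneg)
    also have "\<dots> = ((LINT x|torus. norm (w x) powr q) powr (1/q))\<^sup>2"
      using powr_powr[of "LINT x|torus. norm (w x) powr q" "1/q" 2] by (simp add: powr_numeral)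
    also have "\<dots> \<le> (C * (LINT x|torus. norm (sym_grad w x) powr p) powr (1/p))\<^sup>2"
      using C(2)[OF w mean] by (intro power_mono) auto
    also have "\<dots> = C\<^sup>2 * (LINT x|torus. norm (sym_grad w x) powr p) powr (2/p)"
      using powr_powr[of "LINT x|torus. norm (sym_grad w x) powr p" "1/p" 2]
      by (simp add: power_mult_distrib powr_numeral)
    finally show "(LINT x|torus. (norm (w x))\<^sup>2) \<le> C\<^sup>2 * (LINT x|torus. norm (sym_grad w x) powr p) powr (2/p)" .
  qed simp
qed

text \<open>\<open>K\<close> is uniform over all fields and densities with the given bounds, which
  is what makes it independent of time. \<open>A\<close> is an a priori bound for int |w|^2; it pays
  for the surplus power of w when p < 2, whence the exponent \<open>min 1 (2/p)\<close>.\<close>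

definition density_bound :: "real \<Rightarrow> ereal \<Rightarrow> real \<Rightarrow> real \<Rightarrow> real \<Rightarrow> bool" where
  "density_bound p r M A K \<longleftrightarrow> (\<forall>w \<rho>. C1_field w \<longrightarrow> (\<forall>i. (LINT y|torus. w y $ i) = 0) \<longrightarrow>
    (LINT x|torus. (norm (w x))\<^sup>2) \<le> A \<longrightarrow> (\<forall>x. 0 \<le> \<rho> x) \<longrightarrow> integrable torus \<rho> \<longrightarrow>
    (LINT x|torus. \<rho> x) = 1 \<longrightarrow> Lr_norm_le r \<rho> M \<longrightarrow>
    (LINT x|torus. (norm (w x))\<^sup>2 * \<rho> x) \<le> K * (LINT x|torus. norm (sym_grad w x) powr p) powr (min 1 (2/p)))"

text \<open>Here w is bounded uniformly, and the density integrates to 1.\<close>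

lemma density_bound_gt3:
  assumes p: "3 < p"
  shows "\<exists>K\<ge>0. density_bound p r M A K"
proof -
  obtain C where C: "C \<ge> 0" "\<And>w x. C1_field w \<Longrightarrow> (\<forall>i. (LINT y|torus. w y $ i) = 0) \<Longrightarrow>
    norm (w x) \<le> C * (LINT x|torus. norm (sym_grad w x) powr p) powr (1/p)"
    using Morrey_Korn[OF p] by blast
  show ?thesis unfolding density_bound_def
  proof (intro exI[of _ "C\<^sup>2"] conjI allI impI)
    fix w and \<rho> :: "real^3 \<Rightarrow> real" assume w: "C1_field w" "\<forall>i. (LINT y|torus. w y $ i) = 0"
      and \<rho>: "\<forall>x. 0 \<le> \<rho> x" "integrable torus \<rho>" "(LINT x|torus. \<rho> x) = 1"
    let ?D = "LINT x|torus. norm (sym_grad w x) powr p"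
    have c2: "cper (\<lambda>x. (norm (w x))\<^sup>2)"
      unfolding power2_eq_square by (intro cper_mult C1_field_norm_cper w)
    have "(LINT x|torus. (norm (w x))\<^sup>2 * \<rho> x) \<le> (LINT x|torus. (C * ?D powr (1/p))\<^sup>2 * \<rho> x)"
      using C(2)[OF w] \<rho>
      by (intro integral_mono torus_weighted_integrable c2 cper_const mult_right_mono power_mono) auto
    also have "\<dots> = C\<^sup>2 * ?D powr (2/p)"
      using powr_powr[of ?D "1/p" 2] \<rho>(3) by (simp add: power_mult_distrib powr_numeral)
    also have "2/p = min 1 (2/p)" using p by simp
    finally show "(LINT x|torus. (norm (w x))\<^sup>2 * \<rho> x) \<le> C\<^sup>2 * ?D powr min 1 (2/p)" .
  qed simp
qed

lemma density_bound_2_3: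
  assumes p: "2 \<le> p" "p < 3" and r: "ereal (3 * p / (5 * p - 6)) \<le> r"
  shows "\<exists>K\<ge>0. density_bound p r M A K"
proof -
  obtain C where C: "C \<ge> 0" "\<And>w \<sigma>. C1_field w \<Longrightarrow> (\<forall>i. (LINT y|torus. w y $ i) = 0) \<Longrightarrow> (\<forall>x. 0 \<le> \<sigma> x) \<Longrightarrow>
    integrable torus (\<lambda>x. \<sigma> x powr (3 * p / (5 * p - 6))) \<Longrightarrow>
    (LINT x|torus. (norm (w x))\<^sup>2 * \<sigma> x) \<le>
      C * (LINT x|torus. \<sigma> x powr (3 * p / (5 * p - 6))) powr ((5 * p - 6) / (3 * p)) *
        (LINT x|torus. norm (sym_grad w x) powr p) powr (2/p)"
    using weighted_Sobolev[of p] p by auto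
  obtain B where B: "B \<ge> 0" "\<And>\<rho>. (\<forall>x. 0 \<le> \<rho> x) \<Longrightarrow> Lr_norm_le r \<rho> M \<Longrightarrow>
    integrable torus (\<lambda>x. \<rho> x powr (3 * p / (5 * p - 6))) \<and> (LINT x|torus. \<rho> x powr (3 * p / (5 * p - 6))) \<le> B"
    using Lr_norm_le_imp_powr_bound[OF _ r, of M] p by auto
  show ?thesis unfolding density_bound_def
  proof (intro exI[of _ "C * B powr ((5 * p - 6) / (3 * p))"] conjI allI impI)
    fix w and \<rho> :: "real^3 \<Rightarrow> real" assume w: "C1_field w" "\<forall>i. (LINT y|torus. w y $ i) = 0"
      and \<rho>: "\<forall>x. 0 \<le> \<rho> x" "Lr_norm_le r \<rho> M"
    note B' = B(2)[OF \<rho>]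
    have "(LINT x|torus. (norm (w x))\<^sup>2 * \<rho> x) \<le>
      C * (LINT x|torus. \<rho> x powr (3 * p / (5 * p - 6))) powr ((5 * p - 6) / (3 * p)) *
        (LINT x|torus. norm (sym_grad w x) powr p) powr (2/p)"
      using C(2)[OF w \<rho>(1)] B' by blast
    also have "\<dots> \<le> C * B powr ((5 * p - 6) / (3 * p)) * (LINT x|torus. norm (sym_grad w x) powr p) powr (2/p)"
      using B' C(1) p by (intro mult_right_mono mult_left_mono powr_mono2) (auto simp: torus_integral_nonneg)
    also have "2/p = min 1 (2/p)" using p by simp
    finally show "(LINT x|torus. (norm (w x))\<^sup>2 * \<rho> x) \<le>
      C * B powr ((5 * p - 6) / (3 * p)) * (LINT x|torus. norm (sym_grad w x) powr p) powr (min 1 (2/p))" .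
  qed (use C in simp)
qed

text \<open>At p = 3 the critical exponent is lost, but r > 1 leaves room: descend to a slightly
  smaller p below 3, and return to the exponent 3 by Jensen.\<close>

lemma density_bound_3:
  assumes r: "1 < r"
  shows "\<exists>K\<ge>0. density_bound 3 r M A K"
proof -
  obtain s where s: "1 < s" "s \<le> 3/2" "ereal s \<le> r"
  proof (cases r)
    case (real q)
    then show ?thesis using r that[of "min q (3/2)"] by auto
  qed (use r that[of "3/2"] in auto)
  \<comment> \<open>The solution of 3p/(5p-6) = s; the cap s <= 3/2 corresponds to p >= 2 and s > 1
    to p < 3.\<close>
  define p where "p = 6 * s / (5 * s - 3)"
  have p: "2 \<le> p" "p < 3" using s by (auto simp: p_def field_simps)
  have "3 * p / (5 * p - 6) = s"
    using s by (simp add: p_def field_simps)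
  then obtain K where K: "K \<ge> 0" "density_bound p r M A K"
    using density_bound_2_3[OF p, of r M A] s by auto
  have "density_bound 3 r M A K" unfolding density_bound_def
  proof (intro allI impI)
    fix w and \<rho> :: "real^3 \<Rightarrow> real" assume w: "C1_field w"
      and rest: "\<forall>i. (LINT y|torus. w y $ i) = 0" "(LINT x|torus. (norm (w x))\<^sup>2) \<le> A" "\<forall>x. 0 \<le> \<rho> x"
        "integrable torus \<rho>" "(LINT x|torus. \<rho> x) = 1" "Lr_norm_le r \<rho> M"
    let ?Q = "\<lambda>x. norm (sym_grad w x)"
    have "(LINT x|torus. ?Q x powr p) powr (3/p) \<le> (LINT x|torus. (?Q x powr p) powr (3/p))"
      using p by (intro torus_Jensen cper_powr sym_grad_cper w) auto
    also have "\<dots> = (LINT x|torus. ?Q x powr 3)" using p by (simp add: powr_powr)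
    finally have "((LINT x|torus. ?Q x powr p) powr (3/p)) powr (2/3) \<le> (LINT x|torus. ?Q x powr 3) powr (2/3)"
      by (intro powr_mono2) auto
    then have le: "(LINT x|torus. ?Q x powr p) powr (2/p) \<le> (LINT x|torus. ?Q x powr 3) powr (2/3)"
      by (simp add: powr_powr)
    have "(LINT x|torus. (norm (w x))\<^sup>2 * \<rho> x) \<le> K * (LINT x|torus. ?Q x powr p) powr (min 1 (2/p))"
      using K(2) w rest unfolding density_bound_def by blast
    also have "min 1 (2/p) = 2/p" using p by simp
    also have "K * (LINT x|torus. ?Q x powr p) powr (2/p) \<le> K * (LINT x|torus. ?Q x powr 3) powr (2/3)"
      by (rule mult_left_mono[OF le K(1)])
    finally show "(LINT x|torus. (norm (w x))\<^sup>2 * \<rho> x) \<le> K * (LINT x|torus. ?Q x powr 3) powr (min 1 (2/3))"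
      by simp
  qed
  with K(1) show ?thesis by blast
qed

text \<open>For \<open>p < 2\<close> the integrand is split as \<open>|w|\<^sup>2 \<rho> = |w| powr (2 - p) * (|w| powr p * \<rho>)\<close>. The first
  factor is controlled by the bound \<open>A\<close> alone, so that only the power \<open>p\<close> of \<open>w\<close> is estimated by the
  symmetric gradient.\<close>

lemma density_bound_lt2:
  assumes p: "6/5 < p" "p < 2" and r: "ereal (6 / (5 * p - 6)) \<le> r"
  shows "\<exists>K\<ge>0. density_bound p r M A K"
proof -
  obtain C where C: "C \<ge> 0" "\<And>w \<sigma>. C1_field w \<Longrightarrow> (\<forall>i. (LINT y|torus. w y $ i) = 0) \<Longrightarrow> (\<forall>x. 0 \<le> \<sigma> x) \<Longrightarrow>
    integrable torus (\<lambda>x. \<sigma> x powr (3 * p / (5 * p - 6))) \<Longrightarrow>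
    integrable torus (\<lambda>x. (norm (w x))\<^sup>2 * \<sigma> x) \<and>
    (LINT x|torus. (norm (w x))\<^sup>2 * \<sigma> x) \<le>
      C * (LINT x|torus. \<sigma> x powr (3 * p / (5 * p - 6))) powr ((5 * p - 6) / (3 * p)) *
        (LINT x|torus. norm (sym_grad w x) powr p) powr (2/p)"
    using weighted_Sobolev[of p] p by auto
  obtain B where B: "B \<ge> 0" "\<And>\<rho>. (\<forall>x. 0 \<le> \<rho> x) \<Longrightarrow> Lr_norm_le r \<rho> M \<Longrightarrow>
    integrable torus (\<lambda>x. \<rho> x powr (6 / (5 * p - 6))) \<and> (LINT x|torus. \<rho> x powr (6 / (5 * p - 6))) \<le> B"
    using Lr_norm_le_imp_powr_bound[OF _ r, of M] p by auto
  define L where "L = C * B powr ((5 * p - 6) / (3 * p))"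
  have L0: "0 \<le> L" using C by (simp add: L_def)
  show ?thesis unfolding density_bound_def
  proof (intro exI[of _ "\<bar>A\<bar> powr (1 - p/2) * L powr (p/2)"] conjI allI impI)
    fix w and \<rho> :: "real^3 \<Rightarrow> real" assume w: "C1_field w" "\<forall>i. (LINT y|torus. w y $ i) = 0"
      and A: "(LINT x|torus. (norm (w x))\<^sup>2) \<le> A" and \<rho>: "\<forall>x. 0 \<le> \<rho> x" "Lr_norm_le r \<rho> M"
    let ?D = "LINT x|torus. norm (sym_grad w x) powr p"
    let ?\<sigma> = "\<lambda>x. \<rho> x powr (2/p)"
    \<comment> \<open>The origin of the exponent 6/(5p-6): with the weight rho^(2/p), the power p/2
      of |w|^2 rho^(2/p) is |w|^p rho, and the weighted inequality asks for its s-th power.\<close>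
    have ex: "2/p * (3 * p / (5 * p - 6)) = 6 / (5 * p - 6)" using p by simp
    have \<sigma>s: "?\<sigma> x powr (3 * p / (5 * p - 6)) = \<rho> x powr (6 / (5 * p - 6))" for x
      unfolding powr_powr ex ..
    note B' = B(2)[OF \<rho>]
    have C': "integrable torus (\<lambda>x. (norm (w x))\<^sup>2 * ?\<sigma> x)"
      "(LINT x|torus. (norm (w x))\<^sup>2 * ?\<sigma> x) \<le>
        C * (LINT x|torus. \<rho> x powr (6 / (5 * p - 6))) powr ((5 * p - 6) / (3 * p)) * ?D powr (2/p)"
      using C(2)[OF w, of ?\<sigma>] B' unfolding \<sigma>s by auto
    note C'(2)
    also have "C * (LINT x|torus. \<rho> x powr (6 / (5 * p - 6))) powr ((5 * p - 6) / (3 * p)) * ?D powr (2/p)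
        \<le> L * ?D powr (2/p)"
      unfolding L_def using B' C(1) p
      by (intro mult_right_mono mult_left_mono powr_mono2) (auto simp: torus_integral_nonneg)
    finally have S: "(LINT x|torus. (norm (w x))\<^sup>2 * ?\<sigma> x) \<le> L * ?D powr (2/p)" .
    have c2: "cper (\<lambda>x. (norm (w x))\<^sup>2)"
      unfolding power2_eq_square by (intro cper_mult C1_field_norm_cper w)
    have eq: "(norm (w x))\<^sup>2 * \<rho> x = (norm (w x))\<^sup>2 powr (1 - p/2) * ((norm (w x))\<^sup>2 * ?\<sigma> x) powr (p/2)" for x
    proof -
      have "((norm (w x))\<^sup>2 * ?\<sigma> x) powr (p/2) = (norm (w x))\<^sup>2 powr (p/2) * \<rho> x"
        using p \<rho>(1) by (simp add: powr_mult powr_powr)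
      then show ?thesis
        using powr_add[of "(norm (w x))\<^sup>2" "1 - p/2" "p/2"] by simp
    qed
    have "(LINT x|torus. (norm (w x))\<^sup>2 * \<rho> x) \<le>
        (LINT x|torus. (norm (w x))\<^sup>2) powr (1 - p/2) * (LINT x|torus. (norm (w x))\<^sup>2 * ?\<sigma> x) powr (p/2)"
      unfolding eq using p by (intro Holder_inequality_weights cper_integrable c2 C'(1)) auto
    also have "\<dots> \<le> \<bar>A\<bar> powr (1 - p/2) * (L * ?D powr (2/p)) powr (p/2)"
      using A S p by (intro mult_mono powr_mono2) (auto simp: torus_integral_nonneg)
    also have "\<dots> = \<bar>A\<bar> powr (1 - p/2) * L powr (p/2) * ?D powr (min 1 (2/p))"
      using p L0 by (simp add: powr_mult powr_powr torus_integral_nonneg)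
    finally show "(LINT x|torus. (norm (w x))\<^sup>2 * \<rho> x) \<le> \<bar>A\<bar> powr (1 - p/2) * L powr (p/2) * ?D powr (min 1 (2/p))" .
  qed simp
qed

lemma density_bound_6_5: "\<exists>K\<ge>0. density_bound (6/5) \<infinity> M A K"
proof -
  define p :: real where "p = 6/5"
  obtain C where C: "C \<ge> 0" "\<And>w. C1_field w \<Longrightarrow> (\<forall>i. (LINT y|torus. w y $ i) = 0) \<Longrightarrow>
    (LINT x|torus. (norm (w x))\<^sup>2) \<le> C * (LINT x|torus. norm (sym_grad w x) powr p) powr (2/p)"
    using L2_Sobolev[of p] by (auto simp: p_def)
  have "density_bound p \<infinity> M A (\<bar>M\<bar> * (\<bar>A\<bar> powr (1 - p/2) * C powr (p/2)))" unfolding density_bound_def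
  proof (intro conjI allI impI)
    fix w and \<rho> :: "real^3 \<Rightarrow> real" assume w: "C1_field w" "\<forall>i. (LINT y|torus. w y $ i) = 0"
      and A: "(LINT x|torus. (norm (w x))\<^sup>2) \<le> A"
      and \<rho>: "\<forall>x. 0 \<le> \<rho> x" "integrable torus \<rho>" "Lr_norm_le \<infinity> \<rho> M"
    let ?D = "LINT x|torus. norm (sym_grad w x) powr p"
    let ?X = "LINT x|torus. (norm (w x))\<^sup>2"
    have X0: "0 \<le> ?X" by (simp add: torus_integral_nonneg)
    have c2: "cper (\<lambda>x. (norm (w x))\<^sup>2)"
      unfolding power2_eq_square by (intro cper_mult C1_field_norm_cper w)
    have M: "AE x in torus. \<bar>\<rho> x\<bar> \<le> M" using \<rho>(3) by (simp add: Lr_norm_le_def)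
    have "(LINT x|torus. (norm (w x))\<^sup>2 * \<rho> x) \<le> (LINT x|torus. \<bar>M\<bar> * (norm (w x))\<^sup>2)"
    proof (rule integral_mono_AE)
      show "AE x in torus. (norm (w x))\<^sup>2 * \<rho> x \<le> \<bar>M\<bar> * (norm (w x))\<^sup>2"
        using M
      proof eventually_elim
        case (elim x)
        then have "(norm (w x))\<^sup>2 * \<rho> x \<le> (norm (w x))\<^sup>2 * \<bar>M\<bar>"
          by (intro mult_left_mono) auto
        then show ?case by (simp add: mult.commute)
      qed
      show "integrable torus (\<lambda>x. (norm (w x))\<^sup>2 * \<rho> x)"
        by (rule torus_weighted_integrable[OF c2 \<rho>(2)])
      show "integrable torus (\<lambda>x. \<bar>M\<bar> * (norm (w x))\<^sup>2)"
        by (intro cper_integrable cper_mult cper_const c2)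
    qed
    \<comment> \<open>int |w|^2 is split as for p < 2: the power 1 - p/2 goes to the a priori bound,
      the power p/2 to the Sobolev inequality.\<close>
    also have "\<dots> = \<bar>M\<bar> * (?X powr (1 - p/2) * ?X powr (p/2))"
      unfolding powr_add[symmetric] using X0 by simp
    also have "\<dots> \<le> \<bar>M\<bar> * (\<bar>A\<bar> powr (1 - p/2) * (C * ?D powr (2/p)) powr (p/2))"
      using A C(2)[OF w] X0 by (intro mult_left_mono mult_mono powr_mono2) (auto simp: p_def)
    also have "\<dots> = \<bar>M\<bar> * (\<bar>A\<bar> powr (1 - p/2) * C powr (p/2)) * ?D powr (min 1 (2/p))"
      using C(1) by (simp add: p_def powr_mult powr_powr torus_integral_nonneg)
    finally show "(LINT x|torus. (norm (w x))\<^sup>2 * \<rho> x) \<le>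
      \<bar>M\<bar> * (\<bar>A\<bar> powr (1 - p/2) * C powr (p/2)) * ?D powr (min 1 (2/p))" .
  qed
  moreover have "0 \<le> \<bar>M\<bar> * (\<bar>A\<bar> powr (1 - p/2) * C powr (p/2))" by simp
  ultimately show ?thesis unfolding p_def by blast
qed

lemma density_bound:
  assumes "6/5 \<le> p" "admissible_exponent p r"
  shows "\<exists>K\<ge>0. density_bound p r M A K"
proof -
  consider "p = 6/5" | "6/5 < p" "p < 2" | "2 \<le> p" "p < 3" | "p = 3" | "3 < p"
    using assms(1) by linarith
  then show ?thesis
  proof cases
    case 1
    with assms(2) have "r = \<infinity>" by (simp add: admissible_exponent_def)
    with 1 show ?thesis by (simp only: density_bound_6_5)
  qed (use assms(2) density_bound_lt2 density_bound_2_3 density_bound_3 density_bound_gt3 in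
      \<open>auto simp: admissible_exponent_def split: if_splits\<close>)
qed

section \<open>Decay from the dissipation inequality\<close>

text \<open>Telescoping over a uniform partition of mesh at most \<open>h\<close>. It replaces
  integrating a derivative, so an increment estimate valid only for short steps suffices.\<close>

lemma linear_growth_from_small_steps:
  fixes G :: "real \<Rightarrow> real"
  assumes h: "0 < h" and T: "0 \<le> T"
    and step: "\<And>s t. 0 \<le> s \<Longrightarrow> s < t \<Longrightarrow> t \<le> T \<Longrightarrow> t - s \<le> h \<Longrightarrow> k * (t - s) \<le> G t - G s"
  shows "G 0 + k * T \<le> G T"
proof (cases "T = 0")
  case False
  with T have T0: "0 < T" by simp
  obtain n :: nat where n: "T / h < real n" using reals_Archimedean2 by blast
  have n0: "0 < real n" using n T0 h by (smt (verit) divide_pos_pos)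
  define d where "d = T / real n"
  have d: "0 < d" "d \<le> h" using n n0 T0 h by (auto simp: d_def field_simps)
  have "m \<le> n \<Longrightarrow> G 0 + k * (real m * d) \<le> G (real m * d)" for m
  proof (induction m)
    case (Suc m)
    have "real (Suc m) * d \<le> real n * d"
      using Suc.prems d by (intro mult_right_mono) auto
    also have "\<dots> = T" using n0 by (simp add: d_def)
    finally have "k * (real (Suc m) * d - real m * d) \<le> G (real (Suc m) * d) - G (real m * d)"
      using d by (intro step) (auto simp: algebra_simps)
    then show ?case using Suc by (simp add: algebra_simps)
  qed simp
  from this[of n] show ?thesis using n0 by (simp add: d_def)
qed simp

text \<open>The hypothesis gives E s >= (1 + z) E u with z = c (u - s). For z <= 1/2 one has ln (1 +
  z) >= z - z^2 >= z/2, so -ln E grows at least at rate c/2; this fixes both the step size 1/(2c)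
  and the halved rate.\<close>

lemma exponential_decay:
  fixes E :: "real \<Rightarrow> real"
  assumes c: "0 < c" and E0: "\<And>t. 0 \<le> t \<Longrightarrow> 0 \<le> E t"
    and D: "\<And>s t. 0 \<le> s \<Longrightarrow> s \<le> t \<Longrightarrow> c * (t - s) * E t \<le> E s - E t"
    and t: "0 \<le> t"
  shows "E t \<le> E 0 * exp (- (c/2) * t)"
proof (cases "E t = 0")
  case True
  then show ?thesis using E0[of 0] by simp
next
  case False
  with E0[OF t] have Et: "0 < E t" by simp
  \<comment> \<open>Monotonicity carries positivity backwards from time t, which makes the
    logarithms meaningful on all of [0, t].\<close>
  have pos: "0 < E s" if "0 \<le> s" "s \<le> t" for s
  proof -
    have "0 \<le> c * (t - s) * E t" using c that Et by (intro mult_nonneg_nonneg) auto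
    then show ?thesis using D[OF that] Et by linarith
  qed
  have "- ln (E 0) + c/2 * t \<le> - ln (E t)"
  proof (rule linear_growth_from_small_steps[where G = "\<lambda>s. - ln (E s)" and h = "1/(2*c)"])
    fix s u assume su: "0 \<le> s" "s < u" "u \<le> t" "u - s \<le> 1/(2*c)"
    let ?z = "c * (u - s)"
    have z: "0 \<le> ?z" "?z \<le> 1/2" using su c by (auto simp: field_simps)
    have "?z / 2 \<le> ?z - ?z\<^sup>2" using mult_left_mono[OF z(2,1)] by (simp add: power2_eq_square)
    also have "\<dots> \<le> ln (1 + ?z)" using z by (intro ln_one_plus_pos_lower_bound) auto
    also have "\<dots> \<le> ln (E s / E u)"
    proof -
      have "(1 + ?z) * E u \<le> E s" using D[of s u] su by (simp add: algebra_simps)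
      then have "1 + ?z \<le> E s / E u" using pos[of u] su by (simp add: pos_le_divide_eq)
      then show ?thesis using z by (subst ln_le_cancel_iff) auto
    qed
    also have "\<dots> = ln (E s) - ln (E u)" using pos[of u] pos[of s] su by (simp add: ln_div)
    finally show "c/2 * (u - s) \<le> - ln (E u) - - ln (E s)" by simp
  qed (use c t in auto)
  then have "ln (E t) \<le> ln (E 0 * exp (- (c/2) * t))"
    using pos[of 0] t by (simp add: ln_mult)
  then show ?thesis using Et pos[of 0] t by (subst (asm) ln_le_cancel_iff) auto
qed

text \<open>The linearly growing quantity is E^(1-a). The factor c/4 collects two halvings: ln (1 +
  z) >= z/2 and 1/(1 + y) <= 1 - y/2.\<close>

lemma algebraic_decay:
  fixes E :: "real \<Rightarrow> real"
  assumes c: "0 < c" and a: "1 < a" and E0: "\<And>t. 0 \<le> t \<Longrightarrow> 0 \<le> E t"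
    and D: "\<And>s t. 0 \<le> s \<Longrightarrow> s \<le> t \<Longrightarrow> c * (t - s) * E t powr a \<le> E s - E t"
    and t: "0 \<le> t"
  shows "E t \<le> (if E 0 = 0 then 0 else (E 0 powr (1 - a) + c/4 * (a - 1) * t) powr (- (1 / (a - 1))))"
proof (cases "E t = 0")
  case True
  then show ?thesis by simp
next
  case False
  with E0[OF t] have Et: "0 < E t" by simp
  have mono: "E u \<le> E s" if "0 \<le> s" "s \<le> u" for s u
  proof -
    have "0 \<le> c * (u - s) * E u powr a" using c that by (intro mult_nonneg_nonneg) auto
    then show ?thesis using D[OF that] by linarith
  qed
  have pos: "0 < E s" if "0 \<le> s" "s \<le> t" for s
    using mono[OF that] Et by simp
  have E00: "0 < E 0" using pos[of 0] t by simp
  \<comment> \<open>This step size forces z <= 1/(1 + a), which gives both z <= 1/2 and y <= 1, the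
    ranges of the two elementary inequalities.\<close>
  define h where "h = 1 / (c * E 0 powr (a - 1) * (1 + a))"
  have h0: "0 < h" using c a E00 by (simp add: h_def)
  have "E 0 powr (1 - a) + (c/4 * (a - 1)) * t \<le> E t powr (1 - a)"
  proof (rule linear_growth_from_small_steps[where G = "\<lambda>s. E s powr (1 - a)", OF h0 t])
    fix s u assume su: "0 \<le> s" "s < u" "u \<le> t" "u - s \<le> h"
    have Eu: "0 < E u" "0 < E s" using pos su by auto
    define z where "z = c * (u - s) * E u powr (a - 1)"
    have z0: "0 \<le> z" using c su by (simp add: z_def)
    have "z \<le> c * h * E 0 powr (a - 1)"
      unfolding z_def using c su a mono[of 0 u] Eu h0 by (intro mult_mono powr_mono2) auto
    also have "\<dots> = 1 / (1 + a)" using c a E00 by (simp add: h_def)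
    finally have z1: "z * (1 + a) \<le> 1" using a by (simp add: field_simps)
    have "2 * z \<le> z * (1 + a)" using mult_left_mono[of 2 "1 + a" z] z0 a by simp
    with z1 have z2: "z \<le> 1/2" by simp
    define y where "y = (a - 1) * (z / 2)"
    have y0: "0 \<le> y" using a z0 by (simp add: y_def)
    have "(a - 1) * z \<le> z * (1 + a)" using z0 by (simp add: algebra_simps)
    with z1 have y1: "y \<le> 1" by (simp add: y_def)
    have "z / 2 \<le> z - z\<^sup>2" using mult_left_mono[OF z2 z0] by (simp add: power2_eq_square)
    also have "\<dots> \<le> ln (1 + z)" using z0 z2 by (intro ln_one_plus_pos_lower_bound) auto
    finally have "y \<le> (a - 1) * ln (1 + z)" unfolding y_def using a by (intro mult_left_mono) auto
    then have "1 + y \<le> exp ((a - 1) * ln (1 + z))"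
      by (intro order_trans[OF _ exp_ge_add_one_self]) simp
    also have "\<dots> = (1 + z) powr (a - 1)" using z0 by (simp add: powr_def)
    finally have "inverse ((1 + z) powr (a - 1)) \<le> inverse (1 + y)"
      using y0 by (intro le_imp_inverse_le) auto
    moreover have "inverse (1 + y) \<le> 1 - y / 2"
    proof -
      have "y * y \<le> 1 * y" using y0 y1 by (intro mult_right_mono)
      then have "1 \<le> (1 - y / 2) * (1 + y)" by (simp add: algebra_simps)
      then show ?thesis using y0 by (simp add: field_simps)
    qed
    moreover have "(1 + z) powr (1 - a) = inverse ((1 + z) powr (a - 1))"
      using powr_minus[of "1 + z" "a - 1"] by simp
    ultimately have z3: "(1 + z) powr (1 - a) \<le> 1 - y / 2" by linarith
    have "E u * (1 + z) \<le> E s"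
    proof -
      have "E u * E u powr (a - 1) = E u powr a" using Eu powr_add[of "E u" 1 "a - 1"] by simp
      then have "E u * z = c * (u - s) * E u powr a" by (simp add: z_def mult_ac)
      then show ?thesis using D[of s u] su by (simp add: algebra_simps)
    qed
    then have "E s powr (1 - a) \<le> (E u * (1 + z)) powr (1 - a)"
      using Eu z0 a by (intro powr_mono2') auto
    also have "\<dots> = E u powr (1 - a) * (1 + z) powr (1 - a)" using Eu z0 by (simp add: powr_mult)
    also have "\<dots> \<le> E u powr (1 - a) * (1 - y / 2)" by (intro mult_left_mono z3) auto
    also have "\<dots> = E u powr (1 - a) - c/4 * (a - 1) * (u - s) * (E u powr (1 - a) * E u powr (a - 1))"
      by (simp add: y_def z_def algebra_simps)
    also have "E u powr (1 - a) * E u powr (a - 1) = 1" using Eu by (simp add: powr_add[symmetric])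
    finally show "c/4 * (a - 1) * (u - s) \<le> E u powr (1 - a) - E s powr (1 - a)" by simp
  qed
  moreover have "0 < E 0 powr (1 - a) + (c/4 * (a - 1)) * t"
    using E00 c a t by (intro add_pos_nonneg) auto
  ultimately have "(E t powr (1 - a)) powr (- (1 / (a - 1))) \<le> (E 0 powr (1 - a) + c/4 * (a - 1) * t) powr (- (1 / (a - 1)))"
    using a by (intro powr_mono2') auto
  moreover have "(1 - a) * (- (1 / (a - 1))) = 1" using a by (simp add: field_simps)
  ultimately show ?thesis using Et E00 by (simp add: powr_powr)
qed

section \<open>Integration by parts\<close>

text \<open>The average of the derivative along a closed coordinate line is an increment over one
  period.\<close>

lemma torus_integral_partial:
  assumes g: "periodic g" "\<And>x. partial_exists i g x" "continuous_on UNIV (partial i g)"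
  shows "(LINT x|torus. partial i g x) = 0"
proof -
  have c: "cper (partial i g)"
    using g partial_periodic[of g i] by (simp add: cper_def)
  have "avg (axis i 1) (partial i g) x = 0" for x
  proof -
    have "((\<lambda>t. partial i g (x + t *\<^sub>R axis i 1)) has_integral
        (g (x + 1 *\<^sub>R axis i 1) - g (x + 0 *\<^sub>R axis i 1))) {0..1}"
      by (intro fundamental_theorem_of_calculus)
        (auto simp: has_real_derivative_iff_has_vector_derivative[symmetric]
          intro!: has_field_derivative_at_within partial_line[OF g(2)])
    then show ?thesis
      using g(1) by (simp add: avg_def integral_unique periodic_def)
  qed
  then show ?thesis using torus_avg[OF c, of "axis i 1"] by simp
qed

lemma integral_shift_support:
  fixes h :: "'a::euclidean_space \<Rightarrow> real"
  assumes h: "continuous_on UNIV h" "\<And>v. v \<notin> S \<Longrightarrow> h v = 0"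
    and S: "S \<subseteq> cbox (a + c) (b + c)" "S \<subseteq> cbox a b"
  shows "integral (cbox a b) (\<lambda>v. h (v + c)) = integral (cbox a b) h"
proof -
  have int: "h integrable_on cbox k l" for k l
    by (intro integrable_continuous continuous_on_subset[OF h(1)]) auto
  have all: "(h has_integral integral (cbox k l) h) UNIV" if "S \<subseteq> cbox k l" for k l
    using that h(2) by (intro has_integral_on_superset[OF integrable_integral[OF int]]) auto
  have "((\<lambda>v. h (v + c)) has_integral integral (cbox (a + c) (b + c)) h) (cbox a b)"
    using integrable_integral[OF int, of "a + c" "b + c"] has_integral_shift_cbox_iff[of h c _ a b]
    by (simp add: o_def add.commute)
  then show ?thesis
    using has_integral_unique[OF all[OF S(1)] all[OF S(2)]] by (simp add: integral_unique)
qed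

text \<open>The integral is unchanged by translation along e_i. Averaging over translations s in
  [0, 1] and exchanging the integrals turns the derivative into the increment K(v + e_i) - K(v),
  whose two parts have equal integrals.\<close>

lemma integral_partial_compact_support:
  assumes K: "continuous_on UNIV K" "\<And>v. partial_exists i K v" "continuous_on UNIV (partial i K)"
    and supp: "\<And>v. v \<notin> cbox a b \<Longrightarrow> K v = 0"
  shows "integral (cbox a b) (partial i K) = 0"
proof (cases "cbox a b = {}")
  case False
  then have ab: "a $ j \<le> b $ j" for j by (simp add: interval_ne_empty_cart)
  let ?e = "axis i 1 :: real^3"
  have dK: "partial i K v = 0" if v: "v \<notin> cbox a b" for v
  proof (rule partial_eqI(2))
    have "open ((\<lambda>h::real. v + h *\<^sub>R ?e) -` (- cbox a b))"
      by (intro continuous_open_vimage) (auto intro!: continuous_intros simp: open_Compl)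
    then show "((\<lambda>h. K (v + h *\<^sub>R ?e)) has_real_derivative 0) (at 0)"
      using v supp by (intro has_field_derivative_transform_within_open[OF DERIV_const[of 0]]) auto
  qed
  \<comment> \<open>One unit of room on every side, so that the support stays inside the box and its
    translates by up to one unit.\<close>
  let ?A = "a - 1" and ?B = "b + 1"
  have sub: "cbox a b \<subseteq> cbox ?A ?B" "cbox a b \<subseteq> cbox (?A + s *\<^sub>R ?e) (?B + s *\<^sub>R ?e)"
    if "0 \<le> s" "s \<le> 1" for s
    using that by (auto simp: mem_box_cart axis_def intro: order_trans add_mono) (smt (verit))+
  have "integral (cbox a b) (partial i K) = integral (cbox ?A ?B) (partial i K)"
    using sub(1)[of 0] dK
    by (intro integral_unique[symmetric] has_integral_on_superset[OF integrable_integral] integrable_continuous continuous_on_subset[OF K(3)]) auto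
  also have "\<dots> = integral (cbox 0 1) (\<lambda>s::real. integral (cbox ?A ?B) (partial i K))"
    by simp
  also have "\<dots> = integral (cbox 0 1) (\<lambda>s::real. integral (cbox ?A ?B) (\<lambda>v. partial i K (v + s *\<^sub>R ?e)))"
    using sub by (intro integral_cong integral_shift_support[OF K(3) dK, symmetric]) auto
  also have "\<dots> = integral (cbox ?A ?B) (\<lambda>v. integral (cbox 0 1) (\<lambda>s::real. partial i K (v + s *\<^sub>R ?e)))"
    by (rule integral_swap_continuous)
      (auto simp: split_beta intro!: continuous_on_compose2[OF K(3)] continuous_intros)
  also have "\<dots> = integral (cbox ?A ?B) (\<lambda>v. K (v + 1 *\<^sub>R ?e) - K v)"
  proof (rule integral_cong)
    fix v
    have "((\<lambda>t. partial i K (v + t *\<^sub>R ?e)) has_integral (K (v + 1 *\<^sub>R ?e) - K (v + 0 *\<^sub>R ?e))) {0..1}"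
      by (intro fundamental_theorem_of_calculus)
        (auto simp: has_real_derivative_iff_has_vector_derivative[symmetric]
          intro!: has_field_derivative_at_within partial_line[OF K(2)])
    then show "integral (cbox 0 1) (\<lambda>s::real. partial i K (v + s *\<^sub>R ?e)) = K (v + 1 *\<^sub>R ?e) - K v"
      by (simp add: integral_unique)
  qed
  also have "\<dots> = integral (cbox ?A ?B) (\<lambda>v. K (v + 1 *\<^sub>R ?e)) - integral (cbox ?A ?B) K"
    by (intro integral_diff integrable_continuous continuous_on_compose2[OF K(1)] continuous_on_subset[OF K(1)])
      (auto intro!: continuous_intros)
  also have "integral (cbox ?A ?B) (\<lambda>v. K (v + 1 *\<^sub>R ?e)) = integral (cbox ?A ?B) K"
    using sub[of 1] by (intro integral_shift_support[OF K(1) supp]) auto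
  finally show ?thesis by simp
qed simp

section \<open>Velocity cutoff\<close>

text \<open>Squaring the truncated parabola makes it continuously differentiable across |v| = R,
  while the support stays in the ball of radius R.\<close>

definition cutoff :: "real \<Rightarrow> real^3 \<Rightarrow> real" where
  "cutoff R v = (max 0 (1 - (v \<bullet> v) / R\<^sup>2))\<^sup>2"

definition cutoff_deriv :: "real \<Rightarrow> 3 \<Rightarrow> real^3 \<Rightarrow> real" where
  "cutoff_deriv R i v = 2 * max 0 (1 - (v \<bullet> v) / R\<^sup>2) * (- (2 * v $ i / R\<^sup>2))"

lemma DERIV_max0_sq: "((\<lambda>z. (max 0 z)\<^sup>2) has_real_derivative 2 * max 0 z) (at (z::real))"
proof -
  consider "z > 0" | "z < 0" | "z = 0" by linarith
  then show ?thesis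
  proof cases
    case 1
    have "((\<lambda>z. z\<^sup>2) has_real_derivative 2 * z) (at z)"
      by (auto intro!: derivative_eq_intros)
    then have "((\<lambda>z. (max 0 z)\<^sup>2) has_real_derivative 2 * z) (at z)"
      by (rule has_field_derivative_transform_within_open[where S = "{0<..}"]) (use 1 in auto)
    then show ?thesis using 1 by simp
  next
    case 2
    have "((\<lambda>z. (max 0 z)\<^sup>2) has_real_derivative 0) (at z)"
      by (rule has_field_derivative_transform_within_open[OF DERIV_const, where S = "{..<0}"]) (use 2 in auto)
    then show ?thesis using 2 by simp
  next
    case 3
    have "norm (((max 0 (0 + h))\<^sup>2 - (max 0 0)\<^sup>2) / h) \<le> \<bar>h\<bar>" for h :: real
      by (cases "h = 0") (auto simp: power2_eq_square max_def abs_mult)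
    then have "\<forall>\<^sub>F h in at 0. norm (((max 0 (0 + h))\<^sup>2 - (max 0 0)\<^sup>2) / h) \<le> \<bar>h :: real\<bar>"
      by (intro always_eventually allI)
    moreover have "((\<lambda>h::real. \<bar>h\<bar>) \<longlongrightarrow> 0) (at 0)"
      by (rule tendsto_rabs_zero) simp
    ultimately have "((\<lambda>h::real. ((max 0 (0 + h))\<^sup>2 - (max 0 0)\<^sup>2) / h) \<longlongrightarrow> 0) (at 0)"
      using Lim_null_comparison[of "\<lambda>h::real. ((max 0 (0 + h))\<^sup>2 - (max 0 0)\<^sup>2) / h" "\<lambda>h. \<bar>h\<bar>" "at 0"]
      by blast
    then show ?thesis using 3 by (simp add: DERIV_def)
  qed
qed

lemma DERIV_cutoff:
  "((\<lambda>h. cutoff R (v + h *\<^sub>R axis i 1)) has_real_derivative cutoff_deriv R i v) (at 0)"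
proof -
  have eq: "(v + h *\<^sub>R axis i 1) \<bullet> (v + h *\<^sub>R axis i 1) = v \<bullet> v + 2 * h * v $ i + h\<^sup>2" for h :: real
    by (simp add: inner_add_left inner_add_right inner_axis inner_axis' power2_eq_square algebra_simps)
  have "((\<lambda>h. 1 - (1 / R\<^sup>2) * (v \<bullet> v + 2 * h * v $ i + h\<^sup>2)) has_real_derivative 0 - (1 / R\<^sup>2) * (0 + 2 * v $ i + 0)) (at 0)"
    by (intro DERIV_diff DERIV_cmult DERIV_add DERIV_const) (auto intro!: derivative_eq_intros)
  then have "((\<lambda>h. 1 - (v \<bullet> v + 2 * h * v $ i + h\<^sup>2) / R\<^sup>2) has_real_derivative - (2 * v $ i / R\<^sup>2)) (at 0)"
    by simp
  from DERIV_chain2[OF DERIV_max0_sq this] show ?thesis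
    unfolding cutoff_def cutoff_deriv_def eq by simp
qed

lemma cutoff_bounds: "0 \<le> cutoff R v" "cutoff R v \<le> 1"
  unfolding cutoff_def by (auto intro!: power_le_one)

lemma cutoff_outside:
  assumes "0 < R" "R\<^sup>2 \<le> v \<bullet> v"
  shows "cutoff R v = 0" "cutoff_deriv R i v = 0"
proof -
  have "max 0 (1 - (v \<bullet> v) / R\<^sup>2) = 0" using assms by (auto simp: field_simps)
  then show "cutoff R v = 0" "cutoff_deriv R i v = 0"
    by (simp_all add: cutoff_def cutoff_deriv_def)
qed

text \<open>The gradient is of order |v|/R^2 on |v| < R, so its product with v is bounded
  independently of R. This uniformity is what dominated convergence needs as R grows.\<close>

lemma cutoff_deriv_bound:
  assumes R: "0 < R"
  shows "\<bar>v $ k * cutoff_deriv R i v\<bar> \<le> 4"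
proof (cases "R\<^sup>2 \<le> v \<bullet> v")
  case True
  then show ?thesis by (simp add: cutoff_outside[OF R])
next
  case False
  have m: "0 \<le> max 0 (1 - (v \<bullet> v) / R\<^sup>2)" "max 0 (1 - (v \<bullet> v) / R\<^sup>2) \<le> 1" by auto
  have "\<bar>v $ k\<bar> * \<bar>v $ i\<bar> \<le> norm v * norm v"
    by (intro mult_mono component_le_norm_cart) auto
  also have "\<dots> = v \<bullet> v" by (simp add: power2_norm_eq_inner[symmetric] power2_eq_square)
  finally have "\<bar>v $ k\<bar> * \<bar>v $ i\<bar> / R\<^sup>2 \<le> 1" using False R by (simp add: field_simps)
  then have "max 0 (1 - (v \<bullet> v) / R\<^sup>2) * (\<bar>v $ k\<bar> * \<bar>v $ i\<bar> / R\<^sup>2) \<le> 1 * 1"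
    using m by (intro mult_mono) auto
  moreover have "\<bar>v $ k * cutoff_deriv R i v\<bar> = 4 * (max 0 (1 - (v \<bullet> v) / R\<^sup>2) * (\<bar>v $ k\<bar> * \<bar>v $ i\<bar> / R\<^sup>2))"
    using m(1) by (simp only: cutoff_deriv_def abs_mult abs_minus_cancel abs_divide) simp
  ultimately show ?thesis by simp
qed

text \<open>The compactly supported replacement of the velocity component v_k, the weight that
  yields momentum.\<close>

definition test_fun :: "real \<Rightarrow> 3 \<Rightarrow> real^3 \<Rightarrow> real" where
  "test_fun R k v = v $ k * cutoff R v"

definition test_fun_deriv :: "real \<Rightarrow> 3 \<Rightarrow> 3 \<Rightarrow> real^3 \<Rightarrow> real" where
  "test_fun_deriv R k i v = (if i = k then cutoff R v else 0) + v $ k * cutoff_deriv R i v"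

lemma DERIV_test_fun:
  "((\<lambda>h. test_fun R k (v + h *\<^sub>R axis i 1)) has_real_derivative test_fun_deriv R k i v) (at 0)"
proof -
  have "((\<lambda>h. (v + h *\<^sub>R axis i 1) $ k) has_real_derivative (if i = k then 1 else 0)) (at 0)"
    by (auto simp: axis_def intro!: derivative_eq_intros)
  from DERIV_mult[OF this DERIV_cutoff[of R v i]] show ?thesis
    unfolding test_fun_def test_fun_deriv_def by (auto simp: algebra_simps)
qed

lemma test_fun_bounds:
  assumes "0 < R"
  shows "\<bar>test_fun R k v\<bar> \<le> norm v" "\<bar>test_fun_deriv R k i v\<bar> \<le> 5"
proof -
  have "\<bar>v $ k\<bar> * cutoff R v \<le> norm v * 1"
    using cutoff_bounds by (intro mult_mono component_le_norm_cart) auto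
  then show "\<bar>test_fun R k v\<bar> \<le> norm v" using cutoff_bounds[of R v] by (simp add: test_fun_def abs_mult)
  show "\<bar>test_fun_deriv R k i v\<bar> \<le> 5"
    using cutoff_deriv_bound[OF assms, of v k i] cutoff_bounds[of R v] unfolding test_fun_deriv_def by auto
qed

lemma test_fun_continuous:
  assumes "0 < R"
  shows "continuous_on S (test_fun R k)" "continuous_on S (test_fun_deriv R k i)"
  using assms unfolding test_fun_def test_fun_deriv_def cutoff_def cutoff_deriv_def
  by (cases "i = k"; auto intro!: continuous_intros)+

lemma test_fun_outside:
  assumes "0 < R" "v \<notin> cbox (- (R *\<^sub>R 1)) (R *\<^sub>R 1)"
  shows "test_fun R k v = 0" "test_fun_deriv R k i v = 0"
proof -
  obtain j where "\<not> (- R \<le> v $ j \<and> v $ j \<le> R)" using assms(2) by (auto simp: mem_box_cart)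
  then have "R \<le> norm v" using component_le_norm_cart[of v j] by linarith
  then have "R\<^sup>2 \<le> v \<bullet> v" using assms(1) unfolding power2_norm_eq_inner[symmetric] by (intro power_mono) auto
  then show "test_fun R k v = 0" "test_fun_deriv R k i v = 0"
    by (simp_all add: test_fun_def test_fun_deriv_def cutoff_outside[OF assms(1)])
qed

lemma test_fun_limit:
  shows "(\<lambda>n. test_fun (real (Suc n)) k v) \<longlonglongrightarrow> v $ k"
    and "(\<lambda>n. test_fun_deriv (real (Suc n)) k i v) \<longlonglongrightarrow> (if i = k then 1 else 0)"
proof -
  have z: "(\<lambda>n. 1 / (real (Suc n))\<^sup>2) \<longlonglongrightarrow> 0"
    by real_asymp
  have "(\<lambda>n. 1 - (v \<bullet> v) * (1 / (real (Suc n))\<^sup>2)) \<longlonglongrightarrow> 1 - (v \<bullet> v) * 0"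
    by (intro tendsto_intros z)
  then have m: "(\<lambda>n. max 0 (1 - (v \<bullet> v) / (real (Suc n))\<^sup>2)) \<longlonglongrightarrow> max 0 1"
    by (intro tendsto_max tendsto_const) simp
  then have c: "(\<lambda>n. cutoff (real (Suc n)) v) \<longlonglongrightarrow> 1"
    unfolding cutoff_def using tendsto_power[OF m, of 2] by simp
  then show "(\<lambda>n. test_fun (real (Suc n)) k v) \<longlonglongrightarrow> v $ k"
    unfolding test_fun_def using tendsto_mult[OF tendsto_const c, of "v $ k"] by simp
  have "(\<lambda>n. 2 * max 0 (1 - (v \<bullet> v) / (real (Suc n))\<^sup>2) * (- (2 * v $ i * (1 / (real (Suc n))\<^sup>2))))
      \<longlonglongrightarrow> 2 * max 0 1 * (- (2 * v $ i * 0))"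
    by (intro tendsto_intros m z)
  then have d: "(\<lambda>n. cutoff_deriv (real (Suc n)) i v) \<longlonglongrightarrow> 0"
    unfolding cutoff_deriv_def by simp
  have "(\<lambda>n. (if i = k then cutoff (real (Suc n)) v else 0) + v $ k * cutoff_deriv (real (Suc n)) i v)
      \<longlonglongrightarrow> (if i = k then 1 else 0) + v $ k * 0"
    by (intro tendsto_add tendsto_mult tendsto_const d) (use c in auto)
  then show "(\<lambda>n. test_fun_deriv (real (Suc n)) k i v) \<longlonglongrightarrow> (if i = k then 1 else 0)"
    unfolding test_fun_deriv_def by simp
qed

section \<open>Phase space integrals\<close>

lemma finite_measure_torus: "finite_measure torus"
proof
  show "emeasure torus (space torus) \<noteq> \<infinity>"
    using emeasure_lborel_cbox_finite[of "0::real^3" 1]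
    by (simp add: torus_def emeasure_restrict_space space_restrict_space)
qed

interpretation torus_lborel: pair_sigma_finite torus "lborel :: (real^3) measure"
proof -
  interpret finite_measure torus by (rule finite_measure_torus)
  show "pair_sigma_finite torus (lborel :: (real^3) measure)" ..
qed

lemma phase_measurable:
  fixes H :: "(real^3) \<times> (real^3) \<Rightarrow> 'b::topological_space"
  assumes "continuous_on UNIV H"
  shows "H \<in> borel_measurable phase"
proof -
  have "(\<lambda>x. x) \<in> torus \<rightarrow>\<^sub>M borel"
    unfolding torus_def by (intro measurable_restrict_space1) simp
  then have "(\<lambda>z. (fst z, snd z)) \<in> phase \<rightarrow>\<^sub>M borel \<Otimes>\<^sub>M borel"
    unfolding phase_def by (intro measurable_Pair measurable_compose[OF measurable_fst] measurable_compose[OF measurable_snd]) auto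
  then have "(\<lambda>z. z) \<in> phase \<rightarrow>\<^sub>M borel" by (simp add: borel_prod)
  from measurable_compose[OF this borel_measurable_continuous_onI[OF assms]] show ?thesis .
qed

lemma space_phase: "space phase = cbox 0 1 \<times> UNIV"
  by (simp add: phase_def space_pair_measure torus_def space_restrict_space)

text \<open>Passes from Lebesgue integration on phase space to a box, where exchanging integrals
  only needs continuity.\<close>

lemma phase_integral_compact_support:
  fixes H :: "(real^3) \<times> (real^3) \<Rightarrow> real"
  assumes H: "continuous_on UNIV H" and int: "integrable phase H"
    and supp: "\<And>x v. v \<notin> cbox a b \<Longrightarrow> H (x, v) = 0"
  shows "(LINT z|phase. H z) = integral (cbox (0, a) (1, b)) H"
proof -
  have cont: "continuous_on S (\<lambda>v. H (x, v))" for x S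
    by (rule continuous_on_compose2[OF H]) (auto intro!: continuous_intros)
  have in1: "(LINT v|lborel. H (x, v)) = integral (cbox a b) (\<lambda>v. H (x, v))" for x
  proof -
    have eq: "(\<lambda>v. indicator (cbox a b) v *\<^sub>R H (x, v)) = (\<lambda>v. H (x, v))"
      using supp[of _ x] by (intro ext) (auto simp: indicator_def)
    have "(LINT v|restrict_space lborel (cbox a b). H (x, v)) = (LINT v|lborel. indicator (cbox a b) v *\<^sub>R H (x, v))"
      by (rule integral_restrict_space) simp
    then have "(LINT v|lborel. H (x, v)) = (LINT v|restrict_space lborel (cbox a b). H (x, v))"
      by (simp only: eq)
    then show ?thesis by (simp add: cube_continuous_integral(2)[OF cont])
  qed
  have "(LINT z|phase. H z) = (LINT x|torus. LINT v|lborel. H (x, v))"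
    using torus_lborel.integral_fst'[of H] int by (simp add: phase_def)
  also have "\<dots> = (LINT x|torus. integral (cbox a b) (\<lambda>v. H (x, v)))"
    by (simp add: in1)
  also have "\<dots> = integral (cbox 0 1) (\<lambda>x. integral (cbox a b) (\<lambda>v. H (x, v)))"
    by (intro torus_integral integral_continuous_on_param)
      (simp add: split_beta continuous_on_subset[OF H])
  also have "\<dots> = integral (cbox (0, a) (1, b)) H"
    by (intro integral_prod_continuous[symmetric] continuous_on_subset[OF H]) auto
  finally show ?thesis .
qed

section \<open>Conservation of momentum\<close>

lemma joint_continuous3:
  assumes "continuous_on ({0..} \<times> UNIV \<times> UNIV) (\<lambda>(t::real, x, v). F t x v)"
    and "continuous_on S a" "continuous_on S b" "continuous_on S c" "\<And>z. z \<in> S \<Longrightarrow> 0 \<le> a z"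
  shows "continuous_on S (\<lambda>z. F (a z) (b z) (c z))"
proof -
  have "continuous_on S (\<lambda>z. (\<lambda>(t, x, v). F t x v) (a z, b z, c z))"
    using assms(2-) by (intro continuous_on_compose2[OF assms(1)] continuous_on_Pair) auto
  then show ?thesis by simp
qed

lemma joint_continuous2:
  assumes "continuous_on ({0..} \<times> UNIV) (\<lambda>(t::real, x). F t x)"
    and "continuous_on S a" "continuous_on S b" "\<And>z. z \<in> S \<Longrightarrow> 0 \<le> a z"
  shows "continuous_on S (\<lambda>z. F (a z) (b z))"
proof -
  have "continuous_on S (\<lambda>z. (\<lambda>(t, x). F t x) (a z, b z))"
    using assms(2-) by (intro continuous_on_compose2[OF assms(1)] continuous_on_Pair) auto
  then show ?thesis by simp
qed

lemma dt_has_integral: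
  fixes g :: "real \<Rightarrow> 'a::banach"
  assumes "\<And>t. 0 \<le> t \<Longrightarrow> dt_exists g t" "0 \<le> t"
  shows "(dt g has_integral (g t - g 0)) {0..t}"
proof (rule fundamental_theorem_of_calculus[OF assms(2)])
  fix s assume "s \<in> {0..t}"
  then have "(g has_vector_derivative dt g s) (at s within {0..})"
    using assms(1) unfolding dt_exists_def dt_def by (simp add: vector_derivative_works)
  then show "(g has_vector_derivative dt g s) (at s within {0..t})"
    by (rule has_vector_derivative_within_subset) auto
qed

locale regular_solution =
  fixes \<mu> p :: real and f :: "real \<Rightarrow> real^3 \<Rightarrow> real^3 \<Rightarrow> real" and u :: "real \<Rightarrow> real^3 \<Rightarrow> real^3"
    and \<pi> :: "real \<Rightarrow> real^3 \<Rightarrow> real"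
  assumes solution: "sufficiently_regular_solution \<mu> p f u \<pi>"
begin

lemma solution_facts:
  shows f_nonneg: "0 \<le> t \<Longrightarrow> 0 \<le> f t x v"
    and f_periodic: "0 \<le> t \<Longrightarrow> periodic (\<lambda>x. f t x v)"
    and u_periodic: "0 \<le> t \<Longrightarrow> periodic (u t)"
    and \<pi>_periodic: "0 \<le> t \<Longrightarrow> periodic (\<pi> t)"
    and kin_reg: "kinetic_regular f u" and fl_reg: "fluid_regular \<mu> p f u \<pi>"
    and kin_eq: "kinetic_eq f u" and fl_eq: "fluid_eq \<mu> p f u \<pi>"
    and mass: "unit_mass f" and second_moment: "finite_second_moment f"
    and balance: "energy_balance \<mu> p f u"
  using solution unfolding sufficiently_regular_solution_def classical_solution_def by blast+

lemmas cont_f = kin_reg[unfolded kinetic_regular_def, THEN conjunct1]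
lemmas cont_dtf = kin_reg[unfolded kinetic_regular_def, THEN conjunct2, THEN conjunct2, THEN conjunct1]
lemmas cont_u = fl_reg[unfolded fluid_regular_def, THEN conjunct1]

lemma dtf_exists: "0 \<le> t \<Longrightarrow> dt_exists (\<lambda>s. f s x v) t"
  using kin_reg unfolding kinetic_regular_def by blast

lemma f_partial:
  shows "0 \<le> t \<Longrightarrow> partial_exists i (\<lambda>y. f t y v) x"
    and "continuous_on ({0..} \<times> UNIV \<times> UNIV) (\<lambda>(t, x, v). partial i (\<lambda>y. f t y v) x)"
  using kin_reg unfolding kinetic_regular_def by blast+

lemma flux_partial:
  shows "0 \<le> t \<Longrightarrow> partial_exists i (\<lambda>w. (f t x w *\<^sub>R (u t x - w)) $ i) v"
    and "continuous_on ({0..} \<times> UNIV \<times> UNIV) (\<lambda>(t, x, v). partial i (\<lambda>w. (f t x w *\<^sub>R (u t x - w)) $ i) v)"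
  using kin_reg unfolding kinetic_regular_def by blast+

lemma f_continuous:
  "0 \<le> t \<Longrightarrow> continuous_on S a \<Longrightarrow> continuous_on S b \<Longrightarrow> continuous_on S (\<lambda>z. f t (a z) (b z))"
  by (rule joint_continuous3[OF cont_f continuous_on_const])

lemma u_continuous:
  "0 \<le> t \<Longrightarrow> continuous_on S a \<Longrightarrow> continuous_on S (\<lambda>z. u t (a z))"
  by (rule joint_continuous2[OF cont_u continuous_on_const])

lemma u_bounded:
  assumes "0 \<le> t"
  obtains B where "0 \<le> B" "\<And>x. x \<in> cbox 0 1 \<Longrightarrow> norm (u t x) \<le> B"
proof -
  have "bounded (u t ` cbox 0 1)"
    by (intro compact_imp_bounded compact_continuous_image u_continuous[OF assms] continuous_on_id compact_cbox)
  then obtain B where B: "\<And>x. x \<in> cbox 0 1 \<Longrightarrow> norm (u t x) \<le> B"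
    by (auto simp: bounded_iff)
  show ?thesis by (rule that[of "max 0 B"]) (use B in \<open>auto intro: max.coboundedI2\<close>)
qed

lemma f_integrable: "0 \<le> t \<Longrightarrow> integrable phase (\<lambda>z. f t (fst z) (snd z))"
  and f_integral: "0 \<le> t \<Longrightarrow> (LINT z|phase. f t (fst z) (snd z)) = 1"
  using mass by (auto simp: unit_mass_def case_prod_unfold)

lemma f2_integrable: "0 \<le> t \<Longrightarrow> integrable phase (\<lambda>z. (norm (snd z))\<^sup>2 * f t (fst z) (snd z))"
  using second_moment by (auto simp: finite_second_moment_def case_prod_unfold)

lemma f_fst_snd_continuous: "0 \<le> t \<Longrightarrow> continuous_on S (\<lambda>z. f t (fst z) (snd z))"
  by (intro f_continuous continuous_intros)

lemma u_fst_continuous: "0 \<le> t \<Longrightarrow> continuous_on S (\<lambda>z. u t (fst z))"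
  by (intro u_continuous continuous_intros)

text \<open>Mass and second moment make every continuous weight of quadratic growth in v integrable
  against f at a fixed time; bounds in x are needed on the unit cube only.\<close>

lemma phase_weight_integrable:
  fixes H :: "(real^3) \<times> (real^3) \<Rightarrow> 'b::euclidean_space"
  assumes t: "0 \<le> t" and H: "continuous_on UNIV H"
    and b: "\<And>x v. x \<in> cbox 0 1 \<Longrightarrow> norm (H (x, v)) \<le> c * (1 + (norm v)\<^sup>2)"
  shows "integrable phase (\<lambda>z. f t (fst z) (snd z) *\<^sub>R H z)"
proof (rule Bochner_Integration.integrable_bound)
  show "integrable phase (\<lambda>z. c * (f t (fst z) (snd z) + (norm (snd z))\<^sup>2 * f t (fst z) (snd z)))"
    using f_integrable[OF t] f2_integrable[OF t] by simp
  show "(\<lambda>z. f t (fst z) (snd z) *\<^sub>R H z) \<in> borel_measurable phase"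
    by (intro phase_measurable continuous_intros H f_fst_snd_continuous t)
  show "AE z in phase. norm (f t (fst z) (snd z) *\<^sub>R H z)
      \<le> norm (c * (f t (fst z) (snd z) + (norm (snd z))\<^sup>2 * f t (fst z) (snd z)))"
  proof (rule AE_I2)
    fix z assume "z \<in> space phase"
    then have "norm (H z) \<le> c * (1 + (norm (snd z))\<^sup>2)"
      using b[of "fst z" "snd z"] by (cases z) (auto simp: space_phase)
    then have "f t (fst z) (snd z) * norm (H z) \<le> f t (fst z) (snd z) * (c * (1 + (norm (snd z))\<^sup>2))"
      by (intro mult_left_mono f_nonneg t)
    also have "\<dots> \<le> \<bar>c * (f t (fst z) (snd z) + (norm (snd z))\<^sup>2 * f t (fst z) (snd z))\<bar>"
      by (rule order_trans[OF _ abs_ge_self]) (simp add: algebra_simps)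
    finally show "norm (f t (fst z) (snd z) *\<^sub>R H z)
      \<le> norm (c * (f t (fst z) (snd z) + (norm (snd z))\<^sup>2 * f t (fst z) (snd z)))"
      using f_nonneg[OF t] by simp
  qed
qed

lemma weight_ineq: "(a::real) \<le> 1 + a\<^sup>2"
proof (cases "a \<le> 1")
  case True
  then show ?thesis by (simp add: add_increasing2)
next
  case False
  then have "a * 1 \<le> a * a" by (intro mult_left_mono) auto
  then show ?thesis by (simp add: power2_eq_square)
qed

text \<open>The kinetic equation tested with \<open>test_fun R k\<close>: the transport term drops out after
  integration over the torus, the friction term is integrated by parts in \<open>v\<close>.\<close>

definition tested_flux :: "real \<Rightarrow> 3 \<Rightarrow> real \<Rightarrow> (real^3) \<times> (real^3) \<Rightarrow> real" where
  "tested_flux R k s z = f s (fst z) (snd z) * (\<Sum>i\<in>UNIV. (u s (fst z) - snd z) $ i * test_fun_deriv R k i (snd z))"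

lemma tested_kinetic_eq:
  assumes s: "0 \<le> s" and R: "0 < R"
  defines "b \<equiv> R *\<^sub>R (1 :: real^3)"
  shows "integral (cbox (0, - b) (1, b)) (\<lambda>z. dt (\<lambda>t. f t (fst z) (snd z)) s * test_fun R k (snd z))
    = integral (cbox (0, - b) (1, b)) (tested_flux R k s)"
proof -
  let ?\<psi> = "test_fun R k"
  let ?V = "cbox (- b) b"
  let ?G = "\<lambda>x i w. (f s x w *\<^sub>R (u s x - w)) $ i"
  have cV: "continuous_on S (\<lambda>v. ?\<psi> (h v))" if "continuous_on S h" for S and h :: "'z::topological_space \<Rightarrow> _"
    using continuous_on_compose2[OF test_fun_continuous(1)[OF R, of UNIV k] that] by auto
  have cV': "continuous_on S (\<lambda>v. test_fun_deriv R k i (h v))" if "continuous_on S h" for S i and h :: "'z::topological_space \<Rightarrow> _"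
    using continuous_on_compose2[OF test_fun_continuous(2)[OF R, of UNIV k i] that] by auto
  have cdt: "continuous_on S (\<lambda>z. dt (\<lambda>t. f t (a z) (c z)) s)" if "continuous_on S a" "continuous_on S c"
    for S and a c :: "'z::topological_space \<Rightarrow> _"
    using joint_continuous3[OF cont_dtf continuous_on_const that] s by auto
  have cfx: "continuous_on S (\<lambda>z. partial i (\<lambda>y. f s y (c z)) (a z))" if "continuous_on S a" "continuous_on S c"
    for S i and a c :: "'z::topological_space \<Rightarrow> _"
    using joint_continuous3[OF f_partial(2) continuous_on_const that] s by auto
  have cG: "continuous_on S (\<lambda>z. ?G (a z) i (c z))" if "continuous_on S a" "continuous_on S c"
    for S i and a c :: "'z::topological_space \<Rightarrow> _"
    using that s by (auto intro!: continuous_intros f_continuous u_continuous)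
  have cGv: "continuous_on S (\<lambda>z. partial i (?G (a z) i) (c z))" if "continuous_on S a" "continuous_on S c"
    for S i and a c :: "'z::topological_space \<Rightarrow> _"
    using joint_continuous3[OF flux_partial(2) continuous_on_const that] s by auto
  have pde: "dt (\<lambda>t. f t x v) s = - (\<Sum>i\<in>UNIV. v $ i * partial i (\<lambda>y. f s y v) x) - (\<Sum>i\<in>UNIV. partial i (?G x i) v)" for x v
  proof -
    have "dt (\<lambda>t. f t x v) s + v \<bullet> grad (\<lambda>y. f s y v) x + dvg (\<lambda>w. f s x w *\<^sub>R (u s x - w)) v = 0"
      using kin_eq s unfolding kinetic_eq_def by blast
    moreover have "v \<bullet> grad (\<lambda>y. f s y v) x = (\<Sum>i\<in>UNIV. v $ i * partial i (\<lambda>y. f s y v) x)"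
      by (simp add: inner_vec_def grad_def)
    ultimately show ?thesis unfolding dvg_def by linarith
  qed
  let ?T = "\<lambda>z. \<Sum>i\<in>UNIV. snd z $ i * partial i (\<lambda>y. f s y (snd z)) (fst z) * ?\<psi> (snd z)"
  let ?F = "\<lambda>z. \<Sum>i\<in>UNIV. partial i (?G (fst z) i) (snd z) * ?\<psi> (snd z) + ?G (fst z) i (snd z) * test_fun_deriv R k i (snd z)"
  have cT: "continuous_on S ?T" for S
    by (intro continuous_intros cfx cV)
  have cF: "continuous_on S ?F" for S
    by (intro continuous_on_sum continuous_on_add continuous_on_mult cGv cG cV cV' continuous_on_fst continuous_on_snd continuous_on_id)
  have cTF: "continuous_on S (tested_flux R k s)" for S
    unfolding tested_flux_def
    by (intro continuous_intros f_fst_snd_continuous u_fst_continuous s cV')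
  \<comment> \<open>The sum \<open>?T\<close> is the transport term, an x-divergence for fixed v,
    and \<open>?F\<close> is the v-divergence of flux times test function. Both integrate to zero,
    and the tested flux remains.\<close>
  have split: "dt (\<lambda>t. f t (fst z) (snd z)) s * ?\<psi> (snd z) = tested_flux R k s z - ?T z - ?F z" for z
    unfolding pde tested_flux_def by (simp add: sum_3 algebra_simps)
  have T0: "integral (cbox (0, - b) (1, b)) ?T = 0"
  proof -
    have "integral (cbox (0, - b) (1, b)) ?T = integral (cbox 0 1) (\<lambda>x. integral ?V (\<lambda>v. ?T (x, v)))"
      by (rule integral_prod_continuous[OF cT])
    also have "\<dots> = integral ?V (\<lambda>v. integral (cbox 0 1) (\<lambda>x. ?T (x, v)))"
      by (rule integral_swap_continuous) (use cT in \<open>simp add: case_prod_unfold\<close>)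
    also have "\<dots> = integral ?V (\<lambda>v. 0)"
    proof (rule integral_cong)
      fix v
      have c: "continuous_on UNIV (\<lambda>x. partial i (\<lambda>y. f s y v) x)" for i
        by (intro cfx continuous_on_id continuous_on_const)
      have 0: "(LINT x|torus. partial i (\<lambda>y. f s y v) x) = 0" for i
        using f_periodic[OF s, of v] f_partial(1)[OF s] c by (intro torus_integral_partial) auto
      have "integral (cbox 0 1) (\<lambda>x. ?T (x, v)) = (LINT x|torus. ?T (x, v))"
        by (intro torus_integral[symmetric] continuous_on_compose2[OF cT[of UNIV]]) (auto intro!: continuous_intros)
      also have "\<dots> = (\<Sum>i\<in>UNIV. v $ i * (LINT x|torus. partial i (\<lambda>y. f s y v) x) * ?\<psi> v)"
        using torus_integrable[OF c] by (simp add: Bochner_Integration.integral_sum)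
      finally show "integral (cbox 0 1) (\<lambda>x. ?T (x, v)) = 0" by (simp add: 0)
    qed
    finally show ?thesis by simp
  qed
  have F0: "integral (cbox (0, - b) (1, b)) ?F = 0"
  proof -
    have "integral (cbox (0, - b) (1, b)) ?F = integral (cbox 0 1) (\<lambda>x. integral ?V (\<lambda>v. ?F (x, v)))"
      by (rule integral_prod_continuous[OF cF])
    also have "\<dots> = integral (cbox 0 1) (\<lambda>x::real^3. 0)"
    proof (rule integral_cong)
      fix x :: "real^3"
      \<comment> \<open>The product rule is applied to the whole flux component, whose v-derivative
        is the one supplied by \<open>kinetic_regular\<close>; f alone is not differentiated in
        v.\<close>
      let ?K = "\<lambda>i v. ?G x i v * ?\<psi> v"
      have pK: "partial_exists i (?K i) v" "partial i (?K i) v = partial i (?G x i) v * ?\<psi> v + ?G x i v * test_fun_deriv R k i v" for i v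
      proof -
        have "((\<lambda>h. ?G x i (v + h *\<^sub>R axis i 1)) has_real_derivative partial i (?G x i) v) (at 0)"
          using partial_line[of i "?G x i" v 0] flux_partial(1)[OF s] by simp
        from DERIV_mult[OF this DERIV_test_fun[of R k v i]]
        have "((\<lambda>h. ?K i (v + h *\<^sub>R axis i 1)) has_real_derivative
            partial i (?G x i) v * ?\<psi> v + ?G x i v * test_fun_deriv R k i v) (at 0)"
          by (simp add: mult.commute)
        from partial_eqI[OF this]
        show "partial_exists i (?K i) v" "partial i (?K i) v = partial i (?G x i) v * ?\<psi> v + ?G x i v * test_fun_deriv R k i v"
          by auto
      qed
      have cK: "continuous_on S (?K i)" "continuous_on S (partial i (?K i))" for i S
        unfolding pK(2)
        by (intro continuous_on_mult continuous_on_add cG cGv cV cV' continuous_on_const continuous_on_id)+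
      have "integral ?V (\<lambda>v. ?F (x, v)) = integral ?V (\<lambda>v. \<Sum>i\<in>UNIV. partial i (?K i) v)"
        by (simp only: fst_conv snd_conv pK(2))
      also have "\<dots> = (\<Sum>i\<in>UNIV. integral ?V (partial i (?K i)))"
        by (intro integral_sum integrable_continuous cK) auto
      also have "\<dots> = 0"
      proof (rule sum.neutral, rule ballI)
        fix i
        show "integral ?V (partial i (?K i)) = 0"
          using test_fun_outside(1)[OF R, of _ k] by (intro integral_partial_compact_support cK pK(1)) (simp add: b_def)
      qed
      finally show "integral ?V (\<lambda>v. ?F (x, v)) = 0" .
    qed
    finally show ?thesis by simp
  qed
  have int: "h integrable_on cbox (0, - b) (1, b)" if "continuous_on UNIV h" for h :: "_ \<Rightarrow> real"
    by (intro integrable_continuous continuous_on_subset[OF that]) auto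
  have "integral (cbox (0, - b) (1, b)) (\<lambda>z. tested_flux R k s z - ?T z - ?F z)
      = integral (cbox (0, - b) (1, b)) (tested_flux R k s) - integral (cbox (0, - b) (1, b)) ?T - integral (cbox (0, - b) (1, b)) ?F"
    by (simp only: integral_diff int cT cF cTF continuous_on_diff)
  then show ?thesis unfolding split T0 F0 by simp
qed

end

lemma sym_grad_periodic:
  assumes "periodic w"
  shows "periodic (sym_grad w)"
proof -
  have "periodic (\<lambda>y. w y $ i)" for i using assms by (simp add: periodic_def)
  then show ?thesis using partial_periodic by (auto simp: periodic_def vec_eq_iff sym_grad_component)
qed

lemma test_fun_compose_continuous:
  assumes "0 < R" "continuous_on S h"
  shows "continuous_on S (\<lambda>z. test_fun R k (h z))" "continuous_on S (\<lambda>z. test_fun_deriv R k i (h z))"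
  using continuous_on_compose2[OF test_fun_continuous(1)[OF assms(1), of UNIV k] assms(2)]
    continuous_on_compose2[OF test_fun_continuous(2)[OF assms(1), of UNIV k i] assms(2)] by auto

context regular_solution
begin

text \<open>15 = 3 * 5: three components, each test function derivative bounded by 5. The bound does
  not involve R.\<close>

lemma tested_flux_bound:
  assumes "0 \<le> s" "0 < R"
  shows "\<bar>tested_flux R k s z\<bar> \<le> 15 * (f s (fst z) (snd z) * norm (u s (fst z) - snd z))"
proof -
  let ?d = "u s (fst z) - snd z"
  have "\<bar>\<Sum>i\<in>UNIV. ?d $ i * test_fun_deriv R k i (snd z)\<bar> \<le> (\<Sum>i\<in>(UNIV::3 set). norm ?d * 5)"
  proof (rule order_trans[OF sum_abs sum_mono])
    fix i
    show "\<bar>?d $ i * test_fun_deriv R k i (snd z)\<bar> \<le> norm ?d * 5"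
      unfolding abs_mult by (intro mult_mono component_le_norm_cart test_fun_bounds assms) auto
  qed
  then have "f s (fst z) (snd z) * \<bar>\<Sum>i\<in>UNIV. ?d $ i * test_fun_deriv R k i (snd z)\<bar>
      \<le> f s (fst z) (snd z) * (15 * norm ?d)"
    by (intro mult_left_mono f_nonneg assms) simp
  then show ?thesis
    using f_nonneg[OF assms(1)] by (simp add: tested_flux_def abs_mult algebra_simps)
qed

lemma slip_integrable:
  assumes s: "0 \<le> s"
  shows "integrable phase (\<lambda>z. f s (fst z) (snd z) *\<^sub>R (u s (fst z) - snd z))"
    and "integrable phase (\<lambda>z. (norm (u s (fst z) - snd z))\<^sup>2 * f s (fst z) (snd z))"
proof -
  obtain B where B: "0 \<le> B" "\<And>x. x \<in> cbox 0 1 \<Longrightarrow> norm (u s x) \<le> B"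
    using u_bounded[OF s] by blast
  show "integrable phase (\<lambda>z. f s (fst z) (snd z) *\<^sub>R (u s (fst z) - snd z))"
  proof (rule phase_weight_integrable[OF s, where c = "B + 1"])
    show "continuous_on UNIV (\<lambda>z. u s (fst z) - snd z)"
      by (intro continuous_intros u_fst_continuous s)
    fix x v :: "real^3" assume "x \<in> cbox 0 1"
    then have "norm (u s x - v) \<le> B + norm v"
      using norm_triangle_ineq4[of "u s x" v] B(2)[of x] by linarith
    also have "\<dots> \<le> B * (1 + (norm v)\<^sup>2) + (1 + (norm v)\<^sup>2)"
      using B(1) weight_ineq[of "norm v"] by (intro add_mono) (auto simp: mult_le_cancel_left1)
    also have "\<dots> = (B + 1) * (1 + (norm v)\<^sup>2)" by (simp add: algebra_simps)
    finally show "norm (u s (fst (x, v)) - snd (x, v)) \<le> (B + 1) * (1 + (norm v)\<^sup>2)" by simp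
  qed
  have "integrable phase (\<lambda>z. f s (fst z) (snd z) *\<^sub>R (norm (u s (fst z) - snd z))\<^sup>2)"
  proof (rule phase_weight_integrable[OF s, where c = "2 * B\<^sup>2 + 2"])
    show "continuous_on UNIV (\<lambda>z. (norm (u s (fst z) - snd z))\<^sup>2)"
      by (intro continuous_intros u_fst_continuous s)
    fix x v :: "real^3" assume "x \<in> cbox 0 1"
    then have "norm (u s x - v) \<le> B + norm v"
      using norm_triangle_ineq4[of "u s x" v] B(2)[of x] by linarith
    then have "(norm (u s x - v))\<^sup>2 \<le> (B + norm v)\<^sup>2" by (intro power_mono) auto
    also have "\<dots> \<le> 2 * B\<^sup>2 + 2 * (norm v)\<^sup>2"
      using zero_le_power2[of "B - norm v"] by (simp add: power2_sum power2_diff)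
    also have "\<dots> \<le> (2 * B\<^sup>2 + 2) * (1 + (norm v)\<^sup>2)" by (simp add: algebra_simps)
    finally show "norm ((norm (u s (fst (x, v)) - snd (x, v)))\<^sup>2) \<le> (2 * B\<^sup>2 + 2) * (1 + (norm v)\<^sup>2)" by simp
  qed
  then show "integrable phase (\<lambda>z. (norm (u s (fst z) - snd z))\<^sup>2 * f s (fst z) (snd z))"
    by (simp add: mult.commute)
qed

lemma drag_dissipation_eq: "drag_dissipation f u s = (LINT z|phase. (norm (u s (fst z) - snd z))\<^sup>2 * f s (fst z) (snd z))"
  by (simp add: drag_dissipation_def case_prod_unfold)

text \<open>By a <= 1 + a^2 the first moment of u - v is controlled by mass and drag dissipation,
  the latter being integrable in time.\<close>

lemma slip_norm_integral:
  assumes s: "0 \<le> s"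
  shows "integrable phase (\<lambda>z. f s (fst z) (snd z) * norm (u s (fst z) - snd z))"
    and "(LINT z|phase. f s (fst z) (snd z) * norm (u s (fst z) - snd z)) \<le> 1 + drag_dissipation f u s"
proof -
  show int: "integrable phase (\<lambda>z. f s (fst z) (snd z) * norm (u s (fst z) - snd z))"
    using integrable_norm[OF slip_integrable(1)[OF s]] f_nonneg[OF s] by simp
  have "(LINT z|phase. f s (fst z) (snd z) * norm (u s (fst z) - snd z))
      \<le> (LINT z|phase. f s (fst z) (snd z) + (norm (u s (fst z) - snd z))\<^sup>2 * f s (fst z) (snd z))"
  proof (rule integral_mono[OF int])
    show "integrable phase (\<lambda>z. f s (fst z) (snd z) + (norm (u s (fst z) - snd z))\<^sup>2 * f s (fst z) (snd z))"
      by (intro Bochner_Integration.integrable_add f_integrable slip_integrable s)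
    fix z
    show "f s (fst z) (snd z) * norm (u s (fst z) - snd z)
        \<le> f s (fst z) (snd z) + (norm (u s (fst z) - snd z))\<^sup>2 * f s (fst z) (snd z)"
      using mult_left_mono[OF weight_ineq[of "norm (u s (fst z) - snd z)"] f_nonneg[OF s, of "fst z" "snd z"]]
      by (simp add: algebra_simps)
  qed
  also have "\<dots> = 1 + drag_dissipation f u s"
    unfolding drag_dissipation_eq
    using Bochner_Integration.integral_add[OF f_integrable[OF s] slip_integrable(2)[OF s]] f_integral[OF s] by simp
  finally show "(LINT z|phase. f s (fst z) (snd z) * norm (u s (fst z) - snd z)) \<le> 1 + drag_dissipation f u s" .
qed

lemma tested_flux_continuous:
  assumes "0 \<le> s" "0 < R"
  shows "continuous_on S (tested_flux R k s)"
proof -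
  have "continuous_on S (\<lambda>z. test_fun_deriv R k i (snd z))" for i
    by (intro test_fun_compose_continuous assms continuous_intros)
  then show ?thesis
    unfolding tested_flux_def[abs_def] using assms(1)
    by (intro continuous_intros f_fst_snd_continuous u_fst_continuous) auto
qed

lemma tested_flux_integrable:
  assumes s: "0 \<le> s" "0 < R"
  shows "integrable phase (tested_flux R k s)"
proof (rule Bochner_Integration.integrable_bound)
  show "integrable phase (\<lambda>z. 15 * (f s (fst z) (snd z) * norm (u s (fst z) - snd z)))"
    by (intro integrable_mult_right slip_norm_integral s)
  show "tested_flux R k s \<in> borel_measurable phase"
    by (intro phase_measurable tested_flux_continuous s)
  show "AE z in phase. norm (tested_flux R k s z) \<le> norm (15 * (f s (fst z) (snd z) * norm (u s (fst z) - snd z)))"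
    using tested_flux_bound[OF s] by (intro AE_I2) (simp add: f_nonneg s)
qed

lemma test_fun_moment:
  assumes t: "0 \<le> t" and R: "0 < R"
  shows "integrable phase (\<lambda>z. f t (fst z) (snd z) * test_fun R k (snd z))"
    and "continuous_on S (\<lambda>z. f t (fst z) (snd z) * test_fun R k (snd z))"
    and "(LINT z|phase. f t (fst z) (snd z) * test_fun R k (snd z))
      = integral (cbox (0, - (R *\<^sub>R 1)) (1, R *\<^sub>R 1)) (\<lambda>z. f t (fst z) (snd z) * test_fun R k (snd z))"
proof -
  have cV: "continuous_on S (\<lambda>z. test_fun R k (snd z))" for S :: "((real^3) \<times> (real^3)) set"
    by (intro test_fun_compose_continuous R continuous_intros)
  show c: "continuous_on S (\<lambda>z. f t (fst z) (snd z) * test_fun R k (snd z))" for S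
    by (intro continuous_intros cV f_fst_snd_continuous t)
  have "integrable phase (\<lambda>z. f t (fst z) (snd z) *\<^sub>R test_fun R k (snd z))"
  proof (rule phase_weight_integrable[OF t cV, where c = 1])
    fix x v :: "real^3"
    show "norm (test_fun R k (snd (x, v))) \<le> 1 * (1 + (norm v)\<^sup>2)"
      using test_fun_bounds(1)[OF R, of k v] weight_ineq[of "norm v"] by simp
  qed
  then show int: "integrable phase (\<lambda>z. f t (fst z) (snd z) * test_fun R k (snd z))" by simp
  show "(LINT z|phase. f t (fst z) (snd z) * test_fun R k (snd z))
      = integral (cbox (0, - (R *\<^sub>R 1)) (1, R *\<^sub>R 1)) (\<lambda>z. f t (fst z) (snd z) * test_fun R k (snd z))"
    using test_fun_outside(1)[OF R] by (intro phase_integral_compact_support c int) simp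
qed

text \<open>At fixed R everything lives on a compact box, where the time derivative of f is jointly
  continuous; this justifies exchanging time and phase integrals.\<close>

lemma kinetic_weak_form:
  assumes t: "0 \<le> t" and R: "0 < R"
  shows "continuous_on {0..t} (\<lambda>s. LINT z|phase. tested_flux R k s z)"
    and "(LINT z|phase. f t (fst z) (snd z) * test_fun R k (snd z)) - (LINT z|phase. f 0 (fst z) (snd z) * test_fun R k (snd z))
      = integral {0..t} (\<lambda>s. LINT z|phase. tested_flux R k s z)"
proof -
  let ?C = "cbox (0, - (R *\<^sub>R 1)) (1, R *\<^sub>R 1) :: ((real^3) \<times> (real^3)) set"
  let ?\<psi> = "\<lambda>z. test_fun R k (snd z)"
  let ?d = "\<lambda>s z. dt (\<lambda>t. f t (fst z) (snd z)) s * ?\<psi> z"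
  have cV: "continuous_on S (\<lambda>z. test_fun R k (snd (snd z)))" for S :: "(real \<times> (real^3) \<times> (real^3)) set"
    by (intro test_fun_compose_continuous R continuous_intros)
  have cd: "continuous_on ({0..t} \<times> ?C) (\<lambda>(s, z). ?d s z)"
    unfolding case_prod_unfold
    by (intro continuous_intros cV joint_continuous3[OF cont_dtf]) auto
  have eq: "(LINT z|phase. tested_flux R k s z) = integral ?C (?d s)" if "s \<in> {0..t}" for s
  proof -
    have s: "0 \<le> s" using that by simp
    have "(LINT z|phase. tested_flux R k s z) = integral ?C (tested_flux R k s)"
      using test_fun_outside(2)[OF R]
      by (intro phase_integral_compact_support tested_flux_continuous tested_flux_integrable s R) (simp add: tested_flux_def)
    then show ?thesis using tested_kinetic_eq[OF s R, of k] by simp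
  qed
  have cont: "continuous_on {0..t} (\<lambda>s. integral ?C (?d s))"
    by (rule integral_continuous_on_param[OF cd])
  then show "continuous_on {0..t} (\<lambda>s. LINT z|phase. tested_flux R k s z)"
    using eq by (subst continuous_on_cong[OF refl eq]) auto
  have int: "(\<lambda>z. f s (fst z) (snd z) * ?\<psi> z) integrable_on ?C" if "0 \<le> s" for s
    by (intro integrable_continuous test_fun_moment that R)
  have "(LINT z|phase. f t (fst z) (snd z) * ?\<psi> z) - (LINT z|phase. f 0 (fst z) (snd z) * ?\<psi> z)
      = integral ?C (\<lambda>z. f t (fst z) (snd z) * ?\<psi> z - f 0 (fst z) (snd z) * ?\<psi> z)"
    using test_fun_moment(3)[OF _ R] t int by (simp add: integral_diff)
  also have "\<dots> = integral ?C (\<lambda>z. integral (cbox 0 t) (\<lambda>s. ?d s z))"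
  proof (rule integral_cong)
    fix z :: "(real^3) \<times> (real^3)"
    have "((\<lambda>s. dt (\<lambda>t. f t (fst z) (snd z)) s) has_integral (f t (fst z) (snd z) - f 0 (fst z) (snd z))) {0..t}"
      by (intro dt_has_integral dtf_exists t)
    from has_integral_mult_left[OF this, of "?\<psi> z"]
    show "f t (fst z) (snd z) * ?\<psi> z - f 0 (fst z) (snd z) * ?\<psi> z = integral (cbox 0 t) (\<lambda>s. ?d s z)"
      unfolding cbox_interval left_diff_distrib[symmetric] by (rule integral_unique[symmetric])
  qed
  also have "\<dots> = integral (cbox 0 t) (\<lambda>s. integral ?C (?d s))"
  proof (rule integral_swap_continuous[symmetric])
    show "continuous_on (cbox (0, (0, - (R *\<^sub>R 1))) (t, (1, R *\<^sub>R 1))) (\<lambda>(s, z). ?d s z)"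
      by (rule continuous_on_subset[OF cd]) (auto simp: cbox_Pair_eq)
  qed
  also have "\<dots> = integral {0..t} (\<lambda>s. LINT z|phase. tested_flux R k s z)"
    using eq by (auto intro!: integral_cong)
  finally show "(LINT z|phase. f t (fst z) (snd z) * ?\<psi> z) - (LINT z|phase. f 0 (fst z) (snd z) * ?\<psi> z)
      = integral {0..t} (\<lambda>s. LINT z|phase. tested_flux R k s z)" .
qed

section \<open>Total drag and the two momentum balances\<close>

lemma cont_drag: "continuous_on ({0..} \<times> UNIV) (\<lambda>(t, x). drag f u t x)"
  using fl_reg unfolding fluid_regular_def by blast

lemma drag_continuous: "0 \<le> t \<Longrightarrow> continuous_on S a \<Longrightarrow> continuous_on S (\<lambda>z. drag f u t (a z))"
  by (rule joint_continuous2[OF cont_drag continuous_on_const])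

lemma total_drag:
  assumes s: "0 \<le> s"
  shows "(LINT z|phase. f s (fst z) (snd z) * (u s (fst z) - snd z) $ k) = (LINT x|torus. drag f u s x $ k)"
proof -
  have int: "integrable lborel (\<lambda>v. f s x v *\<^sub>R (u s x - v))" for x
    using fl_reg s unfolding fluid_regular_def by blast
  have "integrable phase (\<lambda>z. (f s (fst z) (snd z) *\<^sub>R (u s (fst z) - snd z)) $ k)"
    by (rule integrable_bounded_linear[OF bounded_linear_vec_nth slip_integrable(1)[OF s]])
  then have "(LINT x|torus. LINT v|lborel. f s x v * (u s x - v) $ k)
      = (LINT z|phase. f s (fst z) (snd z) * (u s (fst z) - snd z) $ k)"
    using torus_lborel.integral_fst'[of "\<lambda>z. f s (fst z) (snd z) * (u s (fst z) - snd z) $ k"] by (simp add: phase_def)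
  moreover have "(LINT v|lborel. f s x v * (u s x - v) $ k) = drag f u s x $ k" for x
    using integral_bounded_linear[OF bounded_linear_vec_nth[of k] int[of x]] by (simp add: drag_def)
  ultimately show ?thesis by simp
qed

lemma total_drag_continuous: "continuous_on {0..t} (\<lambda>s. LINT x|torus. drag f u s x $ k)"
proof -
  have "continuous_on {0..t} (\<lambda>s. integral (cbox 0 1) (\<lambda>x. drag f u s x $ k))"
    by (rule integral_continuous_on_param, unfold case_prod_unfold)
      (auto intro!: continuous_intros joint_continuous2[OF cont_drag])
  moreover have "(LINT x|torus. drag f u s x $ k) = integral (cbox 0 1) (\<lambda>x. drag f u s x $ k)" if "s \<in> {0..t}" for s
    using that by (intro torus_integral continuous_intros drag_continuous) auto
  ultimately show ?thesis by (subst continuous_on_cong[OF refl]) auto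
qed

text \<open>The truncation is removed by dominated convergence twice: in phase space at fixed time,
  and then in the time integral of the weak form.\<close>

lemma particle_momentum:
  assumes t: "0 \<le> t"
  shows "v_c f t $ k - v_c f 0 $ k = integral {0..t} (\<lambda>s. LINT x|torus. drag f u s x $ k)"
proof -
  let ?R = "\<lambda>n. real (Suc n)"
  let ?I = "restrict_space lborel (cbox 0 t)"
  have vc: "(\<lambda>n. LINT z|phase. f s (fst z) (snd z) * test_fun (?R n) k (snd z)) \<longlonglongrightarrow> v_c f s $ k" if s: "0 \<le> s" for s
  proof -
    have int: "integrable phase (\<lambda>z. f s (fst z) (snd z) *\<^sub>R snd z)"
      by (rule phase_weight_integrable[OF s, where c = 1]) (auto intro!: continuous_intros weight_ineq)
    have "(\<lambda>n. LINT z|phase. f s (fst z) (snd z) * test_fun (?R n) k (snd z)) \<longlonglongrightarrow> (LINT z|phase. f s (fst z) (snd z) * snd z $ k)"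
    proof (rule integral_dominated_convergence)
      show "(\<lambda>z. f s (fst z) (snd z) * snd z $ k) \<in> borel_measurable phase"
        by (intro phase_measurable continuous_intros f_fst_snd_continuous s)
      show "(\<lambda>z. f s (fst z) (snd z) * test_fun (?R n) k (snd z)) \<in> borel_measurable phase" for n
        by (intro phase_measurable test_fun_moment s) simp
      show "integrable phase (\<lambda>z. norm (f s (fst z) (snd z) *\<^sub>R snd z))"
        by (rule integrable_norm[OF int])
      show "AE z in phase. (\<lambda>n. f s (fst z) (snd z) * test_fun (?R n) k (snd z)) \<longlonglongrightarrow> f s (fst z) (snd z) * snd z $ k"
        by (intro AE_I2 tendsto_mult tendsto_const test_fun_limit)
      show "AE z in phase. norm (f s (fst z) (snd z) * test_fun (?R n) k (snd z)) \<le> norm (f s (fst z) (snd z) *\<^sub>R snd z)" for n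
        using test_fun_bounds(1)[of "?R n" k] by (intro AE_I2) (simp add: abs_mult mult_left_mono)
    qed
    moreover have "(LINT z|phase. f s (fst z) (snd z) * snd z $ k) = v_c f s $ k"
      using integral_bounded_linear[OF bounded_linear_vec_nth[of k] int] by (simp add: v_c_def case_prod_unfold)
    ultimately show ?thesis by simp
  qed
  let ?g = "\<lambda>n s. LINT z|phase. tested_flux (?R n) k s z"
  let ?G = "\<lambda>s. LINT x|torus. drag f u s x $ k"
  have gG: "(\<lambda>n. ?g n s) \<longlonglongrightarrow> ?G s" if s: "0 \<le> s" for s
    unfolding total_drag[OF s, symmetric]
  proof (rule integral_dominated_convergence)
    show "(\<lambda>z. f s (fst z) (snd z) * (u s (fst z) - snd z) $ k) \<in> borel_measurable phase"
      by (intro phase_measurable continuous_intros f_fst_snd_continuous u_fst_continuous s)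
    show "tested_flux (?R n) k s \<in> borel_measurable phase" for n
      by (intro phase_measurable tested_flux_continuous s) simp
    show "integrable phase (\<lambda>z. 15 * (f s (fst z) (snd z) * norm (u s (fst z) - snd z)))"
      by (intro integrable_mult_right slip_norm_integral s)
    show "AE z in phase. (\<lambda>n. tested_flux (?R n) k s z) \<longlonglongrightarrow> f s (fst z) (snd z) * (u s (fst z) - snd z) $ k"
    proof (rule AE_I2)
      fix z
      have "(\<lambda>n. tested_flux (?R n) k s z) \<longlonglongrightarrow>
          f s (fst z) (snd z) * (\<Sum>i\<in>UNIV. (u s (fst z) - snd z) $ i * (if i = k then 1 else 0))"
        unfolding tested_flux_def by (intro tendsto_mult tendsto_sum tendsto_const test_fun_limit)
      then show "(\<lambda>n. tested_flux (?R n) k s z) \<longlonglongrightarrow> f s (fst z) (snd z) * (u s (fst z) - snd z) $ k"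
        by (simp add: if_distrib cong: if_cong)
    qed
    show "AE z in phase. norm (tested_flux (?R n) k s z) \<le> 15 * (f s (fst z) (snd z) * norm (u s (fst z) - snd z))" for n
      using tested_flux_bound[OF s, of "?R n" k] by (intro AE_I2) simp
  qed
  have cg: "continuous_on (cbox 0 t) (?g n)" for n
    using kinetic_weak_form(1)[OF t, of "?R n" k] by simp
  have cG: "continuous_on (cbox 0 t) ?G"
    using total_drag_continuous by simp
  \<comment> \<open>The bound 15 (1 + drag dissipation) dominates all truncated fluxes at once and
    is integrable on [0, t] by the energy balance.\<close>
  have lim: "(\<lambda>n. LINT s|?I. ?g n s) \<longlonglongrightarrow> (LINT s|?I. ?G s)"
  proof (rule integral_dominated_convergence)
    show "?G \<in> borel_measurable ?I" "?g n \<in> borel_measurable ?I" for n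
      using cube_continuous_integral(1)[OF cG] cube_continuous_integral(1)[OF cg] by auto
    have "set_integrable lborel (cbox 0 t) (drag_dissipation f u)"
      using balance t by (simp add: energy_balance_def)
    then have "integrable ?I (drag_dissipation f u)"
      by (simp add: integrable_restrict_space set_integrable_def)
    moreover have "integrable ?I (\<lambda>s. 1 :: real)"
      by (rule cube_continuous_integral(1)) auto
    ultimately show "integrable ?I (\<lambda>s. 15 * (1 + drag_dissipation f u s))"
      by (intro integrable_mult_right Bochner_Integration.integrable_add)
    have sp: "0 \<le> s" if "s \<in> space ?I" for s using that by (simp add: space_restrict_space)
    show "AE s in ?I. (\<lambda>n. ?g n s) \<longlonglongrightarrow> ?G s"
      by (intro AE_I2 gG sp)
    show "AE s in ?I. norm (?g n s) \<le> 15 * (1 + drag_dissipation f u s)" for n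
    proof (rule AE_I2)
      fix s assume "s \<in> space ?I"
      then have s: "0 \<le> s" by (rule sp)
      have "norm (?g n s) \<le> (LINT z|phase. norm (tested_flux (?R n) k s z))"
        by (rule integral_norm_bound)
      also have "\<dots> \<le> (LINT z|phase. 15 * (f s (fst z) (snd z) * norm (u s (fst z) - snd z)))"
        using tested_flux_bound[OF s, of "?R n" k]
        by (intro integral_mono integrable_norm tested_flux_integrable integrable_mult_right slip_norm_integral s) auto
      also have "\<dots> \<le> 15 * (1 + drag_dissipation f u s)"
        using slip_norm_integral(2)[OF s] by simp
      finally show "norm (?g n s) \<le> 15 * (1 + drag_dissipation f u s)" .
    qed
  qed
  have weak: "(LINT z|phase. f t (fst z) (snd z) * test_fun (?R n) k (snd z)) - (LINT z|phase. f 0 (fst z) (snd z) * test_fun (?R n) k (snd z))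
      = (LINT s|?I. ?g n s)" for n
    using kinetic_weak_form(2)[OF t, of "?R n" k] cube_continuous_integral(2)[OF cg, of n] by simp
  have "(\<lambda>n. LINT s|?I. ?g n s) \<longlonglongrightarrow> v_c f t $ k - v_c f 0 $ k"
    unfolding weak[symmetric] using vc[OF t] vc[of 0] by (intro tendsto_diff) auto
  then have "v_c f t $ k - v_c f 0 $ k = (LINT s|?I. ?G s)"
    using lim LIMSEQ_unique by blast
  then show ?thesis using cube_continuous_integral(2)[OF cG] by simp
qed

lemma fluid_partials:
  shows "0 \<le> t \<Longrightarrow> partial_exists j (\<lambda>y. u t y $ i) x"
    and "continuous_on ({0..} \<times> UNIV) (\<lambda>(t, x). partial j (\<lambda>y. u t y $ i) x)"
    and "0 \<le> t \<Longrightarrow> partial_exists i (\<pi> t) x"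
    and "continuous_on ({0..} \<times> UNIV) (\<lambda>(t, x). partial i (\<pi> t) x)"
    and "0 \<le> t \<Longrightarrow> partial_exists j (\<lambda>y. stress \<mu> p (sym_grad (u t) y) $ i $ j) x"
    and "continuous_on ({0..} \<times> UNIV) (\<lambda>(t, x). partial j (\<lambda>y. stress \<mu> p (sym_grad (u t) y) $ i $ j) x)"
    and "0 \<le> t \<Longrightarrow> dt_exists (\<lambda>s. u s x) t"
    and "continuous_on ({0..} \<times> UNIV) (\<lambda>(t, x). dt (\<lambda>s. u s x) t)"
  using fl_reg unfolding fluid_regular_def by blast+

lemma u_C1_field:
  assumes t: "0 \<le> t"
  shows "C1_field (u t)"
  using u_periodic[OF t] u_continuous[OF t continuous_on_id] fluid_partials(1)[OF t]
    joint_continuous2[OF fluid_partials(2) continuous_on_const continuous_on_id] t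
  by (auto simp: C1_field_def C1_def)

text \<open>Convection, pressure and stress are all derivatives of periodic functions, so only the
  drag survives integration over the torus.\<close>

lemma fluid_acceleration_integral:
  assumes t: "0 \<le> t"
  shows "(LINT x|torus. dt (\<lambda>s. u s x) t $ k) = - (LINT x|torus. drag f u t x $ k)"
proof -
  let ?w = "\<lambda>i y. u t y $ i"
  let ?S = "\<lambda>j y. stress \<mu> p (sym_grad (u t) y) $ k $ j"
  have slice: "continuous_on UNIV (\<lambda>x. F t x)" if "continuous_on ({0..} \<times> UNIV) (\<lambda>(t, x). F t x)"
    for F :: "real \<Rightarrow> real^3 \<Rightarrow> real"
    using joint_continuous2[OF that continuous_on_const continuous_on_id] t by auto
  have cw: "continuous_on UNIV (?w i)" for i
    by (intro continuous_intros u_continuous[OF t continuous_on_id])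
  have cp: "continuous_on UNIV (partial j (?w i))" for i j
    using slice[OF fluid_partials(2)] by simp
  have cpi: "continuous_on UNIV (partial k (\<pi> t))"
    using slice[OF fluid_partials(4)] by simp
  have cS: "continuous_on UNIV (partial j (?S j))" for j
    using slice[OF fluid_partials(6)] by simp
  have cd: "continuous_on UNIV (\<lambda>x. drag f u t x $ k)"
    by (intro continuous_intros drag_continuous t continuous_on_id)
  have prod: "partial_exists j (\<lambda>y. ?w k y * ?w j y) x"
    "partial j (\<lambda>y. ?w k y * ?w j y) x = partial j (?w k) x * ?w j x + ?w k x * partial j (?w j) x" for j x
  proof -
    have D: "((\<lambda>h. ?w i (x + h *\<^sub>R axis j 1)) has_real_derivative partial j (?w i) x) (at 0)" for i
      using partial_line[of j "?w i" x 0] fluid_partials(1)[OF t] by simp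
    from DERIV_mult[OF D[of k] D[of j]]
    have "((\<lambda>h. ?w k (x + h *\<^sub>R axis j 1) * ?w j (x + h *\<^sub>R axis j 1)) has_real_derivative
        partial j (?w k) x * ?w j x + ?w k x * partial j (?w j) x) (at 0)"
      by (simp add: mult.commute)
    from partial_eqI[OF this]
    show "partial_exists j (\<lambda>y. ?w k y * ?w j y) x"
      "partial j (\<lambda>y. ?w k y * ?w j y) x = partial j (?w k) x * ?w j x + ?w k x * partial j (?w j) x"
      by auto
  qed
  have cprod: "continuous_on UNIV (partial j (\<lambda>y. ?w k y * ?w j y))" for j
    unfolding prod(2) by (intro continuous_intros cp cw)
  have per: "periodic (?w i)" for i using u_periodic[OF t] by (simp add: periodic_def)
  have perS: "periodic (?S j)" for j
    using sym_grad_periodic[OF u_periodic[OF t]] by (simp add: periodic_def)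
  have 1: "(LINT x|torus. partial j (\<lambda>y. ?w k y * ?w j y) x) = 0" for j
    using per by (intro torus_integral_partial prod cprod) (simp add: periodic_def)
  have 2: "(LINT x|torus. partial k (\<pi> t) x) = 0"
    by (intro torus_integral_partial \<pi>_periodic fluid_partials cpi t)
  have 3: "(LINT x|torus. partial j (?S j) x) = 0" for j
    by (intro torus_integral_partial perS fluid_partials cS t)
  have pde: "dt (\<lambda>s. u s x) t $ k = - (\<Sum>j\<in>UNIV. partial j (\<lambda>y. ?w k y * ?w j y) x) - partial k (\<pi> t) x
      + (\<Sum>j\<in>UNIV. partial j (?S j) x) - drag f u t x $ k" for x
  proof -
    have eq: "dt (\<lambda>s. u s x) t + jac (u t) x *v u t x + grad (\<pi> t) x
       - dvg_mat (\<lambda>y. stress \<mu> p (sym_grad (u t) y)) x = - drag f u t x" and div: "dvg (u t) x = 0"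
      using fl_eq t unfolding fluid_eq_def by blast+
    \<comment> \<open>Incompressibility puts the convective term in divergence form: the extra term
      of the product rule is u_k div u.\<close>
    have "(\<Sum>j\<in>UNIV. partial j (\<lambda>y. ?w k y * ?w j y) x) = (\<Sum>j\<in>UNIV. partial j (?w k) x * ?w j x) + ?w k x * dvg (u t) x"
      unfolding prod(2) dvg_def by (simp add: sum.distrib sum_distrib_left)
    then have "(\<Sum>j\<in>UNIV. partial j (\<lambda>y. ?w k y * ?w j y) x) = (jac (u t) x *v u t x) $ k"
      by (simp add: div jac_def matrix_vector_mult_def)
    moreover have "grad (\<pi> t) x $ k = partial k (\<pi> t) x" by (simp add: grad_def)
    moreover have "dvg_mat (\<lambda>y. stress \<mu> p (sym_grad (u t) y)) x $ k = (\<Sum>j\<in>UNIV. partial j (?S j) x)"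
      by (simp add: dvg_mat_def dvg_def)
    moreover have "dt (\<lambda>s. u s x) t $ k + (jac (u t) x *v u t x) $ k + grad (\<pi> t) x $ k
       - dvg_mat (\<lambda>y. stress \<mu> p (sym_grad (u t) y)) x $ k = - drag f u t x $ k"
      using arg_cong[OF eq, of "\<lambda>a. a $ k"] by simp
    ultimately show ?thesis by linarith
  qed
  note int = torus_integrable[OF cprod] torus_integrable[OF cpi] torus_integrable[OF cS] torus_integrable[OF cd]
  show ?thesis
    unfolding pde using int
    by (simp add: Bochner_Integration.integral_sum Bochner_Integration.integral_diff Bochner_Integration.integral_add
        Bochner_Integration.integral_minus 1 2 3)
qed

lemma fluid_momentum:
  assumes t: "0 \<le> t"
  shows "u_c u t $ k - u_c u 0 $ k = - integral {0..t} (\<lambda>s. LINT x|torus. drag f u s x $ k)"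
proof -
  have uc: "u_c u s $ k = integral (cbox 0 1) (\<lambda>x. u s x $ k)" if s: "0 \<le> s" for s
  proof -
    have c: "continuous_on UNIV (u s)" by (rule u_continuous[OF s continuous_on_id])
    have "u_c u s $ k = (LINT x|torus. u s x $ k)"
      using integral_bounded_linear[OF bounded_linear_vec_nth[of k] torus_integrable[OF c]] by (simp add: u_c_def)
    also have "\<dots> = integral (cbox 0 1) (\<lambda>x. u s x $ k)"
      by (intro torus_integral continuous_intros c)
    finally show ?thesis .
  qed
  have int: "(\<lambda>x. u s x $ k) integrable_on cbox 0 1" if "0 \<le> s" for s
    by (intro integrable_continuous continuous_intros u_continuous[OF that] continuous_on_id)
  have "u_c u t $ k - u_c u 0 $ k = integral (cbox 0 1) (\<lambda>x. u t x $ k - u 0 x $ k)"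
    using uc t int by (simp add: integral_diff)
  also have "\<dots> = integral (cbox 0 1) (\<lambda>x. integral (cbox 0 t) (\<lambda>s. dt (\<lambda>s. u s x) s $ k))"
  proof (rule integral_cong)
    fix x
    have "((\<lambda>s. dt (\<lambda>s. u s x) s) has_integral (u t x - u 0 x)) {0..t}"
      by (intro dt_has_integral fluid_partials t)
    from has_integral_linear[OF this bounded_linear_vec_nth[of k]]
    show "u t x $ k - u 0 x $ k = integral (cbox 0 t) (\<lambda>s. dt (\<lambda>s. u s x) s $ k)"
      by (simp add: o_def integral_unique)
  qed
  also have "\<dots> = integral (cbox 0 t) (\<lambda>s. integral (cbox 0 1) (\<lambda>x. dt (\<lambda>s. u s x) s $ k))"
    by (rule integral_swap_continuous[symmetric], unfold case_prod_unfold)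
      (auto simp: cbox_Pair_eq intro!: continuous_intros joint_continuous2[OF fluid_partials(8)])
  also have "\<dots> = integral (cbox 0 t) (\<lambda>s. - (LINT x|torus. drag f u s x $ k))"
  proof (rule integral_cong)
    fix s assume "s \<in> cbox 0 t"
    then have s: "0 \<le> s" by simp
    have "continuous_on UNIV (\<lambda>x. dt (\<lambda>s. u s x) s $ k)"
      using s by (intro continuous_intros joint_continuous2[OF fluid_partials(8)] continuous_on_id) auto
    from torus_integral[OF this] show "integral (cbox 0 1) (\<lambda>x. dt (\<lambda>s. u s x) s $ k) = - (LINT x|torus. drag f u s x $ k)"
      using fluid_acceleration_integral[OF s, of k] by simp
  qed
  finally show ?thesis by simp
qed

lemma total_momentum:
  assumes "0 \<le> t"
  shows "u_c u t + v_c f t = u_c u 0 + v_c f 0"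
proof -
  have "u_c u t $ k + v_c f t $ k = u_c u 0 $ k + v_c f 0 $ k" for k
    using particle_momentum[OF assms, of k] fluid_momentum[OF assms, of k] by linarith
  then show ?thesis by (simp add: vec_eq_iff)
qed

end

section \<open>Energy dissipation\<close>

lemma partial_minus_const:
  assumes "\<And>x. partial_exists i g x"
  shows "partial_exists i (\<lambda>y. g y - k) x" "partial i (\<lambda>y. g y - k) x = partial i g x"
proof -
  have "((\<lambda>h. g (x + h *\<^sub>R axis i 1) - k) has_real_derivative partial i g x - 0) (at 0)"
    using partial_line[OF assms, of x 0] by (intro DERIV_diff DERIV_const) simp
  from partial_eqI[OF this[simplified]]
  show "partial_exists i (\<lambda>y. g y - k) x" "partial i (\<lambda>y. g y - k) x = partial i g x"
    by auto
qed

lemma C1_field_minus_const: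
  assumes "C1_field w"
  shows "C1_field (\<lambda>x. w x - c)" "sym_grad (\<lambda>x. w x - c) x = sym_grad w x"
proof -
  have pe: "partial_exists j (\<lambda>y. w y $ i) x" for i j x
    using assms by (simp add: C1_field_def C1_def)
  have peq: "partial j (\<lambda>y. (w y - c) $ i) = partial j (\<lambda>y. w y $ i)" for i j
    using partial_minus_const(2)[OF pe] by (intro ext) simp
  show "C1_field (\<lambda>x. w x - c)"
    unfolding C1_field_def C1_def peq
    using assms partial_minus_const(1)[OF pe]
    by (auto simp: C1_field_def C1_def periodic_def intro!: continuous_intros)
  show "sym_grad (\<lambda>x. w x - c) x = sym_grad w x"
    by (simp add: vec_eq_iff sym_grad_component peq[simplified])
qed

context regular_solution
begin

lemma f_moment_integrable: "0 \<le> t \<Longrightarrow> integrable phase (\<lambda>z. f t (fst z) (snd z) *\<^sub>R snd z)"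
  by (rule phase_weight_integrable[where c = 1]) (auto intro!: continuous_intros weight_ineq)

text \<open>The parallel axis identity; the total mass is 1. It is used with both mean velocities as
  centre.\<close>

lemma shifted_second_moment:
  assumes t: "0 \<le> t"
  shows "integrable phase (\<lambda>z. (norm (snd z - c))\<^sup>2 * f t (fst z) (snd z))"
    and "(LINT z|phase. (norm (snd z - c))\<^sup>2 * f t (fst z) (snd z))
      = (LINT z|phase. (norm (snd z))\<^sup>2 * f t (fst z) (snd z)) - 2 * (c \<bullet> v_c f t) + (norm c)\<^sup>2"
proof -
  have eq: "(norm (snd z - c))\<^sup>2 * f t (fst z) (snd z) = (norm (snd z))\<^sup>2 * f t (fst z) (snd z)
      - 2 * ((f t (fst z) (snd z) *\<^sub>R snd z) \<bullet> c) + (norm c)\<^sup>2 * f t (fst z) (snd z)" for z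
    unfolding power2_norm_eq_inner by (simp add: inner_diff_left inner_diff_right inner_commute algebra_simps)
  note int = f2_integrable[OF t] f_moment_integrable[OF t] f_integrable[OF t]
  have int2: "integrable phase (\<lambda>z. 2 * ((f t (fst z) (snd z) *\<^sub>R snd z) \<bullet> c))"
    by (intro integrable_mult_right integrable_inner_left int)
  have int3: "integrable phase (\<lambda>z. (norm c)\<^sup>2 * f t (fst z) (snd z))"
    by (intro integrable_mult_right int)
  show "integrable phase (\<lambda>z. (norm (snd z - c))\<^sup>2 * f t (fst z) (snd z))"
    unfolding eq by (intro Bochner_Integration.integrable_add Bochner_Integration.integrable_diff int int2 int3)
  have "(LINT z|phase. (norm (snd z - c))\<^sup>2 * f t (fst z) (snd z))
      = (LINT z|phase. (norm (snd z))\<^sup>2 * f t (fst z) (snd z))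
      - (LINT z|phase. 2 * ((f t (fst z) (snd z) *\<^sub>R snd z) \<bullet> c))
      + (LINT z|phase. (norm c)\<^sup>2 * f t (fst z) (snd z))"
    unfolding eq
    by (simp only: Bochner_Integration.integral_add Bochner_Integration.integral_diff
        Bochner_Integration.integrable_diff int(1) int2 int3)
  also have "(LINT z|phase. 2 * ((f t (fst z) (snd z) *\<^sub>R snd z) \<bullet> c)) = 2 * (c \<bullet> v_c f t)"
    using integral_inner_left[OF int(2), of c] by (simp add: v_c_def case_prod_unfold inner_commute)
  also have "(LINT z|phase. (norm c)\<^sup>2 * f t (fst z) (snd z)) = (norm c)\<^sup>2"
    using f_integral[OF t] by simp
  finally show "(LINT z|phase. (norm (snd z - c))\<^sup>2 * f t (fst z) (snd z))
      = (LINT z|phase. (norm (snd z))\<^sup>2 * f t (fst z) (snd z)) - 2 * (c \<bullet> v_c f t) + (norm c)\<^sup>2" .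
qed

lemma fluid_variance:
  assumes t: "0 \<le> t"
  shows "(LINT x|torus. (norm (u t x - u_c u t))\<^sup>2) = (LINT x|torus. (norm (u t x))\<^sup>2) - (norm (u_c u t))\<^sup>2"
proof -
  let ?c = "u_c u t"
  have cu: "continuous_on UNIV (u t)" by (rule u_continuous[OF t continuous_on_id])
  have eq: "(norm (u t x - ?c))\<^sup>2 = (norm (u t x))\<^sup>2 - 2 * (u t x \<bullet> ?c) + (norm ?c)\<^sup>2" for x
    unfolding power2_norm_eq_inner by (simp add: inner_diff_left inner_diff_right inner_commute)
  have "(LINT x|torus. (norm (u t x - ?c))\<^sup>2)
      = (LINT x|torus. (norm (u t x))\<^sup>2) - (LINT x|torus. 2 * (u t x \<bullet> ?c)) + (LINT x|torus. (norm ?c)\<^sup>2)"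
    unfolding eq using cu
    by (simp only: Bochner_Integration.integral_add Bochner_Integration.integral_diff
        torus_integrable continuous_intros)
  also have "(LINT x|torus. 2 * (u t x \<bullet> ?c)) = 2 * (?c \<bullet> ?c)"
    using integral_inner_left[OF torus_integrable[OF cu], of ?c] by (simp add: u_c_def)
  finally show ?thesis by (simp add: power2_norm_eq_inner)
qed

text \<open>By the parallelogram identity |a|^2/2 + |b|^2/2 = |a-b|^2/4 + |a+b|^2/4. This explains
  the weight 1/4 in the modulated energy: the complementary term is the conserved total
  momentum.\<close>

lemma modulated_energy_eq:
  assumes t: "0 \<le> t"
  shows "modulated_energy f u t = energy f u t - 1/4 * (norm (u_c u t + v_c f t))\<^sup>2"
proof -
  have "(LINT z|phase. (norm (snd z - v_c f t))\<^sup>2 * f t (fst z) (snd z))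
      = (LINT z|phase. (norm (snd z))\<^sup>2 * f t (fst z) (snd z)) - (norm (v_c f t))\<^sup>2"
    using shifted_second_moment(2)[OF t, of "v_c f t"] by (simp add: power2_norm_eq_inner)
  moreover have "energy f u t = 1/2 * (LINT z|phase. (norm (snd z))\<^sup>2 * f t (fst z) (snd z)) + 1/2 * (LINT x|torus. (norm (u t x))\<^sup>2)"
    by (simp add: energy_def case_prod_unfold)
  moreover have "(norm (u_c u t - v_c f t))\<^sup>2 + (norm (u_c u t + v_c f t))\<^sup>2 = 2 * (norm (u_c u t))\<^sup>2 + 2 * (norm (v_c f t))\<^sup>2"
    unfolding power2_norm_eq_inner by (simp add: inner_diff_left inner_diff_right inner_add_left inner_add_right inner_commute)
  ultimately show ?thesis
    using fluid_variance[OF t] unfolding modulated_energy_def case_prod_unfold by linarith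
qed

text \<open>The second claim, together with monotonicity of the energy, provides the a priori bound
  \<open>A\<close> of \<open>density_bound\<close>.\<close>

lemma modulated_energy_nonneg:
  assumes t: "0 \<le> t"
  shows "0 \<le> modulated_energy f u t" "(LINT x|torus. (norm (u t x - u_c u t))\<^sup>2) \<le> 2 * modulated_energy f u t"
proof -
  have 1: "0 \<le> (LINT z|phase. (norm (snd z - v_c f t))\<^sup>2 * f t (fst z) (snd z))"
    by (intro integral_nonneg_AE AE_I2) (simp add: f_nonneg t)
  have 2: "0 \<le> (LINT x|torus. (norm (u t x - u_c u t))\<^sup>2)"
    by (simp add: torus_integral_nonneg)
  show "0 \<le> modulated_energy f u t" "(LINT x|torus. (norm (u t x - u_c u t))\<^sup>2) \<le> 2 * modulated_energy f u t"
    using 1 2 unfolding modulated_energy_def by (simp_all add: case_prod_unfold)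
qed

lemma density_facts:
  assumes t: "0 \<le> t"
  shows "0 \<le> particle_density f t x" "integrable torus (particle_density f t)"
    "(LINT x|torus. particle_density f t x) = 1"
proof -
  show "0 \<le> particle_density f t x"
    unfolding particle_density_def by (intro integral_nonneg_AE AE_I2 f_nonneg t)
  show "integrable torus (particle_density f t)"
    using torus_lborel.integrable_fst'[of "\<lambda>z. f t (fst z) (snd z)"] f_integrable[OF t]
    by (simp add: phase_def particle_density_def[abs_def])
  show "(LINT x|torus. particle_density f t x) = 1"
    using torus_lborel.integral_fst'[of "\<lambda>z. f t (fst z) (snd z)"] f_integrable[OF t] f_integral[OF t]
    by (simp add: phase_def particle_density_def)
qed

lemma modulated_energy_bound:
  assumes t: "0 \<le> t"
  defines "w \<equiv> \<lambda>x. u t x - u_c u t"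
  shows "modulated_energy f u t \<le> drag_dissipation f u t + (LINT x|torus. (norm (w x))\<^sup>2 * particle_density f t x)
    + 1/2 * (LINT x|torus. (norm (w x))\<^sup>2)"
proof -
  let ?f = "\<lambda>z. f t (fst z) (snd z)"
  obtain B where B: "0 \<le> B" "\<And>x. x \<in> cbox 0 1 \<Longrightarrow> norm (u t x) \<le> B"
    using u_bounded[OF t] by blast
  have w_int: "integrable phase (\<lambda>z. (norm (w (fst z)))\<^sup>2 * ?f z)"
  proof -
    have "integrable phase (\<lambda>z. ?f z *\<^sub>R (norm (w (fst z)))\<^sup>2)"
    proof (rule phase_weight_integrable[OF t, where c = "(B + norm (u_c u t))\<^sup>2"])
      show "continuous_on UNIV (\<lambda>z. (norm (w (fst z)))\<^sup>2)"
        unfolding w_def by (intro continuous_intros u_fst_continuous t)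
      fix x v :: "real^3" assume "x \<in> cbox 0 1"
      then have "norm (w x) \<le> B + norm (u_c u t)"
        unfolding w_def using norm_triangle_ineq4[of "u t x" "u_c u t"] B(2)[of x] by linarith
      then have "(norm (w x))\<^sup>2 \<le> (B + norm (u_c u t))\<^sup>2 * 1" by (simp add: power_mono)
      also have "\<dots> \<le> (B + norm (u_c u t))\<^sup>2 * (1 + (norm v)\<^sup>2)" by (intro mult_left_mono) auto
      finally show "norm ((norm (w (fst (x, v))))\<^sup>2) \<le> (B + norm (u_c u t))\<^sup>2 * (1 + (norm v)\<^sup>2)" by simp
    qed
    then show ?thesis by (simp add: mult.commute)
  qed
  have wr: "(LINT z|phase. (norm (w (fst z)))\<^sup>2 * ?f z) = (LINT x|torus. (norm (w x))\<^sup>2 * particle_density f t x)"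
    using torus_lborel.integral_fst'[of "\<lambda>z. (norm (w (fst z)))\<^sup>2 * ?f z"] w_int
    by (simp add: phase_def particle_density_def)
  have "(LINT z|phase. (norm (snd z - u_c u t))\<^sup>2 * ?f z)
      \<le> (LINT z|phase. 2 * ((norm (u t (fst z) - snd z))\<^sup>2 * ?f z) + 2 * ((norm (w (fst z)))\<^sup>2 * ?f z))"
  proof (rule integral_mono)
    show "integrable phase (\<lambda>z. (norm (snd z - u_c u t))\<^sup>2 * ?f z)"
      by (rule shifted_second_moment(1)[OF t])
    show "integrable phase (\<lambda>z. 2 * ((norm (u t (fst z) - snd z))\<^sup>2 * ?f z) + 2 * ((norm (w (fst z)))\<^sup>2 * ?f z))"
      by (intro Bochner_Integration.integrable_add integrable_mult_right slip_integrable w_int t)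
    fix z
    have "norm (snd z - u_c u t) \<le> norm (u t (fst z) - snd z) + norm (w (fst z))"
      using norm_triangle_ineq4[of "w (fst z)" "u t (fst z) - snd z"] by (simp add: w_def)
    then have "(norm (snd z - u_c u t))\<^sup>2 \<le> (norm (u t (fst z) - snd z) + norm (w (fst z)))\<^sup>2"
      by (intro power_mono) auto
    also have "\<dots> \<le> 2 * (norm (u t (fst z) - snd z))\<^sup>2 + 2 * (norm (w (fst z)))\<^sup>2"
      using zero_le_power2[of "norm (u t (fst z) - snd z) - norm (w (fst z))"]
      by (simp add: power2_sum power2_diff)
    finally have "(norm (snd z - u_c u t))\<^sup>2 * ?f z \<le> (2 * (norm (u t (fst z) - snd z))\<^sup>2 + 2 * (norm (w (fst z)))\<^sup>2) * ?f z"
      by (intro mult_right_mono f_nonneg t)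
    then show "(norm (snd z - u_c u t))\<^sup>2 * ?f z \<le> 2 * ((norm (u t (fst z) - snd z))\<^sup>2 * ?f z) + 2 * ((norm (w (fst z)))\<^sup>2 * ?f z)"
      by (simp add: algebra_simps)
  qed
  also have "\<dots> = 2 * drag_dissipation f u t + 2 * (LINT x|torus. (norm (w x))\<^sup>2 * particle_density f t x)"
    unfolding drag_dissipation_eq wr[symmetric]
    using slip_integrable(2)[OF t] w_int by (subst Bochner_Integration.integral_add) auto
  finally have Y: "(LINT z|phase. (norm (snd z - u_c u t))\<^sup>2 * ?f z)
      \<le> 2 * drag_dissipation f u t + 2 * (LINT x|torus. (norm (w x))\<^sup>2 * particle_density f t x)" .
  \<comment> \<open>The second moment about u_c contains both the particle variance and |u_c -
    v_c|^2. Half of it therefore covers the first and the last term of the modulated energy.\<close>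
  have "(LINT z|phase. (norm (snd z - u_c u t))\<^sup>2 * ?f z)
      = (LINT z|phase. (norm (snd z - v_c f t))\<^sup>2 * ?f z) + (norm (u_c u t - v_c f t))\<^sup>2"
  proof -
    have "(norm (u_c u t - v_c f t))\<^sup>2 = (norm (u_c u t))\<^sup>2 + (norm (v_c f t))\<^sup>2 - 2 * (u_c u t \<bullet> v_c f t)"
      and "v_c f t \<bullet> v_c f t = (norm (v_c f t))\<^sup>2"
      unfolding power2_norm_eq_inner by (simp_all add: inner_diff_left inner_diff_right inner_commute)
    then show ?thesis
      using shifted_second_moment(2)[OF t, of "u_c u t"] shifted_second_moment(2)[OF t, of "v_c f t"] by linarith
  qed
  then show ?thesis
    using Y zero_le_power2[of "norm (u_c u t - v_c f t)"]
    unfolding modulated_energy_def case_prod_unfold w_def by linarith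
qed

lemma viscous_dissipation_eq:
  "viscous_dissipation \<mu> p u s = \<mu> * (LINT x|torus. norm (sym_grad (u s) x) powr p)"
  by (simp add: viscous_dissipation_def)

lemma drag_dissipation_nonneg: "0 \<le> s \<Longrightarrow> 0 \<le> drag_dissipation f u s"
  unfolding drag_dissipation_eq by (intro integral_nonneg_AE AE_I2) (simp add: f_nonneg)

definition dissipation :: "real \<Rightarrow> real" where
  "dissipation s = viscous_dissipation \<mu> p u s + drag_dissipation f u s"

lemma dissipation_integrable: "0 \<le> t \<Longrightarrow> set_integrable lborel {0..t} dissipation"
  using balance unfolding energy_balance_def dissipation_def[abs_def] by (auto intro: set_integral_add)

text \<open>Constancy of the total momentum makes differences of modulated energy and energy agree;
  the balance from time 0 is then localized to [s, t].\<close>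

lemma modulated_energy_difference:
  assumes s: "0 \<le> s" "s \<le> t"
  shows "set_integrable lborel {s..t} dissipation"
    and "modulated_energy f u s - modulated_energy f u t = (LINT \<tau>:{s..t}|lborel. dissipation \<tau>)"
proof -
  have t: "0 \<le> t" using s by simp
  show st: "set_integrable lborel {s..t} dissipation"
    by (rule set_integrable_subset[OF dissipation_integrable[OF t]]) (use s in auto)
  have E: "modulated_energy f u 0 - modulated_energy f u r = integral {0..r} dissipation" if r: "0 \<le> r" for r
  proof -
    have v: "set_integrable lborel {0..r} (viscous_dissipation \<mu> p u)"
      and d: "set_integrable lborel {0..r} (drag_dissipation f u)"
      and b: "energy f u r + (LINT s:{0..r}|lborel. viscous_dissipation \<mu> p u s)
       + (LINT s:{0..r}|lborel. drag_dissipation f u s) = energy f u 0"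
      using balance r unfolding energy_balance_def by blast+
    have "(LINT s:{0..r}|lborel. dissipation s)
        = (LINT s:{0..r}|lborel. viscous_dissipation \<mu> p u s) + (LINT s:{0..r}|lborel. drag_dissipation f u s)"
      unfolding dissipation_def by (rule set_integral_add(2)[OF v d])
    moreover have "modulated_energy f u 0 - modulated_energy f u r = energy f u 0 - energy f u r"
      using total_momentum[OF r] r by (simp add: modulated_energy_eq)
    ultimately show ?thesis
      using b set_borel_integral_eq_integral(2)[OF dissipation_integrable[OF r]] by simp
  qed
  have "integral {0..s} dissipation + integral {s..t} dissipation = integral {0..t} dissipation"
    using s by (intro Henstock_Kurzweil_Integration.integral_combine set_borel_integral_eq_integral dissipation_integrable t)
  then show "modulated_energy f u s - modulated_energy f u t = (LINT \<tau>:{s..t}|lborel. dissipation \<tau>)"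
    using E[OF s(1)] E[OF t] set_borel_integral_eq_integral(2)[OF st] by simp
qed

end

section \<open>Dissipation dominates a power of the modulated energy\<close>

lemma Lr_norm_le_one: "Lr_norm_le r (\<lambda>x. 1) 1"
  unfolding Lr_norm_le_def by (simp add: cper_integrable cper_const)

lemma powr_add_le:
  fixes x y :: real
  assumes "0 \<le> x" "0 \<le> y" "0 \<le> a"
  shows "(x + y) powr a \<le> 2 powr a * (x powr a + y powr a)"
proof -
  have "(x + y) powr a \<le> (2 * max x y) powr a" using assms by (intro powr_mono2) auto
  also have "\<dots> = 2 powr a * max x y powr a" using assms by (simp add: powr_mult)
  also have "\<dots> \<le> 2 powr a * (x powr a + y powr a)" by (intro mult_left_mono) (auto simp: max_def)
  finally show ?thesis .
qed

context regular_solution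
begin

lemma dissipation_nonneg:
  assumes "0 < \<mu>" "0 \<le> s"
  shows "0 \<le> dissipation s"
  unfolding dissipation_def viscous_dissipation_eq
  using assms drag_dissipation_nonneg[OF assms(2)] by (simp add: torus_integral_nonneg)

lemma modulated_energy_antimono:
  assumes "0 < \<mu>" "0 \<le> s" "s \<le> t"
  shows "modulated_energy f u t \<le> modulated_energy f u s"
proof -
  have "0 \<le> (LINT \<tau>:{s..t}|lborel. dissipation \<tau>)"
    unfolding set_lebesgue_integral_def
    by (intro integral_nonneg_AE AE_I2) (use dissipation_nonneg assms in \<open>auto simp: indicator_def\<close>)
  then show ?thesis using modulated_energy_difference(2)[OF assms(2,3)] by simp
qed

lemma dissipation_lower_bound:
  assumes \<mu>: "0 < \<mu>" and p: "6/5 \<le> p" and adm: "admissible_exponent p r"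
    and dens: "Linf_Lr r (particle_density f)"
  shows "\<exists>c>0. AE t in lborel. 0 < t \<longrightarrow> c * modulated_energy f u t powr (max 1 (p/2)) \<le> dissipation t"
proof -
  let ?E = "modulated_energy f u"
  obtain M where "AE t in restrict_space lborel {0<..}. Lr_norm_le r (particle_density f t) M"
    using dens unfolding Linf_Lr_def by blast
  then have M: "AE t in lborel. 0 < t \<longrightarrow> Lr_norm_le r (particle_density f t) M"
    by (subst (asm) AE_restrict_space_iff) auto
  \<comment> \<open>\<open>max M 1\<close> admits both the particle density and the constant density
    1; \<open>2 * ?E 0\<close> bounds int |w|^2 at all times.\<close>
  obtain K where K: "0 \<le> K" "density_bound p r (max M 1) (2 * ?E 0) K"
    using density_bound[OF p adm] by blast
  define m where "m = min 1 (2/p)"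
  have bound: "?E t \<le> drag_dissipation f u t + 3/2 * K * (LINT x|torus. norm (sym_grad (u t) x) powr p) powr m"
    if t: "0 < t" and L: "Lr_norm_le r (particle_density f t) M" for t
  proof -
    have t0: "0 \<le> t" using t by simp
    let ?w = "\<lambda>x. u t x - u_c u t"
    let ?D = "LINT x|torus. norm (sym_grad (u t) x) powr p"
    have w: "C1_field ?w" by (rule C1_field_minus_const(1)[OF u_C1_field[OF t0]])
    have mean: "(LINT x|torus. ?w x $ i) = 0" for i
    proof -
      have int: "integrable torus (u t)" by (intro torus_integrable u_continuous[OF t0] continuous_on_id)
      have "(LINT x|torus. u t x $ i) = u_c u t $ i"
        using integral_bounded_linear[OF bounded_linear_vec_nth[of i] int] by (simp add: u_c_def)
      moreover have "(LINT x|torus. u t x $ i - u_c u t $ i) = (LINT x|torus. u t x $ i) - (LINT x|torus. u_c u t $ i)"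
        by (intro Bochner_Integration.integral_diff integrable_bounded_linear[OF bounded_linear_vec_nth int] cper_integrable cper_const)
      ultimately show ?thesis by simp
    qed
    have A: "(LINT x|torus. (norm (?w x))\<^sup>2) \<le> 2 * ?E 0"
      using modulated_energy_nonneg(2)[OF t0] modulated_energy_antimono[OF \<mu> order_refl t0] by linarith
    have app: "(LINT x|torus. (norm (?w x))\<^sup>2 * \<rho> x) \<le> K * ?D powr m"
      if "\<forall>x. 0 \<le> \<rho> x" "integrable torus \<rho>" "(LINT x|torus. \<rho> x) = 1" "Lr_norm_le r \<rho> (max M 1)" for \<rho>
    proof -
      have "(LINT x|torus. (norm (?w x))\<^sup>2 * \<rho> x) \<le> K * (LINT x|torus. norm (sym_grad ?w x) powr p) powr m"
        unfolding m_def
        by (rule K(2)[unfolded density_bound_def, THEN spec, THEN spec, THEN mp, THEN mp, THEN mp, THEN mp, THEN mp, THEN mp, THEN mp])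
          (use w mean A that in simp_all)
      then show ?thesis by (simp only: C1_field_minus_const(2)[OF u_C1_field[OF t0]])
    qed
    have "(LINT x|torus. (norm (?w x))\<^sup>2 * particle_density f t x) \<le> K * ?D powr m"
      using density_facts[OF t0] Lr_norm_le_mono[OF L, of "max M 1"] by (intro app) auto
    \<comment> \<open>The unweighted term is the case of constant density 1; with its coefficient
      1/2 the total constant becomes 3/2 K.\<close>
    moreover have "(LINT x|torus. (norm (?w x))\<^sup>2 * 1) \<le> K * ?D powr m"
      using Lr_norm_le_mono[OF Lr_norm_le_one, of "max M 1"] by (intro app) (auto simp: cper_integrable cper_const)
    ultimately show ?thesis
      using modulated_energy_bound[OF t0] by simp
  qed
  let ?a = "max 1 (p/2)"
  \<comment> \<open>The powers are reciprocal, so raising the bound to the power \<open>?a\<close>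
    makes the viscous part linear in the dissipation.\<close>
  have am: "m * ?a = 1" using p by (auto simp: m_def min_def max_def field_simps)
  have a0: "1 \<le> ?a" by simp
  \<comment> \<open>The first summand serves times with drag dissipation at most 1, where its power
    \<open>?a\<close> is below itself; the second serves the others, where the energy is at most
    E(0) and the dissipation at least 1.\<close>
  define L where "L = 2 powr ?a * (1 + (3/2 * K) powr ?a / \<mu>) + ?E 0 powr ?a"
  have L0: "0 < L" unfolding L_def using \<mu> by (intro add_pos_nonneg mult_pos_pos) auto
  have main: "?E t powr ?a \<le> L * dissipation t"
    if t: "0 < t" and Lr: "Lr_norm_le r (particle_density f t) M" for t
  proof -
    have t0: "0 \<le> t" using t by simp
    let ?D = "LINT x|torus. norm (sym_grad (u t) x) powr p"
    let ?d = "drag_dissipation f u t"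
    have D0: "0 \<le> ?D" by (simp add: torus_integral_nonneg)
    have d0: "0 \<le> ?d" by (rule drag_dissipation_nonneg[OF t0])
    have diss: "dissipation t = \<mu> * ?D + ?d" by (simp add: dissipation_def viscous_dissipation_eq)
    have E0: "0 \<le> ?E t" by (rule modulated_energy_nonneg(1)[OF t0])
    show ?thesis
    proof (cases "?d \<le> 1")
      case True
      have "?E t powr ?a \<le> (?d + 3/2 * K * ?D powr m) powr ?a"
        using bound[OF t Lr] E0 by (intro powr_mono2) auto
      also have "\<dots> \<le> 2 powr ?a * (?d powr ?a + (3/2 * K * ?D powr m) powr ?a)"
        using d0 K(1) by (intro powr_add_le) auto
      also have "(3/2 * K * ?D powr m) powr ?a = (3/2 * K) powr ?a * ?D"
        using K(1) D0 by (simp only: powr_mult powr_powr am powr_one)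
      also have "?d powr ?a \<le> ?d"
        using powr_mono'[OF a0 d0 True] d0 by simp
      also have "2 powr ?a * (?d + (3/2 * K) powr ?a * ?D)
          \<le> 2 powr ?a * ((1 + (3/2 * K) powr ?a / \<mu>) * dissipation t)"
      proof (rule mult_left_mono)
        have "(3/2 * K) powr ?a * ?D = (3/2 * K) powr ?a / \<mu> * (\<mu> * ?D)" using \<mu> by simp
        also have "\<dots> \<le> (3/2 * K) powr ?a / \<mu> * dissipation t"
          using d0 \<mu> by (intro mult_left_mono) (auto simp: diss)
        finally have "(3/2 * K) powr ?a * ?D \<le> (3/2 * K) powr ?a / \<mu> * dissipation t" .
        moreover have "?d \<le> dissipation t" using \<mu> D0 by (simp add: diss)
        ultimately show "?d + (3/2 * K) powr ?a * ?D \<le> (1 + (3/2 * K) powr ?a / \<mu>) * dissipation t"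
          by (simp add: distrib_right)
      qed simp
      also have "\<dots> \<le> L * dissipation t"
        unfolding L_def using dissipation_nonneg[OF \<mu> t0] by (simp add: distrib_right mult.assoc)
      finally show ?thesis by simp
    next
      case False
      have 1: "1 \<le> dissipation t" using False \<mu> D0 by (simp add: diss add_increasing)
      have "?E t powr ?a \<le> ?E 0 powr ?a"
        using modulated_energy_antimono[OF \<mu> order_refl t0] E0 by (intro powr_mono2) auto
      also have "\<dots> \<le> L" unfolding L_def using \<mu> by simp
      also have "\<dots> \<le> L * dissipation t" using 1 L0 by simp
      finally show ?thesis .
    qed
  qed
  have "AE t in lborel. 0 < t \<longrightarrow> 1/L * ?E t powr ?a \<le> dissipation t"
    using M
  proof eventually_elim
    case (elim t)
    then show ?case using main[of t] L0 by (auto simp: field_simps)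
  qed
  then show ?thesis using L0 by (intro exI[of _ "1/L"]) simp
qed

text \<open>Within [s, t] the energy is at least its value at t, so the lower bound on the
  dissipation can be frozen there and integrated as a constant. This is the increment form that the
  decay lemmas expect.\<close>

lemma modulated_energy_decrease:
  assumes \<mu>: "0 < \<mu>" and c: "0 < c" and a: "0 \<le> a"
    and lower: "AE t in lborel. 0 < t \<longrightarrow> c * modulated_energy f u t powr a \<le> dissipation t"
    and s: "0 \<le> s" "s \<le> t"
  shows "c * (t - s) * modulated_energy f u t powr a \<le> modulated_energy f u s - modulated_energy f u t"
proof -
  let ?E = "modulated_energy f u"
  let ?k = "c * ?E t powr a"
  have ck: "set_integrable lborel {s..t} (\<lambda>\<tau>. ?k)"
    by (intro borel_integrable_atLeastAtMost' continuous_on_const)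
  have "(LINT \<tau>:{s..t}|lborel. ?k) \<le> (LINT \<tau>:{s..t}|lborel. dissipation \<tau>)"
    unfolding set_lebesgue_integral_def
  proof (rule integral_mono_AE)
    show "integrable lborel (\<lambda>\<tau>. indicator {s..t} \<tau> *\<^sub>R ?k)"
      using ck by (simp add: set_integrable_def)
    show "integrable lborel (\<lambda>\<tau>. indicator {s..t} \<tau> *\<^sub>R dissipation \<tau>)"
      using modulated_energy_difference(1)[OF s] by (simp add: set_integrable_def)
    show "AE \<tau> in lborel. indicator {s..t} \<tau> *\<^sub>R ?k \<le> indicator {s..t} \<tau> *\<^sub>R dissipation \<tau>"
      \<comment> \<open>The lower bound is known for positive times only; time 0 is discarded as a
        null set.\<close>
      using lower AE_lborel_singleton[of 0]
    proof eventually_elim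
      case (elim \<tau>)
      show ?case
      proof (cases "\<tau> \<in> {s..t}")
        case True
        with elim s have \<tau>: "0 < \<tau>" "\<tau> \<le> t" by auto
        have "?k \<le> c * ?E \<tau> powr a"
          using c a \<tau> modulated_energy_antimono[OF \<mu>, of \<tau> t] modulated_energy_nonneg(1)[of t]
          by (intro mult_left_mono powr_mono2) auto
        with elim \<tau> True show ?thesis by simp
      qed simp
    qed
  qed
  moreover have "(LINT \<tau>:{s..t}|lborel. ?k) = (t - s) * ?k"
    using s by (simp add: set_lebesgue_integral_def)
  ultimately show ?thesis
    unfolding modulated_energy_difference(2)[OF s] by (simp only: mult_ac)
qed

end

theorem theorem1p2:
  fixes \<mu> p :: real and r :: ereal
    and f :: "real \<Rightarrow> real^3 \<Rightarrow> real^3 \<Rightarrow> real"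
    and u :: "real \<Rightarrow> real^3 \<Rightarrow> real^3"
    and \<pi> :: "real \<Rightarrow> real^3 \<Rightarrow> real"
  assumes "\<mu> > 0" and "6/5 \<le> p"
    and "sufficiently_regular_solution \<mu> p f u \<pi>"
    and "admissible_exponent p r"
    and "Linf_Lr r (particle_density f)"
  shows "\<exists>C\<^sub>0>0. \<forall>t\<ge>0. modulated_energy f u t \<le>
    (if p > 2 then
       (if modulated_energy f u 0 = 0 then 0
        else (modulated_energy f u 0 powr ((2 - p) / 2) + C\<^sub>0 * (p/2 - 1) * t) powr (- (2 / (p - 2))))
     else modulated_energy f u 0 * exp (- C\<^sub>0 * t))"
proof -
  interpret regular_solution \<mu> p f u \<pi>
    using assms(3) by unfold_locales
  let ?E = "modulated_energy f u"
  obtain c where c: "0 < c" and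
    lower: "AE t in lborel. 0 < t \<longrightarrow> c * ?E t powr (max 1 (p/2)) \<le> dissipation t"
    using dissipation_lower_bound assms by blast
  note dec = modulated_energy_decrease[OF assms(1) c _ lower]
  show ?thesis
  proof (cases "p > 2")
    case True
    then have mx: "max 1 (p/2) = p/2" by simp
    \<comment> \<open>Algebraic decay is applied with exponent a = p/2; these identities rewrite 1 -
      a and -1/(a - 1) in the form of the claim, with C_0 = c/4.\<close>
    have ex: "1 - p/2 = (2 - p)/2" "- (1 / (p/2 - 1)) = - (2 / (p - 2))"
      using True by (simp_all add: field_simps)
    have "?E t \<le> (if ?E 0 = 0 then 0 else (?E 0 powr (1 - p/2) + c/4 * (p/2 - 1) * t) powr (- (1 / (p/2 - 1))))"
      if "0 \<le> t" for t
      using True dec unfolding mx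
      by (intro algebraic_decay[OF c _ modulated_energy_nonneg(1)] that) auto
    then show ?thesis
      using True c unfolding ex by (intro exI[of _ "c/4"]) simp
  next
    case False
    then have mx: "max 1 (p/2) = 1" by simp
    have "?E t \<le> ?E 0 * exp (- (c/2) * t)" if "0 \<le> t" for t
    proof (rule exponential_decay[OF c modulated_energy_nonneg(1) _ that])
      fix s t :: real assume s: "0 \<le> s" "s \<le> t"
      then show "c * (t - s) * ?E t \<le> ?E s - ?E t"
        using dec[of s t] modulated_energy_nonneg(1)[of t] unfolding mx by simp
    qed
    then show ?thesis
      using False c by (intro exI[of _ "c/2"]) auto
  qed
qed

end
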